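(* Let $M$ be a connected $7$-manifold (not necessarily compact) with a torsion-free $G_2$-structure $\varphi$, let $D$ be the Levi-Civita connection of $g_\varphi$, and let $\Gamma$ be the set of torsion-free $G_2$-structures on $M$ that generate the same metric $g_\varphi$ and the same orientation as $\varphi$. Let $p\in M$, let $f$ be a frame at $p$ adapted to a torsion-free $G_2$-structure in $\Gamma$, and let $$N_f=\{g\in SO(7)\mid g^{-1}\,\mathrm{Hol}_f(D)\,g\subset G_2\}.$$ Then the map $N_f/G_2\longrightarrow\Gamma$ given by $h\,G_2\mapsto[f.h]$ is a bijection.
   Context: On $\mathbb{R}^7$ put $\varphi_0 = dx_{123}+dx_{145}+dx_{167}+dx_{246}-dx_{257}-dx_{347}-dx_{356}$, where $dx_{ijk}=dx_i\wedge dx_j\wedge dx_k$; $G_2\subset SO(7)$ is the stabilizer of $\varphi_0$. A $G_2$-structure on a $7$-manifold $M$ is a smooth $3$-form $\varphi$ such that near each point there are local frames, viewed pointwise as linear isomorphisms $f:T_pM\to\mathbb{R}^7$, with $\varphi=f^*\varphi_0$ (such frames are called adapted); equivalently, it is a principal $G_2$-sub-bundle of the frame bundle. Since $G_2\subset SO(7)$, $\varphi$ generates a unique Riemannian metric $g_\varphi$ and orientation (pulled back from $\mathbb{R}^7$ by adapted frames). $\varphi$ is torsion-free if $D\varphi=0$ for the Levi-Civita connection $D$ of $g_\varphi$. For a frame $f:T_pM\to\mathbb{R}^7$ and $h\in GL(7,\mathbb{R})$, the right action is $f.h=h^{-1}\circ f$. $\mathrm{Hol}_f(D)\subset GL(7,\mathbb{R})$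 is the group of all $f\circ P_\gamma\circ f^{-1}$, where $P_\gamma$ is $D$-parallel transport around a loop $\gamma$ at $p$. $N_f/G_2$ is the set of cosets $hG_2$, $h\in N_f$ ($N_f$ need not be a group). For a frame $\tilde f$ at $p$ adapted to the $SO(7)$-structure of $\Gamma$ with $\mathrm{Hol}_{\tilde f}(D)\subset G_2$, $[\tilde f]=\{\tilde f.h\mid h\in G_2\}$ is its $G_2$-orbit, identified with the torsion-free $G_2$-structure on $M$ obtained from it by $D$-parallel translation, i.e. with the unique $D$-parallel $3$-form on $M$ whose value at $p$ is $\tilde f^*\varphi_0$. *)

theory Defs
  imports "HOL-Analysis.Analysis" "HOL-Library.Function_Algebras"
begin

section \<open>Pointwise vector space structure on functions\<close>

instantiation "fun" :: (type, real_vector) real_vector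
begin

definition scaleR_fun :: "real \<Rightarrow> ('a \<Rightarrow> 'b) \<Rightarrow> 'a \<Rightarrow> 'b"
  where "scaleR_fun r f = (\<lambda>x. r *\<^sub>R f x)"

instance
  by standard (auto simp: scaleR_fun_def plus_fun_def fun_eq_iff algebra_simps)

end


section \<open>Smooth manifolds of dimension 7\<close>

text \<open>
  \<open>Ck_on k S f\<close> and \<open>smooth_on S f\<close> are meant for open sets \<open>S\<close>.
\<close>

fun Ck_on :: "nat \<Rightarrow> 'a::euclidean_space set \<Rightarrow> ('a \<Rightarrow> 'b::real_normed_vector) \<Rightarrow> bool" where
  "Ck_on 0 S f \<longleftrightarrow> continuous_on S f"
| "Ck_on (Suc k) S f \<longleftrightarrow>
     (\<forall>x\<in>S. f differentiable (at x)) \<and> (\<forall>v. Ck_on k S (\<lambda>x. frechet_derivative f (at x) v))"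

definition smooth_on :: "'a::euclidean_space set \<Rightarrow> ('a \<Rightarrow> 'b::real_normed_vector) \<Rightarrow> bool" where
  "smooth_on S f \<longleftrightarrow> (\<forall>k. Ck_on k S f)"

text \<open>
  A chart is a pair of an open set and a coordinate map; the values of the map outside the
  set are irrelevant.  A manifold is a whole (Hausdorff, second countable) type together with
  an atlas, which need not be maximal.  The coordinates are indexed by the type \<open>7\<close>, whose
  elements are \<open>1, \<dots>, 7\<close> (with \<open>7 = 0\<close>).
\<close>

type_synonym 'a chart = "'a set \<times> ('a \<Rightarrow> real^7)"

abbreviation dom_chart :: "'a chart \<Rightarrow> 'a set" where "dom_chart c \<equiv> fst c"
abbreviation coord :: "'a chart \<Rightarrow> 'a \<Rightarrow> real^7" where "coord c \<equiv> snd c"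

definition chart_inv :: "'a chart \<Rightarrow> real^7 \<Rightarrow> 'a" where
  "chart_inv c = inv_into (dom_chart c) (coord c)"

definition smooth_atlas :: "'a::topological_space chart set \<Rightarrow> bool" where
  "smooth_atlas \<A> \<longleftrightarrow>
     (\<forall>c\<in>\<A>. open (dom_chart c) \<and> open (coord c ` dom_chart c) \<and>
        homeomorphism (dom_chart c) (coord c ` dom_chart c) (coord c) (chart_inv c)) \<and>
     (\<Union>c\<in>\<A>. dom_chart c) = UNIV \<and>
     (\<forall>c\<in>\<A>. \<forall>c'\<in>\<A>.
        smooth_on (coord c ` (dom_chart c \<inter> dom_chart c')) (coord c' \<circ> chart_inv c))"

definition smooth_fun :: "'a::topological_space chart set \<Rightarrow> 'a set \<Rightarrow> ('a \<Rightarrow> real) \<Rightarrow> bool" where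
  "smooth_fun \<A> W h \<longleftrightarrow> open W \<and>
     (\<forall>c\<in>\<A>. smooth_on (coord c ` (W \<inter> dom_chart c)) (\<lambda>y. h (chart_inv c y)))"


section \<open>Tangent vectors, vector fields, frames\<close>

text \<open>
  A tangent vector at \<open>p\<close> is the family of its component vectors in all charts around \<open>p\<close>,
  subject to the usual transformation law; the components in all other charts are set to \<open>0\<close>,
  so that the tangent space is a linear subspace of the function space.
\<close>

type_synonym 'a tvec = "'a chart \<Rightarrow> real^7"

definition tangent_space :: "'a chart set \<Rightarrow> 'a \<Rightarrow> 'a tvec set" where
  "tangent_space \<A> p =
     {v. (\<forall>c\<in>\<A>. \<forall>c'\<in>\<A>. p \<in> dom_chart c \<longrightarrow> p \<in> dom_chart c' \<longrightarrow>
            v c' = frechet_derivative (coord c' \<circ> chart_inv c) (at (coord c p)) (v c)) \<and>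
         (\<forall>c. \<not> (c \<in> \<A> \<and> p \<in> dom_chart c) \<longrightarrow> v c = 0)}"

text \<open>The tangent vector at \<open>p\<close> with components \<open>v\<close> in the chart \<open>c\<close> around \<open>p\<close>.\<close>

definition coord_vec :: "'a chart set \<Rightarrow> 'a chart \<Rightarrow> 'a \<Rightarrow> real^7 \<Rightarrow> 'a tvec" where
  "coord_vec \<A> c p v = (\<lambda>c'. if c' \<in> \<A> \<and> p \<in> dom_chart c'
      then frechet_derivative (coord c' \<circ> chart_inv c) (at (coord c p)) v else 0)"

definition smooth_vf :: "'a::topological_space chart set \<Rightarrow> 'a set \<Rightarrow> ('a \<Rightarrow> 'a tvec) \<Rightarrow> bool" where
  "smooth_vf \<A> W Y \<longleftrightarrow> open W \<and> (\<forall>q\<in>W. Y q \<in> tangent_space \<A> q) \<and>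
     (\<forall>c\<in>\<A>. smooth_on (coord c ` (W \<inter> dom_chart c)) (\<lambda>y. Y (chart_inv c y) c))"

text \<open>The derivative of \<open>h\<close> at \<open>p\<close> along \<open>X\<close>; it does not depend on the chart chosen.\<close>

definition dir_deriv :: "'a chart set \<Rightarrow> 'a \<Rightarrow> 'a tvec \<Rightarrow> ('a \<Rightarrow> real) \<Rightarrow> real" where
  "dir_deriv \<A> p X h =
     (let c = (SOME c. c \<in> \<A> \<and> p \<in> dom_chart c)
      in frechet_derivative (\<lambda>y. h (chart_inv c y)) (at (coord c p)) (X c))"

definition lie_bracket ::
  "'a chart set \<Rightarrow> ('a \<Rightarrow> 'a tvec) \<Rightarrow> ('a \<Rightarrow> 'a tvec) \<Rightarrow> 'a \<Rightarrow> 'a tvec" where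
  "lie_bracket \<A> X Y p = (\<lambda>c. if c \<in> \<A> \<and> p \<in> dom_chart c then
      frechet_derivative (\<lambda>y. Y (chart_inv c y) c) (at (coord c p)) (X p c) -
      frechet_derivative (\<lambda>y. X (chart_inv c y) c) (at (coord c p)) (Y p c) else 0)"

definition frame :: "'a chart set \<Rightarrow> 'a \<Rightarrow> ('a tvec \<Rightarrow> real^7) \<Rightarrow> bool" where
  "frame \<A> p f \<longleftrightarrow> bij_betw f (tangent_space \<A> p) UNIV \<and>
     (\<forall>u\<in>tangent_space \<A> p. \<forall>v\<in>tangent_space \<A> p. f (u + v) = f u + f v) \<and>
     (\<forall>a. \<forall>u\<in>tangent_space \<A> p. f (a *\<^sub>R u) = a *\<^sub>R f u)"

definition smooth_frame ::
  "'a::topological_space chart set \<Rightarrow> 'a set \<Rightarrow> ('a \<Rightarrow> 'a tvec \<Rightarrow> real^7) \<Rightarrow> bool" where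
  "smooth_frame \<A> W F \<longleftrightarrow> open W \<and> (\<forall>q\<in>W. frame \<A> q (F q)) \<and>
     (\<forall>c\<in>\<A>. \<forall>v. smooth_on (coord c ` (W \<inter> dom_chart c))
        (\<lambda>y. F (chart_inv c y) (coord_vec \<A> c (chart_inv c y) v)))"

definition frame_act :: "('a tvec \<Rightarrow> real^7) \<Rightarrow> real^7^7 \<Rightarrow> 'a tvec \<Rightarrow> real^7" where
  "frame_act f h = (\<lambda>v. matrix_inv h *v f v)"


section \<open>Three-forms\<close>

text \<open>
  A 3-form is a function of a point and three tangent vectors at this point, set to \<open>0\<close> when
  one of the arguments is not tangent at the point; equality of 3-forms is thus equality of
  functions.  Linearity in the second and third argument follows from antisymmetry.
\<close>

type_synonym 'a form3 = "'a \<Rightarrow> 'a tvec \<Rightarrow> 'a tvec \<Rightarrow> 'a tvec \<Rightarrow> real"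

definition alt3_at ::
  "'a chart set \<Rightarrow> 'a \<Rightarrow> ('a tvec \<Rightarrow> 'a tvec \<Rightarrow> 'a tvec \<Rightarrow> real) \<Rightarrow> bool" where
  "alt3_at \<A> p \<omega> \<longleftrightarrow>
     (let T = tangent_space \<A> p in
       (\<forall>u\<in>T. \<forall>u'\<in>T. \<forall>v\<in>T. \<forall>w\<in>T. \<omega> (u + u') v w = \<omega> u v w + \<omega> u' v w) \<and>
       (\<forall>a. \<forall>u\<in>T. \<forall>v\<in>T. \<forall>w\<in>T. \<omega> (a *\<^sub>R u) v w = a * \<omega> u v w) \<and>
       (\<forall>u\<in>T. \<forall>v\<in>T. \<forall>w\<in>T. \<omega> v u w = - \<omega> u v w \<and> \<omega> u w v = - \<omega> u v w) \<and>
       (\<forall>u v w. \<not> (u \<in> T \<and> v \<in> T \<and> w \<in> T) \<longrightarrow> \<omega> u v w = 0))"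

definition smooth_form3 :: "'a::topological_space chart set \<Rightarrow> 'a form3 \<Rightarrow> bool" where
  "smooth_form3 \<A> \<phi> \<longleftrightarrow> (\<forall>p. alt3_at \<A> p (\<phi> p)) \<and>
     (\<forall>c\<in>\<A>. \<forall>u v w. smooth_on (coord c ` dom_chart c)
        (\<lambda>y. let q = chart_inv c y in
           \<phi> q (coord_vec \<A> c q u) (coord_vec \<A> c q v) (coord_vec \<A> c q w)))"


section \<open>The group \<open>G\<^sub>2\<close>\<close>

definition dx3 :: "7 \<Rightarrow> 7 \<Rightarrow> 7 \<Rightarrow> real^7 \<Rightarrow> real^7 \<Rightarrow> real^7 \<Rightarrow> real" where
  "dx3 i j k u v w = det (vector [vector [u $ i, u $ j, u $ k],
                                  vector [v $ i, v $ j, v $ k],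
                                  vector [w $ i, w $ j, w $ k]] :: real^3^3)"

definition \<phi>\<^sub>0 :: "real^7 \<Rightarrow> real^7 \<Rightarrow> real^7 \<Rightarrow> real" where
  "\<phi>\<^sub>0 u v w = dx3 1 2 3 u v w + dx3 1 4 5 u v w + dx3 1 6 7 u v w + dx3 2 4 6 u v w
              - dx3 2 5 7 u v w - dx3 3 4 7 u v w - dx3 3 5 6 u v w"

text \<open>The full stabilizer in \<open>GL(7,\<real>)\<close>; that it lies in \<open>SO(7)\<close> is a theorem.\<close>

definition G2 :: "(real^7^7) set" where
  "G2 = {h. invertible h \<and> (\<forall>u v w. \<phi>\<^sub>0 (h *v u) (h *v v) (h *v w) = \<phi>\<^sub>0 u v w)}"

definition pullback_\<phi>\<^sub>0 ::
  "'a chart set \<Rightarrow> 'a \<Rightarrow> ('a tvec \<Rightarrow> real^7) \<Rightarrow> 'a tvec \<Rightarrow> 'a tvec \<Rightarrow> 'a tvec \<Rightarrow> real" where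
  "pullback_\<phi>\<^sub>0 \<A> p f = (\<lambda>u v w.
     if u \<in> tangent_space \<A> p \<and> v \<in> tangent_space \<A> p \<and> w \<in> tangent_space \<A> p
     then \<phi>\<^sub>0 (f u) (f v) (f w) else 0)"


section \<open>\<open>G\<^sub>2\<close>-structures, metric and orientation\<close>

definition adapted_frame :: "'a chart set \<Rightarrow> 'a form3 \<Rightarrow> 'a \<Rightarrow> ('a tvec \<Rightarrow> real^7) \<Rightarrow> bool" where
  "adapted_frame \<A> \<phi> p f \<longleftrightarrow> frame \<A> p f \<and> \<phi> p = pullback_\<phi>\<^sub>0 \<A> p f"

definition G2_structure :: "'a::topological_space chart set \<Rightarrow> 'a form3 \<Rightarrow> bool" where
  "G2_structure \<A> \<phi> \<longleftrightarrow> smooth_form3 \<A> \<phi> \<and>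
     (\<forall>p. \<exists>W F. p \<in> W \<and> smooth_frame \<A> W F \<and> (\<forall>q\<in>W. adapted_frame \<A> \<phi> q (F q)))"

text \<open>
  The metric at \<open>p\<close> is pulled back from the Euclidean one by an adapted frame; the choice of
  the frame does not matter because \<open>G\<^sub>2 \<subseteq> SO(7)\<close>.  It is only meaningful on tangent vectors
  at \<open>p\<close>.
\<close>

definition G2_metric :: "'a chart set \<Rightarrow> 'a form3 \<Rightarrow> 'a \<Rightarrow> 'a tvec \<Rightarrow> 'a tvec \<Rightarrow> real" where
  "G2_metric \<A> \<phi> p u v = (let f = (SOME f. adapted_frame \<A> \<phi> p f) in f u \<bullet> f v)"

text \<open>An orientation is given by the positively oriented frames at each point.\<close>

definition G2_orientation :: "'a chart set \<Rightarrow> 'a form3 \<Rightarrow> 'a \<Rightarrow> ('a tvec \<Rightarrow> real^7) set" where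
  "G2_orientation \<A> \<phi> p = {f. frame \<A> p f \<and>
     (\<exists>f'. adapted_frame \<A> \<phi> p f' \<and> det (matrix (f \<circ> inv_into (tangent_space \<A> p) f')) > 0)}"


section \<open>Connections\<close>

text \<open>
  A connection acts on a tangent vector \<open>X\<close> at \<open>p\<close> and on a vector field \<open>Y\<close> that is smooth
  near \<open>p\<close> (and arbitrary elsewhere), depending on \<open>Y\<close> only through its germ at \<open>p\<close>.
  The value of \<open>D p X Y\<close> for other arguments is unspecified.
\<close>

type_synonym 'a conn = "'a \<Rightarrow> 'a tvec \<Rightarrow> ('a \<Rightarrow> 'a tvec) \<Rightarrow> 'a tvec"

locale connection =
  fixes \<A> :: "'a::topological_space chart set" and D :: "'a conn"
  assumes in_tangent_space: "\<lbrakk>smooth_vf \<A> W Y; p \<in> W; X \<in> tangent_space \<A> p\<rbrakk> \<Longrightarrow>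
      D p X Y \<in> tangent_space \<A> p"
    and local: "\<lbrakk>smooth_vf \<A> W Y; p \<in> W; X \<in> tangent_space \<A> p; \<And>q. q \<in> W \<Longrightarrow> Z q = Y q\<rbrakk> \<Longrightarrow>
      D p X Z = D p X Y"
    and add_left: "\<lbrakk>smooth_vf \<A> W Y; p \<in> W; X \<in> tangent_space \<A> p; X' \<in> tangent_space \<A> p\<rbrakk> \<Longrightarrow>
      D p (X + X') Y = D p X Y + D p X' Y"
    and scale_left: "\<lbrakk>smooth_vf \<A> W Y; p \<in> W; X \<in> tangent_space \<A> p\<rbrakk> \<Longrightarrow>
      D p (a *\<^sub>R X) Y = a *\<^sub>R D p X Y"
    and add_right: "\<lbrakk>smooth_vf \<A> W Y; smooth_vf \<A> W Z; p \<in> W; X \<in> tangent_space \<A> p\<rbrakk> \<Longrightarrow>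
      D p X (\<lambda>q. Y q + Z q) = D p X Y + D p X Z"
    and Leibniz: "\<lbrakk>smooth_fun \<A> W h; smooth_vf \<A> W Y; p \<in> W; X \<in> tangent_space \<A> p\<rbrakk> \<Longrightarrow>
      D p X (\<lambda>q. h q *\<^sub>R Y q) = dir_deriv \<A> p X h *\<^sub>R Y p + h p *\<^sub>R D p X Y"
    and smooth: "\<lbrakk>smooth_vf \<A> W Z; smooth_vf \<A> W Y\<rbrakk> \<Longrightarrow> smooth_vf \<A> W (\<lambda>q. D q (Z q) Y)"

locale levi_civita = connection \<A> D
  for \<A> :: "'a::topological_space chart set"
    and g :: "'a \<Rightarrow> 'a tvec \<Rightarrow> 'a tvec \<Rightarrow> real" and D :: "'a conn" +
  assumes torsion_zero: "\<lbrakk>smooth_vf \<A> W Z; smooth_vf \<A> W Y; p \<in> W\<rbrakk> \<Longrightarrow>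
      D p (Z p) Y - D p (Y p) Z = lie_bracket \<A> Z Y p"
    and metric: "\<lbrakk>smooth_vf \<A> W Y; smooth_vf \<A> W Z; p \<in> W; X \<in> tangent_space \<A> p\<rbrakk> \<Longrightarrow>
      dir_deriv \<A> p X (\<lambda>q. g q (Y q) (Z q)) = g p (D p X Y) (Z p) + g p (Y p) (D p X Z)"

text \<open>\<open>D \<phi> = 0\<close> for the induced connection on 3-forms.\<close>

definition parallel_form3 :: "'a::topological_space chart set \<Rightarrow> 'a conn \<Rightarrow> 'a form3 \<Rightarrow> bool" where
  "parallel_form3 \<A> D \<phi> \<longleftrightarrow>
     (\<forall>W p X Y\<^sub>1 Y\<^sub>2 Y\<^sub>3. p \<in> W \<longrightarrow> X \<in> tangent_space \<A> p \<longrightarrow>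
        smooth_vf \<A> W Y\<^sub>1 \<longrightarrow> smooth_vf \<A> W Y\<^sub>2 \<longrightarrow> smooth_vf \<A> W Y\<^sub>3 \<longrightarrow>
        dir_deriv \<A> p X (\<lambda>q. \<phi> q (Y\<^sub>1 q) (Y\<^sub>2 q) (Y\<^sub>3 q))
          - \<phi> p (D p X Y\<^sub>1) (Y\<^sub>2 p) (Y\<^sub>3 p)
          - \<phi> p (Y\<^sub>1 p) (D p X Y\<^sub>2) (Y\<^sub>3 p)
          - \<phi> p (Y\<^sub>1 p) (Y\<^sub>2 p) (D p X Y\<^sub>3) = 0)"

text \<open>
  The Levi-Civita connection is unique on the arguments that matter, so the existential
  quantifier picks out \<^emph>\<open>the\<close> Levi-Civita connection.
\<close>

definition torsion_free_G2_structure :: "'a::topological_space chart set \<Rightarrow> 'a form3 \<Rightarrow> bool" where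
  "torsion_free_G2_structure \<A> \<phi> \<longleftrightarrow> G2_structure \<A> \<phi> \<and>
     (\<exists>D. levi_civita \<A> (G2_metric \<A> \<phi>) D \<and> parallel_form3 \<A> D \<phi>)"


section \<open>Parallel transport and holonomy\<close>

text \<open>The Christoffel symbols of \<open>D\<close> in the chart \<open>c\<close>, as a bilinear map.\<close>

definition christoffel ::
  "'a chart set \<Rightarrow> 'a conn \<Rightarrow> 'a chart \<Rightarrow> 'a \<Rightarrow> real^7 \<Rightarrow> real^7 \<Rightarrow> real^7" where
  "christoffel \<A> D c q v w = D q (coord_vec \<A> c q v) (\<lambda>r. coord_vec \<A> c r w) c"

text \<open>Smoothness on a closed interval is existence of a smooth extension to a larger open one.\<close>

definition smooth_curve_on ::
  "'a::topological_space chart set \<Rightarrow> real \<Rightarrow> real \<Rightarrow> (real \<Rightarrow> 'a) \<Rightarrow> bool" where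
  "smooth_curve_on \<A> a b \<gamma> \<longleftrightarrow>
     (\<exists>e>0. \<exists>\<sigma>. continuous_on {a - e<..<b + e} \<sigma> \<and> (\<forall>t\<in>{a..b}. \<sigma> t = \<gamma> t) \<and>
        (\<forall>c\<in>\<A>. smooth_on {t \<in> {a - e<..<b + e}. \<sigma> t \<in> dom_chart c} (coord c \<circ> \<sigma>)))"

text \<open>
  The equation \<open>D V / dt = 0\<close> for a vector field \<open>V\<close> along \<open>\<gamma>\<close>, written in charts; at the end
  points the derivatives are one-sided.
\<close>

definition parallel_on ::
  "'a chart set \<Rightarrow> 'a conn \<Rightarrow> (real \<Rightarrow> 'a) \<Rightarrow> real \<Rightarrow> real \<Rightarrow> (real \<Rightarrow> 'a tvec) \<Rightarrow> bool" where
  "parallel_on \<A> D \<gamma> a b V \<longleftrightarrow>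
     (\<forall>t\<in>{a..b}. V t \<in> tangent_space \<A> (\<gamma> t) \<and>
        (\<forall>c\<in>\<A>. \<gamma> t \<in> dom_chart c \<longrightarrow>
          ((\<lambda>s. V s c) has_vector_derivative
             - christoffel \<A> D c (\<gamma> t)
                 (vector_derivative (\<lambda>s. coord c (\<gamma> s)) (at t within {a..b})) (V t c))
           (at t within {a..b})))"

definition partition_of_unit_interval :: "nat \<Rightarrow> (nat \<Rightarrow> real) \<Rightarrow> bool" where
  "partition_of_unit_interval n t \<longleftrightarrow> t 0 = 0 \<and> t n = 1 \<and> (\<forall>i<n. t i < t (Suc i))"

definition piecewise_smooth_curve ::
  "'a::topological_space chart set \<Rightarrow> (real \<Rightarrow> 'a) \<Rightarrow> bool" where
  "piecewise_smooth_curve \<A> \<gamma> \<longleftrightarrow>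
     (\<exists>n t. partition_of_unit_interval n t \<and>
        (\<forall>i<n. smooth_curve_on \<A> (t i) (t (Suc i)) \<gamma>))"

definition parallel_along ::
  "'a::topological_space chart set \<Rightarrow> 'a conn \<Rightarrow> (real \<Rightarrow> 'a) \<Rightarrow> (real \<Rightarrow> 'a tvec) \<Rightarrow> bool" where
  "parallel_along \<A> D \<gamma> V \<longleftrightarrow>
     (\<exists>n t. partition_of_unit_interval n t \<and>
        (\<forall>i<n. smooth_curve_on \<A> (t i) (t (Suc i)) \<gamma> \<and>
               parallel_on \<A> D \<gamma> (t i) (t (Suc i)) V))"

definition parallel_transport ::
  "'a::topological_space chart set \<Rightarrow> 'a conn \<Rightarrow> (real \<Rightarrow> 'a) \<Rightarrow> 'a tvec \<Rightarrow> 'a tvec" where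
  "parallel_transport \<A> D \<gamma> v = (THE w. \<exists>V. parallel_along \<A> D \<gamma> V \<and> V 0 = v \<and> V 1 = w)"

definition holonomy_group ::
  "'a::topological_space chart set \<Rightarrow> 'a conn \<Rightarrow> 'a \<Rightarrow> ('a tvec \<Rightarrow> real^7) \<Rightarrow> (real^7^7) set" where
  "holonomy_group \<A> D p f =
     {matrix (f \<circ> parallel_transport \<A> D \<gamma> \<circ> inv_into (tangent_space \<A> p) f) | \<gamma>.
        piecewise_smooth_curve \<A> \<gamma> \<and> \<gamma> 0 = p \<and> \<gamma> 1 = p}"


section \<open>The two sides of the correspondence\<close>

definition same_metric_G2_structures ::
  "'a::topological_space chart set \<Rightarrow> 'a form3 \<Rightarrow> 'a form3 set" where
  "same_metric_G2_structures \<A> \<phi> = {\<psi>. torsion_free_G2_structure \<A> \<psi> \<and>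
     (\<forall>q. \<forall>u\<in>tangent_space \<A> q. \<forall>v\<in>tangent_space \<A> q.
        G2_metric \<A> \<psi> q u v = G2_metric \<A> \<phi> q u v) \<and>
     (\<forall>q. G2_orientation \<A> \<psi> q = G2_orientation \<A> \<phi> q)}"

definition N_set ::
  "'a::topological_space chart set \<Rightarrow> 'a conn \<Rightarrow> 'a \<Rightarrow> ('a tvec \<Rightarrow> real^7) \<Rightarrow> (real^7^7) set" where
  "N_set \<A> D p f =
     {g. rotation_matrix g \<and> (\<forall>k\<in>holonomy_group \<A> D p f. matrix_inv g ** k ** g \<in> G2)}"

definition G2_coset :: "real^7^7 \<Rightarrow> (real^7^7) set" where
  "G2_coset h = (\<lambda>k. h ** k) ` G2"

definition frame_orbit :: "('a tvec \<Rightarrow> real^7) \<Rightarrow> ('a tvec \<Rightarrow> real^7) set" where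
  "frame_orbit f = frame_act f ` G2"

text \<open>
  The unique \<open>D\<close>-parallel 3-form whose value at \<open>p\<close> is the pullback of \<open>\<phi>\<^sub>0\<close> by the frames of
  a \<open>G\<^sub>2\<close>-orbit.
\<close>

definition parallel_extension ::
  "'a::topological_space chart set \<Rightarrow> 'a conn \<Rightarrow> 'a \<Rightarrow> ('a tvec \<Rightarrow> real^7) set \<Rightarrow> 'a form3" where
  "parallel_extension \<A> D p O\<^sub>f = (THE \<psi>. smooth_form3 \<A> \<psi> \<and> parallel_form3 \<A> D \<psi> \<and>
     (\<forall>f\<in>O\<^sub>f. \<psi> p = pullback_\<phi>\<^sub>0 \<A> p f))"

end

theory Submission
  imports Defs
begin

text \<open>
  Fix \<open>\<psi>\<^sub>0 \<in> \<Gamma>\<close> to which \<open>f\<close> is adapted. Parallel transport from \<open>p\<close> to \<open>q\<close> preserves \<open>\<psi>\<^sub>0\<close>, so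
  in adapted frames it is given by an element of \<open>G\<^sub>2\<close> (\<open>transport_G2\<close>). This also yields that
  transport is well defined, linear and bijective: since \<open>\<phi>\<^sub>0\<close> is nondegenerate, a relation on
  \<open>\<real>\<^sup>7\<close> that is total in both directions and preserves \<open>\<phi>\<^sub>0\<close> is the graph of an element of \<open>G\<^sub>2\<close>
  (\<open>phi0_relation\<close>). A parallel form is determined by its value at \<open>p\<close>
  (\<open>parallel_form_unique\<close>).

  For \<open>h \<in> N\<^sub>f\<close> the pullback of \<open>\<phi>\<^sub>0\<close> by \<open>f.h\<close> is invariant under the holonomy group, hence
  transport along arbitrary curves spreads it to a well-defined form \<open>\<psi>\<close> on \<open>M\<close>
  (\<open>holonomy_invariant_form_exists\<close>). Its smoothness does not rest on smooth dependence of
  differential equations on parameters: transport along coordinate segments to a point \<open>q\<close>, as a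
  function of the starting point, is differentiable at \<open>q\<close> and its derivative is the
  Christoffel symbol (\<open>segment_transport_has_derivative\<close>). So the components of \<open>\<psi>\<close> satisfy the
  equation \<open>D\<psi> = 0\<close>, in which all derivatives of \<open>\<psi>\<close> are linear in \<open>\<psi>\<close> with smooth
  coefficients, and smoothness follows by induction on the order of differentiability. Smooth
  frames adapted to \<open>\<psi>\<close> come from the fact that a \<open>G\<^sub>2\<close>-basis is generated, by cross products, by
  three orthonormal vectors \<open>a, b, d\<close> with \<open>d\<close> orthogonal to \<open>a \<times> b\<close> (\<open>g2_frame_in_G2\<close>,
  \<open>smooth_adapted_frame_exists\<close>). The metric of \<open>\<psi>\<close> is that of \<open>\<psi>\<^sub>0\<close> because \<open>h\<close> is orthogonal and
  \<open>G\<^sub>2 \<subseteq> O(7)\<close> (\<open>G2_orthogonal\<close>), the orientation is the same because \<open>det h > 0\<close>. So \<open>\<psi> \<in> \<Gamma>\<close>.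

  Conversely every \<open>\<psi> \<in> \<Gamma>\<close> is parallel for \<open>D\<close>, since the Levi-Civita connection depends on the
  metric only (\<open>levi_civita_unique\<close>). A frame at \<open>p\<close> adapted to \<open>\<psi>\<close>, chosen in the orientation of
  \<open>f\<close>, is \<open>f.h\<close> for a rotation \<open>h\<close>, and \<open>transport_G2\<close> for \<open>\<psi>\<close> says exactly that \<open>h \<in> N\<^sub>f\<close>. This
  is surjectivity. The map is well defined and injective on cosets because two frames pull \<open>\<phi>\<^sub>0\<close>
  back to the same form iff they differ by an element of \<open>G\<^sub>2\<close>.
\<close>

section \<open>Calculus of \<open>C\<^sup>k\<close> maps\<close>

lemma frechet_derivative_eqI:
  "(f has_derivative f') (at x) \<Longrightarrow> frechet_derivative f (at x) = f'"
  by (metis frechet_derivative_at)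

lemma frechet_derivative_cong_open:
  assumes "open S" "x \<in> S" "\<And>y. y \<in> S \<Longrightarrow> f y = g y"
  shows "frechet_derivative f (at x) = frechet_derivative g (at x)"
    and "f differentiable (at x) \<longleftrightarrow> g differentiable (at x)"
proof -
  have 1: "(f has_derivative F) (at x) \<longleftrightarrow> (g has_derivative F) (at x)" for F
    using assms by (metis has_derivative_transform_within_open)
  show "frechet_derivative f (at x) = frechet_derivative g (at x)"
    unfolding frechet_derivative_def by (simp add: 1)
  show "f differentiable (at x) \<longleftrightarrow> g differentiable (at x)"
    unfolding differentiable_def by (simp add: 1)
qed

lemma Ck_on_cong:
  assumes "open S" "\<And>x. x \<in> S \<Longrightarrow> f x = g x"
  shows "Ck_on k S f \<longleftrightarrow> Ck_on k S g"
  using assms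
proof (induction k arbitrary: f g)
  case 0
  show ?case unfolding Ck_on.simps
    by (rule continuous_on_cong[OF refl]) (rule 0)
next
  case (Suc k)
  have 1: "Ck_on k S (\<lambda>x. frechet_derivative f (at x) v) = Ck_on k S (\<lambda>x. frechet_derivative g (at x) v)" for v
    by (rule Suc.IH[OF Suc.prems(1)]) (metis frechet_derivative_cong_open(1) Suc.prems)
  then show ?case
    using frechet_derivative_cong_open(2)[OF Suc.prems(1) _ Suc.prems(2)] by auto
qed

lemma Ck_on_subset: "Ck_on k S f \<Longrightarrow> T \<subseteq> S \<Longrightarrow> Ck_on k T f"
  by (induction k arbitrary: f) (auto intro: continuous_on_subset)

lemma Ck_on_imp_continuous_on: "Ck_on k S f \<Longrightarrow> continuous_on S f"
  by (cases k) (auto intro!: continuous_at_imp_continuous_on differentiable_imp_continuous_within)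

lemma Ck_on_Suc_imp: "Ck_on (Suc k) S f \<Longrightarrow> Ck_on k S f"
proof (induction k arbitrary: f)
  case 0 then show ?case using Ck_on_imp_continuous_on Ck_on.simps(1) by blast
next
  case (Suc k) then show ?case by (metis Ck_on.simps(2))
qed

lemma Ck_on_SucI:
  assumes "open S" "\<And>x. x \<in> S \<Longrightarrow> (f has_derivative f' x) (at x)"
    and "\<And>v. Ck_on k S (\<lambda>x. f' x v)"
  shows "Ck_on (Suc k) S f"
proof -
  have "Ck_on k S (\<lambda>x. frechet_derivative f (at x) v)" for v
    by (subst Ck_on_cong[OF assms(1), of _ "\<lambda>x. f' x v"])
      (metis assms(2) frechet_derivative_eqI, rule assms(3))
  moreover have "f differentiable (at x)" if "x \<in> S" for x
    using assms(2)[OF that] unfolding differentiable_def by blast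
  ultimately show ?thesis by simp
qed

lemma Ck_on_has_derivative:
  "Ck_on (Suc k) S f \<Longrightarrow> x \<in> S \<Longrightarrow> (f has_derivative frechet_derivative f (at x)) (at x)"
  by (simp add: frechet_derivative_works[symmetric])

lemma Ck_on_const: "open S \<Longrightarrow> Ck_on k S (\<lambda>x. c)"
proof (induction k arbitrary: c)
  case (Suc k) then show ?case by (intro Ck_on_SucI[where f' = "\<lambda>x v. 0"]) auto
qed auto

lemma Ck_on_bounded_linear:
  assumes "open S" "bounded_linear L" shows "Ck_on k S L"
proof (cases k)
  case (Suc n)
  show ?thesis unfolding Suc
    using assms by (intro Ck_on_SucI[where f' = "\<lambda>x v. L v"] Ck_on_const bounded_linear_imp_has_derivative)
qed (use assms in \<open>auto intro: linear_continuous_on\<close>)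

lemma Ck_on_add:
  assumes "open S" shows "Ck_on k S f \<Longrightarrow> Ck_on k S g \<Longrightarrow> Ck_on k S (\<lambda>x. f x + g x)"
proof (induction k arbitrary: f g)
  case (Suc k) then show ?case
    by (intro Ck_on_SucI[OF assms, where f' = "\<lambda>x v. frechet_derivative f (at x) v + frechet_derivative g (at x) v"]
        has_derivative_add Ck_on_has_derivative) auto
qed (auto intro: continuous_intros)

lemma Ck_on_bilinear:
  assumes "bounded_bilinear B" "open S"
  shows "Ck_on k S f \<Longrightarrow> Ck_on k S g \<Longrightarrow> Ck_on k S (\<lambda>x. B (f x) (g x))"
proof (induction k arbitrary: f g)
  case 0 then show ?case using bounded_bilinear.continuous_on[OF assms(1)] by auto
next
  case (Suc k)
  have "Ck_on k S f" "Ck_on k S g" using Suc.prems Ck_on_Suc_imp by blast+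
  then show ?case using Suc
    by (intro Ck_on_SucI[OF assms(2), where f' = "\<lambda>x v. B (f x) (frechet_derivative g (at x) v) + B (frechet_derivative f (at x) v) (g x)"]
        bounded_bilinear.FDERIV[OF assms(1)] Ck_on_add assms(2) Ck_on_has_derivative) auto
qed

lemma Ck_on_sum:
  assumes "open S" "\<And>i. i \<in> I \<Longrightarrow> Ck_on k S (f i)"
  shows "Ck_on k S (\<lambda>x. \<Sum>i\<in>I. f i x)"
  using assms(2) by (induction I rule: infinite_finite_induct) (auto intro: Ck_on_add Ck_on_const assms)

lemma Ck_on_prod:
  fixes f :: "_ \<Rightarrow> _ \<Rightarrow> real"
  assumes "open S" "\<And>i. i \<in> I \<Longrightarrow> Ck_on k S (f i)"
  shows "Ck_on k S (\<lambda>x. \<Prod>i\<in>I. f i x)"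
  using assms(2)
  by (induction I rule: infinite_finite_induct)
    (auto intro: Ck_on_bilinear[OF bounded_bilinear_mult] Ck_on_const assms)

text \<open>
  The derivative of \<open>g \<circ> f\<close>, expanded over a basis, is a sum of products of components of the
  derivative of \<open>f\<close> with directional derivatives of \<open>g\<close> composed with \<open>f\<close>. The latter are again
  compositions, of one order less.
\<close>

lemma Ck_on_compose:
  fixes f :: "'a::euclidean_space \<Rightarrow> 'b::euclidean_space" and g :: "'b \<Rightarrow> 'c::real_normed_vector"
  assumes "open S" "open T" "f ` S \<subseteq> T"
  shows "Ck_on k S f \<Longrightarrow> Ck_on k T g \<Longrightarrow> Ck_on k S (\<lambda>x. g (f x))"
proof (induction k arbitrary: g)
  case 0 then show ?case using assms(3) by (auto intro: continuous_on_compose2)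
next
  case (Suc k)
  let ?d = "\<lambda>x v. \<Sum>b\<in>Basis. (frechet_derivative f (at x) v \<bullet> b) *\<^sub>R frechet_derivative g (at (f x)) b"
  show ?case
  proof (rule Ck_on_SucI[OF assms(1), where f' = ?d])
    fix x assume x: "x \<in> S"
    have 1: "(f has_derivative frechet_derivative f (at x)) (at x)"
      using Suc.prems x Ck_on_has_derivative by blast
    have 2: "(g has_derivative frechet_derivative g (at (f x))) (at (f x))"
      using Suc.prems x assms(3) Ck_on_has_derivative by blast
    have 3: "frechet_derivative g (at (f x)) w = (\<Sum>b\<in>Basis. (w \<bullet> b) *\<^sub>R frechet_derivative g (at (f x)) b)" for w
      by (subst euclidean_representation[of w, symmetric])
        (simp only: linear_sum[OF has_derivative_linear[OF 2]] linear_scale[OF has_derivative_linear[OF 2]])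
    have "(\<lambda>v. frechet_derivative g (at (f x)) (frechet_derivative f (at x) v)) = ?d x"
      using 3 by (rule ext)
    then show "((\<lambda>x. g (f x)) has_derivative ?d x) (at x)"
      using has_derivative_compose[OF 1 2] by simp
  next
    fix v
    have f: "Ck_on k S f" using Suc.prems Ck_on_Suc_imp by blast
    show "Ck_on k S (\<lambda>x. ?d x v)"
      using Suc.prems
      by (intro Ck_on_sum assms Ck_on_bilinear[OF bounded_bilinear_scaleR] Suc.IH f
          Ck_on_bilinear[OF bounded_bilinear_inner] Ck_on_const) auto
  qed
qed

text \<open>
  Differentiation lowers the exponent, so it has to vary in the induction.
\<close>

lemma Ck_on_powr: "Ck_on k {0<..} (\<lambda>t::real. t powr r)"
proof (induction k arbitrary: r)
  case 0 then show ?case by (auto intro!: continuous_intros)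
next
  case (Suc k)
  show ?case
  proof (rule Ck_on_SucI[where f' = "\<lambda>t v. v * (r * t powr (r - 1))"])
    fix t :: real assume "t \<in> {0<..}"
    then have "((\<lambda>t. t powr r) has_real_derivative r * t powr (r - 1)) (at t)"
      by (auto intro: has_real_derivative_powr)
    then show "((\<lambda>t. t powr r) has_derivative (\<lambda>v. v * (r * t powr (r - 1)))) (at t)"
      by (simp add: has_field_derivative_def mult.commute[of _ "r * t powr (r - 1)"])
  next
    fix v :: real
    show "Ck_on k {0<..} (\<lambda>x. v * (r * x powr (r - 1)))"
      by (intro Ck_on_bilinear[OF bounded_bilinear_mult] Ck_on_const Suc.IH) auto
  qed auto
qed

lemma smooth_on_cong:
  assumes "open S" "\<And>x. x \<in> S \<Longrightarrow> f x = g x"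
  shows "smooth_on S f \<longleftrightarrow> smooth_on S g"
  using Ck_on_cong[OF assms] by (simp add: smooth_on_def)

lemma smooth_on_subset: "smooth_on S f \<Longrightarrow> T \<subseteq> S \<Longrightarrow> smooth_on T f"
  by (auto simp: smooth_on_def intro: Ck_on_subset)

lemma smooth_on_const: "open S \<Longrightarrow> smooth_on S (\<lambda>x. c)"
  by (simp add: smooth_on_def Ck_on_const)

lemma smooth_on_bounded_linear: "open S \<Longrightarrow> bounded_linear L \<Longrightarrow> smooth_on S L"
  by (simp add: smooth_on_def Ck_on_bounded_linear)

lemma smooth_on_add:
  "open S \<Longrightarrow> smooth_on S f \<Longrightarrow> smooth_on S g \<Longrightarrow> smooth_on S (\<lambda>x. f x + g x)"
  by (simp add: smooth_on_def Ck_on_add)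

lemma smooth_on_bilinear:
  "bounded_bilinear B \<Longrightarrow> open S \<Longrightarrow> smooth_on S f \<Longrightarrow> smooth_on S g \<Longrightarrow> smooth_on S (\<lambda>x. B (f x) (g x))"
  by (simp add: smooth_on_def Ck_on_bilinear)

lemmas smooth_on_scaleR = smooth_on_bilinear[OF bounded_bilinear_scaleR]
lemmas smooth_on_mult = smooth_on_bilinear[OF bounded_bilinear_mult]

lemma smooth_on_diff:
  "open S \<Longrightarrow> smooth_on S f \<Longrightarrow> smooth_on S g \<Longrightarrow> smooth_on S (\<lambda>x. f x - g x)"
  using smooth_on_add[of S f "\<lambda>x. (-1) *\<^sub>R g x"] smooth_on_scaleR[of S "\<lambda>x. -1" g] smooth_on_const[of S "-1::real"]
  by simp

lemma smooth_on_sum: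
  "open S \<Longrightarrow> (\<And>i. i \<in> I \<Longrightarrow> smooth_on S (f i)) \<Longrightarrow> smooth_on S (\<lambda>x. \<Sum>i\<in>I. f i x)"
  by (simp add: smooth_on_def Ck_on_sum)

lemma smooth_on_prod:
  fixes f :: "_ \<Rightarrow> _ \<Rightarrow> real"
  shows "open S \<Longrightarrow> (\<And>i. i \<in> I \<Longrightarrow> smooth_on S (f i)) \<Longrightarrow> smooth_on S (\<lambda>x. \<Prod>i\<in>I. f i x)"
  by (simp add: smooth_on_def Ck_on_prod)

lemma smooth_on_compose:
  fixes f :: "'a::euclidean_space \<Rightarrow> 'b::euclidean_space" and g :: "'b \<Rightarrow> 'c::real_normed_vector"
  shows "open S \<Longrightarrow> open T \<Longrightarrow> smooth_on S f \<Longrightarrow> smooth_on T g \<Longrightarrow> f ` S \<subseteq> T \<Longrightarrow> smooth_on S (\<lambda>x. g (f x))"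
  unfolding smooth_on_def using Ck_on_compose by blast

lemma smooth_on_linear_compose:
  assumes "open S" "smooth_on S f" "bounded_linear L"
  shows "smooth_on S (\<lambda>x. L (f x))"
  using assms
proof -
  have "Ck_on k S f \<Longrightarrow> Ck_on k S (\<lambda>x. L (f x))" for k
  proof (induction k arbitrary: f)
    case 0 then show ?case using assms by (auto intro: bounded_linear.continuous_on)
  next
    case (Suc k) then show ?case
      by (intro Ck_on_SucI[OF assms(1), where f' = "\<lambda>x v. L (frechet_derivative f (at x) v)"]
          bounded_linear.has_derivative[OF assms(3)] Ck_on_has_derivative) auto
  qed
  then show ?thesis using assms by (simp add: smooth_on_def)
qed

lemma smooth_on_nth:
  "open S \<Longrightarrow> smooth_on S f \<Longrightarrow> smooth_on S (\<lambda>x. f x $ i)"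
  using smooth_on_linear_compose bounded_linear_vec_nth by blast

lemma smooth_on_vecI:
  fixes f :: "'a::euclidean_space \<Rightarrow> real ^ 'n"
  assumes "open S" "\<And>i. smooth_on S (\<lambda>x. f x $ i)"
  shows "smooth_on S f"
proof -
  have "smooth_on S (\<lambda>x. \<Sum>i\<in>UNIV. (f x $ i) *\<^sub>R (axis i 1 :: real ^ 'n))"
    using assms by (intro smooth_on_sum smooth_on_scaleR smooth_on_const)
  moreover have "(\<lambda>x. \<Sum>i\<in>UNIV. (f x $ i) *\<^sub>R (axis i 1 :: real ^ 'n)) = f"
    by (simp add: fun_eq_iff scalar_mult_eq_scaleR[symmetric] basis_expansion)
  ultimately show ?thesis by simp
qed

lemma smooth_on_frechet_derivative:
  "smooth_on S f \<Longrightarrow> smooth_on S (\<lambda>x. frechet_derivative f (at x) v)"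
  unfolding smooth_on_def using Ck_on.simps(2) by blast

lemma smooth_on_has_derivative:
  "smooth_on S f \<Longrightarrow> x \<in> S \<Longrightarrow> (f has_derivative frechet_derivative f (at x)) (at x)"
  unfolding smooth_on_def using Ck_on_has_derivative by blast

lemma smooth_on_imp_continuous_on: "smooth_on S f \<Longrightarrow> continuous_on S f"
  by (meson smooth_on_def Ck_on_imp_continuous_on)

lemma smooth_on_powr:
  fixes f :: "'a::euclidean_space \<Rightarrow> real"
  assumes "open S" "smooth_on S f" "\<And>x. x \<in> S \<Longrightarrow> f x > 0"
  shows "smooth_on S (\<lambda>x. f x powr r)"
proof (rule smooth_on_compose[of S "{0<..}" f "\<lambda>t. t powr r"])
  show "smooth_on {0<..} (\<lambda>t::real. t powr r)" by (simp add: smooth_on_def Ck_on_powr)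
qed (use assms in auto)

text \<open>
  The power function is smooth on positive numbers only; writing \<open>1 / g\<close> as \<open>g (g\<^sup>2)\<^sup>-\<^sup>1\<close> allows
  both signs of \<open>g\<close>.
\<close>

lemma smooth_on_divide:
  fixes f g :: "'a::euclidean_space \<Rightarrow> real"
  assumes "open S" "smooth_on S f" "smooth_on S g" "\<And>x. x \<in> S \<Longrightarrow> g x \<noteq> 0"
  shows "smooth_on S (\<lambda>x. f x / g x)"
proof -
  have "smooth_on S (\<lambda>x. f x * (g x * ((g x * g x) powr (- 1))))"
    using assms by (intro smooth_on_mult smooth_on_powr) (auto simp: zero_less_mult_iff linorder_neq_iff)
  then show ?thesis
    by (subst smooth_on_cong[OF assms(1), of _ "\<lambda>x. f x * (g x * ((g x * g x) powr (- 1)))"])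
      (use assms in \<open>auto simp: powr_minus divide_simps\<close>)
qed

lemma linear_vec_expand:
  fixes L :: "real ^ 'n \<Rightarrow> 'b::real_vector"
  assumes "linear L"
  shows "L v = (\<Sum>i\<in>UNIV. (v $ i) *\<^sub>R L (axis i 1))"
proof -
  have "v = (\<Sum>i\<in>UNIV. (v $ i) *\<^sub>R axis i 1)"
    by (simp add: scalar_mult_eq_scaleR[symmetric] basis_expansion)
  then have "L v = L (\<Sum>i\<in>UNIV. (v $ i) *\<^sub>R axis i 1)" by simp
  also have "\<dots> = (\<Sum>i\<in>UNIV. (v $ i) *\<^sub>R L (axis i 1))"
    by (simp add: linear_sum[OF assms] linear_scale[OF assms])
  finally show ?thesis .
qed

text \<open>
  The identity \<open>L\<^sub>s (u\<^sub>s) = L\<^sub>s (u\<^sub>t) + \<Sum>\<^sub>i (u\<^sub>s - u\<^sub>t)\<^sub>i L\<^sub>s e\<^sub>i\<close> reduces this product rule to products with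
  scalar functions that vanish at \<open>t\<close>. It asks for the derivative of \<open>L\<^sub>s v\<close> for constant \<open>v\<close> only,
  which is how changes of coordinates and the components of a form are given.
\<close>

lemma has_derivative_apply_linear:
  fixes L :: "'s::real_normed_vector \<Rightarrow> real ^ 'n \<Rightarrow> 'b::real_normed_vector"
  assumes t: "t \<in> S"
    and lin: "\<forall>\<^sub>F s in at t within S. linear (L s)" "linear (L t)"
    and L': "\<And>v. ((\<lambda>s. L s v) has_derivative (\<lambda>x. L' x v)) (at t within S)"
    and u: "(u has_derivative u') (at t within S)"
  shows "((\<lambda>s. L s (u s)) has_derivative (\<lambda>x. L' x (u t) + L t (u' x))) (at t within S)"
proof -
  have expand: "L s (u s) = L s (u t) + (\<Sum>i\<in>UNIV. ((u s - u t) $ i) *\<^sub>R L s (axis i 1))"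
    if "linear (L s)" for s
    using linear_vec_expand[OF that, of "u s - u t"] linear_diff[OF that, of "u s" "u t"]
    by (simp add: diff_eq_eq add.commute)
  have comp: "((\<lambda>s. (u s - u t) $ i) has_derivative (\<lambda>x. u' x $ i)) (at t within S)" for i
    using bounded_linear.has_derivative[OF bounded_linear_vec_nth has_derivative_diff[OF u has_derivative_const[of "u t"]]]
    by simp
  have "((\<lambda>s. ((u s - u t) $ i) *\<^sub>R L s (axis i 1)) has_derivative (\<lambda>x. (u' x $ i) *\<^sub>R L t (axis i 1))) (at t within S)" for i
    by (rule has_derivative_eq_rhs[OF has_derivative_scaleR[OF comp[of i] L'[of "axis i 1"]]]) simp
  note add = has_derivative_add[OF L'[of "u t"] has_derivative_sum[OF this]]
  have "((\<lambda>s. L s (u t) + (\<Sum>i\<in>UNIV. ((u s - u t) $ i) *\<^sub>R L s (axis i 1))) has_derivative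
         (\<lambda>x. L' x (u t) + L t (u' x))) (at t within S)"
    by (rule has_derivative_eq_rhs[OF add]) (simp add: linear_vec_expand[OF lin(2), symmetric])
  then show ?thesis
  proof (rule has_derivative_transform_eventually)
    show "\<forall>\<^sub>F s in at t within S. L s (u t) + (\<Sum>i\<in>UNIV. ((u s - u t) $ i) *\<^sub>R L s (axis i 1)) = L s (u s)"
      using lin(1) by eventually_elim (simp add: expand)
  qed (use t in simp_all)
qed

lemma smooth_on_apply_linear:
  fixes u :: "'s::euclidean_space \<Rightarrow> real^'n" and L :: "'s \<Rightarrow> real^'n \<Rightarrow> 'b::real_normed_vector"
  assumes "open S" "\<And>y. y \<in> S \<Longrightarrow> linear (L y)" "\<And>v. smooth_on S (\<lambda>y. L y v)" "smooth_on S u"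
  shows "smooth_on S (\<lambda>y. L y (u y))"
proof -
  have "smooth_on S (\<lambda>y. \<Sum>i\<in>UNIV. (u y $ i) *\<^sub>R L y (axis i 1))"
    using assms by (intro smooth_on_sum smooth_on_scaleR smooth_on_nth)
  then show ?thesis
    by (subst smooth_on_cong[OF assms(1), of _ "\<lambda>y. \<Sum>i\<in>UNIV. (u y $ i) *\<^sub>R L y (axis i 1)"])
      (use assms(2) linear_vec_expand in blast)+
qed

lemma smooth_on_det:
  fixes A :: "'s::euclidean_space \<Rightarrow> real^'n^'n"
  assumes "open S" "\<And>i j. smooth_on S (\<lambda>y. A y $ i $ j)"
  shows "smooth_on S (\<lambda>y. det (A y))"
  unfolding det_def
  by (rule smooth_on_sum[OF assms(1)], rule smooth_on_mult[OF assms(1) smooth_on_const[OF assms(1)]],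
      rule smooth_on_prod[OF assms(1)], rule assms(2))

section \<open>Linear differential equations\<close>

lemma linear_family_bound:
  fixes A :: "'s::topological_space \<Rightarrow> 'a::euclidean_space \<Rightarrow> 'b::real_normed_vector"
  assumes "compact S" "\<And>t. t \<in> S \<Longrightarrow> linear (A t)" "\<And>v. continuous_on S (\<lambda>t. A t v)"
  obtains K where "K > 0" "\<And>t v. t \<in> S \<Longrightarrow> norm (A t v) \<le> K * norm v"
proof -
  have "\<exists>k. \<forall>t\<in>S. norm (A t v) \<le> k" for v
    using compact_imp_bounded[OF compact_continuous_image[OF assms(3) assms(1)]]
    by (auto simp: bounded_iff)
  then obtain k where k: "\<And>t v. t \<in> S \<Longrightarrow> norm (A t v) \<le> k v" by metis
  define K where "K = 1 + (\<Sum>b\<in>Basis. \<bar>k b\<bar>)"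
  show ?thesis
  proof
    show "K > 0" unfolding K_def by (smt (verit) sum_nonneg abs_ge_zero)
    fix t v assume t: "t \<in> S"
    have "A t v = A t (\<Sum>b\<in>Basis. (v \<bullet> b) *\<^sub>R b)" by (simp add: euclidean_representation)
    also have "\<dots> = (\<Sum>b\<in>Basis. (v \<bullet> b) *\<^sub>R A t b)"
      by (simp add: linear_sum[OF assms(2)[OF t]] linear_scale[OF assms(2)[OF t]])
    also have "norm \<dots> \<le> (\<Sum>b\<in>Basis. \<bar>k b\<bar> * norm v)"
    proof (rule sum_norm_le)
      fix b :: 'a assume b: "b \<in> Basis"
      have "norm ((v \<bullet> b) *\<^sub>R A t b) \<le> norm v * \<bar>k b\<bar>"
        using k[OF t, of b] Basis_le_norm[OF b, of v] by (auto intro!: mult_mono)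
      then show "norm ((v \<bullet> b) *\<^sub>R A t b) \<le> \<bar>k b\<bar> * norm v" by (simp add: mult.commute)
    qed
    also have "\<dots> \<le> K * norm v" by (simp add: K_def sum_distrib_right distrib_right)
    finally show "norm (A t v) \<le> K * norm v" .
  qed
qed

lemma continuous_on_apply_linear:
  fixes A :: "'s::topological_space \<Rightarrow> 'a::euclidean_space \<Rightarrow> 'b::real_normed_vector"
  assumes "\<And>t. t \<in> S \<Longrightarrow> linear (A t)" "\<And>v. continuous_on S (\<lambda>t. A t v)" "continuous_on S u"
  shows "continuous_on S (\<lambda>t. A t (u t))"
proof -
  have "A t (u t) = (\<Sum>b\<in>Basis. (u t \<bullet> b) *\<^sub>R A t b)" if "t \<in> S" for t
    using linear_sum[OF assms(1)[OF that], of "\<lambda>b. (u t \<bullet> b) *\<^sub>R b" Basis]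
    by (simp add: euclidean_representation linear_scale[OF assms(1)[OF that]])
  moreover have "continuous_on S (\<lambda>t. \<Sum>b\<in>Basis. (u t \<bullet> b) *\<^sub>R A t b)"
    using assms by (intro continuous_intros) auto
  ultimately show ?thesis by (subst continuous_on_cong[OF refl])
qed

text \<open>
  Picard iteration: \<open>u\<close> is the sum of the functions \<open>w\<^sub>n\<close> with \<open>w\<^sub>0 = u0\<close>, \<open>w\<^sub>n\<^sub>+\<^sub>1' = A w\<^sub>n\<close> and \<open>w\<^sub>n\<^sub>+\<^sub>1 a = 0\<close>.
  If \<open>K\<close> bounds the norm of \<open>A\<close> then \<open>|w\<^sub>n(t)| \<le> |u0| (K (t - a))\<^sup>n / n!\<close>, so that the series
  converges uniformly and can be differentiated term by term.
\<close>

lemma linear_ODE_exists: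
  fixes A :: "real \<Rightarrow> 'a::euclidean_space \<Rightarrow> 'a"
  assumes "a < b" and lin: "\<And>t. t \<in> {a..b} \<Longrightarrow> linear (A t)"
    and cont: "\<And>v. continuous_on {a..b} (\<lambda>t. A t v)"
  shows "\<exists>u. u a = u0 \<and> (\<forall>t\<in>{a..b}. (u has_vector_derivative A t (u t)) (at t within {a..b}))"
proof -
  obtain K where K: "K > 0" "\<And>t v. t \<in> {a..b} \<Longrightarrow> norm (A t v) \<le> K * norm v"
    using linear_family_bound[OF compact_Icc lin cont] by metis
  define w where "w = rec_nat (\<lambda>t. u0) (\<lambda>n wn t. integral {a..t} (\<lambda>s. A s (wn s)))"
  have w0: "w 0 = (\<lambda>t. u0)" and wS: "w (Suc n) = (\<lambda>t. integral {a..t} (\<lambda>s. A s (w n s)))" for n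
    by (auto simp: w_def)
  have Acont: "continuous_on {a..b} (\<lambda>s. A s (v s))" if "continuous_on {a..b} v" for v
    using continuous_on_apply_linear[of "{a..b}" A v] lin cont that by blast
  have wcont: "continuous_on {a..b} (w n)" for n
  proof (induction n)
    case (Suc n)
    show ?case unfolding wS
      by (rule indefinite_integral_continuous_1[OF integrable_continuous_real[OF Acont[OF Suc.IH]]])
  qed (simp add: w0)
  have wd: "(w (Suc n) has_vector_derivative A t (w n t)) (at t within {a..b})" if "t \<in> {a..b}" for n t
    unfolding wS by (rule integral_has_vector_derivative[OF Acont[OF wcont] that])
  define c where "c n t = norm u0 * ((K * (t - a)) ^ n / fact n)" for n t
  have cd: "(c (Suc n) has_vector_derivative K * c n t) (at t)" for n t
  proof -
    have "((\<lambda>t. K * (t - a)) has_real_derivative K) (at t)"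
      by (auto intro!: derivative_eq_intros)
    from DERIV_cmult[OF DERIV_cdivide[OF DERIV_power[OF this, of "Suc n"]], of "norm u0" "fact (Suc n)"]
    have "(c (Suc n) has_real_derivative
        norm u0 * (real (Suc n) * (K * (K * (t - a)) ^ n) / fact (Suc n))) (at t)"
      by (simp add: c_def[abs_def] del: fact_Suc of_nat_Suc power_Suc)
    also have "norm u0 * (real (Suc n) * (K * (K * (t - a)) ^ n) / fact (Suc n)) = K * c n t"
      by (simp add: c_def del: of_nat_Suc)
    finally show ?thesis by (simp add: has_real_derivative_iff_has_vector_derivative)
  qed
  have wa: "w (Suc n) a = 0" for n by (simp add: wS)
  have bound: "norm (w n t) \<le> c n t" if "t \<in> {a..b}" for n t
    using that
  proof (induction n arbitrary: t)
    case 0 then show ?case by (simp add: w0 c_def)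
  next
    case (Suc n)
    show ?case
    proof (cases "t = a")
      case True then show ?thesis by (simp add: wa c_def)
    next
      case False
      then have at: "a < t" using Suc.prems by simp
      have "norm (w (Suc n) t - w (Suc n) a) \<le> c (Suc n) t - c (Suc n) a"
      proof (rule differentiable_bound_general[OF at])
        show "continuous_on {a..t} (w (Suc n))"
          by (rule continuous_on_subset[OF wcont]) (use Suc.prems in auto)
        show "continuous_on {a..t} (c (Suc n))"
          by (intro continuous_at_imp_continuous_on ballI has_vector_derivative_continuous[OF cd])
        fix x assume x: "a < x" "x < t"
        then have xb: "a < x" "x < b" using Suc.prems by auto
        show "(w (Suc n) has_vector_derivative A x (w n x)) (at x)"
          using wd[of x n] xb by (simp add: at_within_Icc_at)
        show "(c (Suc n) has_vector_derivative K * c n x) (at x)" by (rule cd)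
        have "norm (A x (w n x)) \<le> K * norm (w n x)" using K xb by auto
        also have "\<dots> \<le> K * c n x" using Suc.IH[of x] xb K by auto
        finally show "norm (A x (w n x)) \<le> K * c n x" .
      qed
      then show ?thesis by (simp add: wa c_def)
    qed
  qed
  define M where "M n = norm u0 * ((K * (b - a)) ^ n / fact n)" for n
  have wM: "norm (w n t) \<le> M n" if "t \<in> {a..b}" for n t
  proof -
    have "c n t \<le> M n" unfolding c_def M_def
      using that K by (intro mult_left_mono divide_right_mono power_mono) auto
    then show ?thesis using bound[OF that, of n] by simp
  qed
  have sumM: "summable M"
    unfolding M_def using summable_exp[of "K * (b - a)"]
    by (intro summable_mult) (simp add: field_simps)
  have sumw: "summable (\<lambda>n. w n t)" if "t \<in> {a..b}" for t
    by (rule summable_comparison_test'[OF sumM]) (rule wM[OF that])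
  define W where "W t = (\<Sum>n. w n t)" for t
  have unif: "uniform_limit {a..b} (\<lambda>n t. \<Sum>i<n. w i t) W sequentially"
    unfolding W_def by (rule Weierstrass_m_test[OF wM sumM])
  define f' where "f' n t h = (case n of 0 \<Rightarrow> 0 | Suc m \<Rightarrow> h *\<^sub>R A t (w m t))" for n t and h :: real
  have sumf': "(\<Sum>i<Suc n. f' i t h) = h *\<^sub>R A t (\<Sum>i<n. w i t)" if "t \<in> {a..b}" for n t h
  proof (induction n)
    case 0 show ?case using linear_0[OF lin[OF that]] by (simp add: f'_def)
  next
    case (Suc n)
    then show ?case
      by (subst sum.lessThan_Suc) (simp add: f'_def linear_add[OF lin[OF that]] scaleR_add_right)
  qed
  have "\<exists>g. \<forall>x\<in>{a..b}. (\<lambda>n. w n x) sums g x \<and> (g has_derivative (\<lambda>h. h *\<^sub>R A x (W x))) (at x within {a..b})"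
  proof (rule has_derivative_series[where f' = f'])
    fix n t assume t: "t \<in> {a..b}"
    show "(w n has_derivative f' n t) (at t within {a..b})"
    proof (cases n)
      case 0 then show ?thesis by (simp add: w0 f'_def[abs_def])
    next
      case (Suc m) then show ?thesis using wd[OF t, of m]
        by (simp add: f'_def[abs_def] has_vector_derivative_def)
    qed
  next
    fix e :: real assume e: "e > 0"
    then have "e / K > 0" using K by simp
    from uniform_limitD[OF unif this]
    have ev: "\<forall>\<^sub>F n in sequentially. \<forall>t\<in>{a..b}. dist (\<Sum>i<n. w i t) (W t) < e / K" .
    have "\<forall>\<^sub>F n in sequentially. \<forall>t\<in>{a..b}. \<forall>h. norm ((\<Sum>i<Suc n. f' i t h) - h *\<^sub>R A t (W t)) \<le> e * norm h"
      using ev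
    proof eventually_elim
      case (elim n)
      show ?case
      proof (intro ballI allI)
        fix t and h :: real assume t: "t \<in> {a..b}"
        have "norm ((\<Sum>i<Suc n. f' i t h) - h *\<^sub>R A t (W t)) = \<bar>h\<bar> * norm (A t ((\<Sum>i<n. w i t) - W t))"
          unfolding sumf'[OF t] by (simp add: linear_diff[OF lin[OF t]] scaleR_diff_right[symmetric])
        also have "\<dots> \<le> \<bar>h\<bar> * (K * (e / K))"
        proof (rule mult_left_mono)
          have "norm ((\<Sum>i<n. w i t) - W t) \<le> e / K" using elim[rule_format, OF t] by (simp add: dist_norm)
          then have "K * norm ((\<Sum>i<n. w i t) - W t) \<le> K * (e / K)"
            using K(1) by (intro mult_left_mono) auto
          then show "norm (A t ((\<Sum>i<n. w i t) - W t)) \<le> K * (e / K)"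
            using K(2)[OF t, of "(\<Sum>i<n. w i t) - W t"] by (rule order_trans[rotated])
        qed simp
        finally show "norm ((\<Sum>i<Suc n. f' i t h) - h *\<^sub>R A t (W t)) \<le> e * norm h"
          using K(1) by (simp add: mult.commute)
      qed
    qed
    then show "\<forall>\<^sub>F n in sequentially. \<forall>t\<in>{a..b}. \<forall>h. norm ((\<Sum>i<n. f' i t h) - h *\<^sub>R A t (W t)) \<le> e * norm h"
      by (subst (asm) eventually_sequentially_Suc)
  next
    show "a \<in> {a..b}" using assms by simp
    show "(\<lambda>n. w n a) sums W a" unfolding W_def using sumw[of a] assms by (simp add: summable_sums)
  qed auto
  then obtain g where g: "\<And>x. x \<in> {a..b} \<Longrightarrow> (\<lambda>n. w n x) sums g x"
    "\<And>x. x \<in> {a..b} \<Longrightarrow> (g has_vector_derivative A x (W x)) (at x within {a..b})"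
    unfolding has_vector_derivative_def by blast
  have gW: "g x = W x" if "x \<in> {a..b}" for x using g(1)[OF that] by (simp add: W_def sums_iff)
  have "(\<lambda>n. w n a) sums u0"
  proof -
    have "w n a = (if n = 0 then u0 else 0)" for n by (cases n) (simp_all add: wa w0)
    then show ?thesis using sums_single[of 0 "\<lambda>_. u0"] by simp
  qed
  then have "g a = u0" using g(1)[of a] assms sums_unique2 by auto
  then show ?thesis using g(2) gW by (intro exI[of _ g]) auto
qed

lemma vector_derivative_bound_unit_interval:
  fixes z :: "real \<Rightarrow> 'a::real_normed_vector"
  assumes "\<And>s. s \<in> {0..1} \<Longrightarrow> (z has_vector_derivative z' s) (at s within {0..1})"
    and "\<And>s. s \<in> {0..1} \<Longrightarrow> norm (z' s) \<le> B" and t: "t \<in> {0..1}"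
  shows "norm (z t - z 0) \<le> B"
proof -
  have "0 \<le> B" using assms(2)[OF t] norm_ge_zero order_trans by blast
  have "norm (z t - z 0) \<le> B * norm (t - 0)"
  proof (rule differentiable_bound[of "{0..1}" z "\<lambda>s h. h *\<^sub>R z' s"])
    fix s :: real assume s: "s \<in> {0..1}"
    show "(z has_derivative (\<lambda>h. h *\<^sub>R z' s)) (at s within {0..1})"
      using assms(1)[OF s] by (simp add: has_vector_derivative_def)
    show "onorm (\<lambda>h. h *\<^sub>R z' s) \<le> B"
      by (rule onorm_le) (use assms(2)[OF s] in \<open>auto simp: mult.commute[of B] intro!: mult_left_mono\<close>)
  qed (use t in auto)
  also have "\<dots> \<le> B" using t \<open>0 \<le> B\<close> by (simp add: mult_left_le)
  finally show ?thesis .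
qed

lemma bilinear_family_bound:
  fixes G :: "'s::topological_space \<Rightarrow> 'n::euclidean_space \<Rightarrow> 'm::euclidean_space \<Rightarrow> 'b::real_normed_vector"
  assumes "compact S"
    and lin1: "\<And>y w. y \<in> S \<Longrightarrow> linear (\<lambda>v. G y v w)"
    and lin2: "\<And>y v. y \<in> S \<Longrightarrow> linear (\<lambda>w. G y v w)"
    and cont: "\<And>v w. continuous_on S (\<lambda>y. G y v w)"
  obtains M where "M > 0" "\<And>y v w. y \<in> S \<Longrightarrow> norm (G y v w) \<le> M * norm v * norm w"
proof -
  have "\<exists>K>0. \<forall>y\<in>S. \<forall>w. norm (G y b w) \<le> K * norm w" for b
    using linear_family_bound[OF assms(1) lin2 cont] by metis
  then obtain K where K: "\<And>b. K b > 0" "\<And>b y w. y \<in> S \<Longrightarrow> norm (G y b w) \<le> K b * norm w" by metis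
  define M where "M = 1 + (\<Sum>b\<in>Basis. K b)"
  show ?thesis
  proof
    show "M > 0" unfolding M_def using K(1) by (smt (verit) sum_nonneg)
    fix y v w assume y: "y \<in> S"
    have "G y v w = (\<Sum>b\<in>Basis. (v \<bullet> b) *\<^sub>R G y b w)"
      using linear_sum[OF lin1[OF y], of "\<lambda>b. (v \<bullet> b) *\<^sub>R b" Basis]
      by (simp add: euclidean_representation linear_scale[OF lin1[OF y]])
    also have "norm \<dots> \<le> (\<Sum>b\<in>Basis. norm v * (K b * norm w))"
    proof (rule sum_norm_le)
      fix b :: 'n assume "b \<in> Basis"
      then show "norm ((v \<bullet> b) *\<^sub>R G y b w) \<le> norm v * (K b * norm w)"
        using K(2)[OF y, of b w] Basis_le_norm[of b v] by (auto intro!: mult_mono)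
    qed
    also have "\<dots> = (\<Sum>b\<in>Basis. K b) * (norm v * norm w)"
      by (simp add: sum_distrib_left sum_distrib_right mult_ac)
    also have "\<dots> \<le> M * norm v * norm w" by (simp add: M_def distrib_right mult.assoc)
    finally show "norm (G y v w) \<le> M * norm v * norm w" .
  qed
qed

text \<open>
  The solution on the segment from \<open>y\<close> to \<open>y0\<close>, evaluated at \<open>y0\<close>, as a function of \<open>y\<close>. With
  \<open>r = |y - y0|\<close> the solution stays within \<open>O(r)\<close> of \<open>u\<close>. Hence replacing it by \<open>u\<close> in the
  equation costs \<open>O(r\<^sup>2)\<close>, replacing \<open>G\<close> at the points of the segment by \<open>G y0\<close> costs \<open>o(r)\<close>, and
  \<open>z y 1 = u + G y0 (y - y0) u + o(r)\<close>.
\<close>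

lemma segment_transport_has_derivative:
  fixes G :: "'n::euclidean_space \<Rightarrow> 'n \<Rightarrow> 'm::euclidean_space \<Rightarrow> 'm"
  assumes R: "R > 0"
    and lin1: "\<And>y w. y \<in> ball y0 R \<Longrightarrow> linear (\<lambda>v. G y v w)"
    and lin2: "\<And>y v. y \<in> ball y0 R \<Longrightarrow> linear (\<lambda>w. G y v w)"
    and cont: "\<And>v w. continuous_on (ball y0 R) (\<lambda>y. G y v w)"
    and z: "\<And>y s. y \<in> ball y0 R \<Longrightarrow> s \<in> {0..1} \<Longrightarrow>
        (z y has_vector_derivative G (y + s *\<^sub>R (y0 - y)) (y - y0) (z y s)) (at s within {0..1})"
    and z0: "\<And>y. y \<in> ball y0 R \<Longrightarrow> z y 0 = u"
  shows "((\<lambda>y. z y 1) has_derivative (\<lambda>x. G y0 x u)) (at y0)"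
proof -
  define C where "C = cball y0 (R / 2)"
  have C: "compact C" "C \<subseteq> ball y0 R" using R by (auto simp: C_def)
  obtain M where M: "M > 0" "\<And>y v w. y \<in> C \<Longrightarrow> norm (G y v w) \<le> M * norm v * norm w"
    using bilinear_family_bound[OF C(1), of G] lin1 lin2 cont C(2) continuous_on_subset by (metis subsetD)
  define N where "N y = (\<Sum>b\<in>Basis. norm (G y b u - G y0 b u))" for y
  have y0: "y0 \<in> ball y0 R" using R by simp
  have Nbound: "norm (G y x u - G y0 x u) \<le> N y * norm x" if y: "y \<in> ball y0 R" for y x
  proof -
    have lin: "linear (\<lambda>v. G y v u - G y0 v u)"
      using linear_compose_sub[OF lin1[OF y] lin1[OF y0]] .
    have "G y x u - G y0 x u = (\<Sum>b\<in>Basis. (x \<bullet> b) *\<^sub>R (G y b u - G y0 b u))"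
      using linear_sum[OF lin, of "\<lambda>b. (x \<bullet> b) *\<^sub>R b" Basis]
      by (simp add: euclidean_representation linear_scale[OF lin])
    also have "norm \<dots> \<le> (\<Sum>b\<in>Basis. norm (G y b u - G y0 b u) * norm x)"
      by (rule sum_norm_le) (auto simp: mult.commute[of _ "norm x"] intro!: mult_right_mono Basis_le_norm)
    finally show ?thesis by (simp add: N_def sum_distrib_right)
  qed
  have Ncont: "continuous_on (ball y0 R) N"
    unfolding N_def by (intro continuous_intros cont)
  have "N y0 = 0" by (simp add: N_def)
  have est: "norm (z y 1 - u - G y0 (y - y0) u) \<le> norm (y - y0) * (2 * M * M * norm (y - y0) * norm u + B)"
    if r: "norm (y - y0) < R / 2" "M * norm (y - y0) \<le> 1 / 2"
      and B: "\<And>y'. norm (y' - y0) \<le> norm (y - y0) \<Longrightarrow> N y' \<le> B" for y B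
  proof -
    define r where "r = norm (y - y0)"
    have yR: "y \<in> ball y0 R" using r R by (auto simp: dist_norm norm_minus_commute)
    have seg: "norm (y + s *\<^sub>R (y0 - y) - y0) \<le> r" if s: "s \<in> {0..1}" for s
    proof -
      have "y + s *\<^sub>R (y0 - y) - y0 = (1 - s) *\<^sub>R (y - y0)" by (simp add: algebra_simps)
      then show ?thesis using s by (auto simp: r_def intro!: mult_left_le_one_le)
    qed
    then have segC: "y + s *\<^sub>R (y0 - y) \<in> C" if "s \<in> {0..1}" for s
      using that r by (force simp: C_def dist_norm norm_minus_commute r_def)
    have "continuous_on {0..1} (\<lambda>s. norm (z y s))"
      using continuous_on_vector_derivative[OF z[OF yR]] by (rule continuous_on_norm)
    then obtain t where t: "t \<in> {0..1}" "\<And>s. s \<in> {0..1} \<Longrightarrow> norm (z y s) \<le> norm (z y t)"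
      using continuous_attains_sup[of "{0..1::real}" "\<lambda>s. norm (z y s)"] by auto
    define m where "m = norm (z y t)"
    have zd: "norm (z y s - u) \<le> M * r * m" if s: "s \<in> {0..1}" for s
    proof -
      have "norm (z y s - z y 0) \<le> M * r * m"
      proof (rule vector_derivative_bound_unit_interval[OF z[OF yR] _ s])
        fix s :: real assume s: "s \<in> {0..1}"
        have "norm (G (y + s *\<^sub>R (y0 - y)) (y - y0) (z y s)) \<le> M * r * norm (z y s)"
          using M(2)[OF segC[OF s]] by (simp add: r_def)
        also have "\<dots> \<le> M * r * m" using t(2)[OF s] M(1) by (auto simp: m_def r_def intro!: mult_left_mono)
        finally show "norm (G (y + s *\<^sub>R (y0 - y)) (y - y0) (z y s)) \<le> M * r * m" .
      qed auto
      then show ?thesis using z0[OF yR] by simp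
    qed
    have "m \<le> norm u + M * r * m"
      using zd[OF t(1)] norm_triangle_sub[of "z y t" u] by (simp add: m_def)
    moreover have "M * r * m \<le> 1 / 2 * m" using r by (intro mult_right_mono) (auto simp: r_def m_def)
    ultimately have m: "m \<le> 2 * norm u" by simp
    have zd2: "norm (z y s - u) \<le> M * r * (2 * norm u)" if s: "s \<in> {0..1}" for s
      by (rule order_trans[OF zd[OF s] mult_left_mono[OF m]]) (use M(1) in \<open>simp add: r_def\<close>)
    have "norm ((z y 1 - 1 *\<^sub>R G y0 (y - y0) u) - (z y 0 - 0 *\<^sub>R G y0 (y - y0) u)) \<le> r * (2 * M * M * r * norm u + B)"
    proof (rule vector_derivative_bound_unit_interval[where z = "\<lambda>s. z y s - s *\<^sub>R G y0 (y - y0) u"])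
      fix s :: real assume s: "s \<in> {0..1}"
      let ?y = "y + s *\<^sub>R (y0 - y)"
      show "((\<lambda>s. z y s - s *\<^sub>R G y0 (y - y0) u) has_vector_derivative
          (G ?y (y - y0) (z y s) - G y0 (y - y0) u)) (at s within {0..1})"
        using z[OF yR s] by (auto intro!: derivative_eq_intros)
      have yb: "?y \<in> ball y0 R" using segC[OF s] C by auto
      have "G ?y (y - y0) (z y s) - G y0 (y - y0) u
          = G ?y (y - y0) (z y s - u) + (G ?y (y - y0) u - G y0 (y - y0) u)"
        using linear_diff[OF lin2[OF yb, of "y - y0"], of "z y s" u] by simp
      then have "norm (G ?y (y - y0) (z y s) - G y0 (y - y0) u)
          \<le> norm (G ?y (y - y0) (z y s - u)) + norm (G ?y (y - y0) u - G y0 (y - y0) u)"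
        by (simp only: norm_triangle_ineq)
      also have "norm (G ?y (y - y0) (z y s - u)) \<le> M * r * norm (z y s - u)"
        using M(2)[OF segC[OF s]] by (simp add: r_def)
      also have "\<dots> \<le> M * r * (M * r * (2 * norm u))"
        using zd2[OF s] M(1) by (intro mult_left_mono) (auto simp: r_def)
      also have "norm (G ?y (y - y0) u - G y0 (y - y0) u) \<le> B * r"
        using Nbound[OF yb, of "y - y0"] B[of ?y] seg[OF s] mult_right_mono[of "N ?y" B r]
        by (auto simp: r_def)
      also have "M * r * (M * r * (2 * norm u)) + B * r = r * (2 * M * M * r * norm u + B)"
        by (simp add: algebra_simps)
      finally show "norm (G ?y (y - y0) (z y s) - G y0 (y - y0) u) \<le> r * (2 * M * M * r * norm u + B)"
        by simp
    qed auto
    then show ?thesis using z0[OF yR] by (simp add: r_def algebra_simps)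
  qed
  have zy0: "z y0 1 = u"
  proof -
    have "norm (z y0 1 - z y0 0) \<le> 0"
    proof (rule vector_derivative_bound_unit_interval[OF z[OF y0]])
      show "norm (G (y0 + s *\<^sub>R (y0 - y0)) (y0 - y0) (z y0 s)) \<le> 0" for s
        using linear_0[OF lin1[OF y0]] by simp
    qed auto
    then show ?thesis using z0[OF y0] by simp
  qed
  show ?thesis
    unfolding has_derivative_at_alt
  proof (intro conjI allI impI)
    show "bounded_linear (\<lambda>x. G y0 x u)" using lin1[OF y0] linear_conv_bounded_linear by blast
    fix e :: real assume e: "e > 0"
    have "isCont N y0" using Ncont y0 by (simp add: continuous_on_eq_continuous_at)
    then obtain d1 where d1: "d1 > 0" "\<And>y. norm (y - y0) < d1 \<Longrightarrow> N y < e / 2"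
      using e \<open>N y0 = 0\<close> unfolding continuous_at_eps_delta dist_norm
      by (metis abs_less_iff diff_0_right half_gt_zero real_norm_def)
    \<comment> \<open>the last bound makes the quadratic error at most \<open>e / 2\<close>; the term \<open>+ 1\<close> covers \<open>u = 0\<close>\<close>
    define d where "d = min (min d1 (R / 2)) (min (1 / (2 * M)) (e / (4 * M * M * (norm u + 1))))"
    have d: "d > 0" using d1 R M(1) e by (auto simp: d_def intro!: divide_pos_pos mult_pos_pos add_nonneg_pos)
    moreover have "norm (z y 1 - z y0 1 - G y0 (y - y0) u) \<le> e * norm (y - y0)" if y: "norm (y - y0) < d" for y
    proof -
      have y1: "norm (y - y0) < d1" "norm (y - y0) < R / 2" "norm (y - y0) \<le> 1 / (2 * M)"
        "norm (y - y0) \<le> e / (4 * M * M * (norm u + 1))" using y by (auto simp: d_def)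
      have "M * norm (y - y0) \<le> 1 / 2" using y1(3) M(1) by (simp add: field_simps)
      moreover have "N y' \<le> e / 2" if "norm (y' - y0) \<le> norm (y - y0)" for y'
        using d1(2)[of y'] that y1(1) by simp
      ultimately have "norm (z y 1 - u - G y0 (y - y0) u) \<le> norm (y - y0) * (2 * M * M * norm (y - y0) * norm u + e / 2)"
        using est[OF y1(2)] by blast
      also have "\<dots> \<le> norm (y - y0) * e"
      proof (intro mult_left_mono)
        have "norm (y - y0) * (4 * M * M * (norm u + 1)) \<le> e"
          using y1(4) M(1) by (simp add: pos_le_divide_eq mult_pos_pos add_nonneg_pos)
        moreover have "0 \<le> norm (y - y0) * (4 * M * M)" using M(1) by simp
        ultimately show "2 * M * M * norm (y - y0) * norm u + e / 2 \<le> e"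
          by (simp add: algebra_simps)
      qed simp
      finally show ?thesis by (simp add: zy0 mult.commute)
    qed
    ultimately show "\<exists>d>0. \<forall>y. norm (y - y0) < d \<longrightarrow> norm (z y 1 - z y0 1 - G y0 (y - y0) u) \<le> e * norm (y - y0)"
      by blast
  qed
qed

section \<open>The cross product of \<open>\<phi>\<^sub>0\<close> and the group \<open>G\<^sub>2\<close>\<close>

lemma matrix_inv_both:
  fixes h :: "real^'n^'n"
  assumes "invertible h" shows "h ** matrix_inv h = mat 1" "matrix_inv h ** h = mat 1"
proof -
  have "h ** matrix_inv h = mat 1 \<and> matrix_inv h ** h = mat 1"
    unfolding matrix_inv_def using assms unfolding invertible_def by (rule someI_ex)
  then show "h ** matrix_inv h = mat 1" "matrix_inv h ** h = mat 1" by auto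
qed

lemma matrix_inv_eqI:
  fixes h :: "real^'n^'n"
  assumes "h ** k = mat 1" shows "matrix_inv h = k"
proof -
  have kh: "k ** h = mat 1" using assms matrix_left_right_inverse by blast
  then have "invertible h" using assms unfolding invertible_def by blast
  from matrix_inv_both(1)[OF this] have "k ** (h ** matrix_inv h) = k" by simp
  then show ?thesis by (simp add: matrix_mul_assoc kh)
qed

lemma matrix_inv_cancel:
  assumes "invertible (h :: real^'n^'n)"
  shows "matrix_inv h *v (h *v x) = x" "h *v (matrix_inv h *v x) = x"
  using matrix_inv_both[OF assms] by (simp_all add: matrix_vector_mul_assoc)

lemma matrix_inv_mult:
  assumes "invertible (g :: real^'n^'n)" "invertible (h :: real^'n^'n)"
  shows "matrix_inv (g ** h) = matrix_inv h ** matrix_inv g"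
proof (rule matrix_inv_eqI)
  have "g ** h ** (matrix_inv h ** matrix_inv g) = g ** (h ** matrix_inv h) ** matrix_inv g"
    by (simp only: matrix_mul_assoc)
  then show "g ** h ** (matrix_inv h ** matrix_inv g) = mat 1"
    by (simp add: matrix_inv_both assms)
qed

lemma orthogonal_matrix_inner:
  "orthogonal_matrix (m :: real^'n^'n) \<Longrightarrow> (m *v x) \<bullet> (m *v y) = x \<bullet> y"
  using orthogonal_transformation_matrix[of "(*v) m"] by (simp add: orthogonal_transformation_def)

lemma orthogonal_matrix_invertible: "orthogonal_matrix (m :: real^'n^'n) \<Longrightarrow> invertible m"
  unfolding orthogonal_matrix_def invertible_def by blast

lemma orthogonal_matrix_inv: "orthogonal_matrix (m :: real^'n^'n) \<Longrightarrow> matrix_inv m = transpose m"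
  by (rule matrix_inv_eqI) (simp add: orthogonal_matrix_def)

lemma orthogonal_matrix_surj: "orthogonal_matrix (m :: real^'n^'n) \<Longrightarrow> \<exists>x. m *v x = y"
  using matrix_inv_cancel(2)[OF orthogonal_matrix_invertible] by blast

lemma rotation_inv:
  assumes "rotation_matrix (h :: real^'n^'n)" shows "orthogonal_matrix (matrix_inv h)" "det (matrix_inv h) = 1" "invertible h"
proof -
  have o: "orthogonal_matrix h" and d: "det h = 1" using assms by (auto simp: rotation_matrix_def)
  show "invertible h" by (rule orthogonal_matrix_invertible[OF o])
  show "orthogonal_matrix (matrix_inv h)" using o by (simp add: orthogonal_matrix_inv orthogonal_matrix_transpose)
  show "det (matrix_inv h) = 1" using d by (simp add: orthogonal_matrix_inv[OF o] det_transpose)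
qed

lemma exhaust_7: fixes x :: 7
  shows "x = 1 \<or> x = 2 \<or> x = 3 \<or> x = 4 \<or> x = 5 \<or> x = 6 \<or> x = 7"
proof (induct x)
  case (of_int z)
  then have "0 \<le> z" and "z < 7" by simp_all
  then have "z = 0 \<or> z = 1 \<or> z = 2 \<or> z = 3 \<or> z = 4 \<or> z = 5 \<or> z = 6" by arith
  then show ?case by auto
qed

lemma forall_7: "(\<forall>i::7. P i) \<longleftrightarrow> P 1 \<and> P 2 \<and> P 3 \<and> P 4 \<and> P 5 \<and> P 6 \<and> P 7"
  by (metis exhaust_7)

lemma UNIV_7: "UNIV = {1::7, 2, 3, 4, 5, 6, 7}"
  using exhaust_7 by auto

lemma sum_7: "sum f (UNIV :: 7 set) = f 1 + f 2 + f 3 + f 4 + f 5 + f 6 + f 7"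
  unfolding UNIV_7 by (simp add: ac_simps)

lemma phi0_poly: "\<phi>\<^sub>0 u v w =
    u$1 * v$2 * w$3 - u$1 * v$3 * w$2 - u$2 * v$1 * w$3 + u$2 * v$3 * w$1 + u$3 * v$1 * w$2 - u$3 * v$2 * w$1
  + u$1 * v$4 * w$5 - u$1 * v$5 * w$4 - u$4 * v$1 * w$5 + u$4 * v$5 * w$1 + u$5 * v$1 * w$4 - u$5 * v$4 * w$1
  + u$1 * v$6 * w$7 - u$1 * v$7 * w$6 - u$6 * v$1 * w$7 + u$6 * v$7 * w$1 + u$7 * v$1 * w$6 - u$7 * v$6 * w$1
  + u$2 * v$4 * w$6 - u$2 * v$6 * w$4 - u$4 * v$2 * w$6 + u$4 * v$6 * w$2 + u$6 * v$2 * w$4 - u$6 * v$4 * w$2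
  - (u$2 * v$5 * w$7 - u$2 * v$7 * w$5 - u$5 * v$2 * w$7 + u$5 * v$7 * w$2 + u$7 * v$2 * w$5 - u$7 * v$5 * w$2)
  - (u$3 * v$4 * w$7 - u$3 * v$7 * w$4 - u$4 * v$3 * w$7 + u$4 * v$7 * w$3 + u$7 * v$3 * w$4 - u$7 * v$4 * w$3)
  - (u$3 * v$5 * w$6 - u$3 * v$6 * w$5 - u$5 * v$3 * w$6 + u$5 * v$6 * w$3 + u$6 * v$3 * w$5 - u$6 * v$5 * w$3)"
  unfolding \<phi>\<^sub>0_def dx3_def by (simp add: det_3 vector_3 algebra_simps)

lemma phi0_add: "\<phi>\<^sub>0 (u + u') v w = \<phi>\<^sub>0 u v w + \<phi>\<^sub>0 u' v w"
  and phi0_scale: "\<phi>\<^sub>0 (r *\<^sub>R u) v w = r * \<phi>\<^sub>0 u v w"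
  and phi0_swap12: "\<phi>\<^sub>0 v u w = - \<phi>\<^sub>0 u v w"
  and phi0_swap23: "\<phi>\<^sub>0 u w v = - \<phi>\<^sub>0 u v w"
  unfolding phi0_poly by (simp_all add: algebra_simps)

lemma linear_phi0_1: "linear (\<lambda>u. \<phi>\<^sub>0 u v w)"
  by (rule linearI) (simp_all add: phi0_add phi0_scale)

lemma linear_phi0_2: "linear (\<lambda>v. \<phi>\<^sub>0 u v w)"
  by (subst phi0_swap12) (rule linear_compose_neg[OF linear_phi0_1])

lemma linear_phi0_3: "linear (\<lambda>w. \<phi>\<^sub>0 u v w)"
  by (subst phi0_swap23) (rule linear_compose_neg[OF linear_phi0_2])

text \<open>
  The cross product of imaginary octonions.
\<close>

definition cross7 :: "real^7 \<Rightarrow> real^7 \<Rightarrow> real^7" where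
  "cross7 u v = (\<chi> i. \<phi>\<^sub>0 u v (axis i 1))"

lemma phi0_eq_cross7: "\<phi>\<^sub>0 u v w = cross7 u v \<bullet> w"
  using linear_vec_expand[OF linear_phi0_3, of u v w] by (simp add: cross7_def inner_vec_def mult.commute)

lemma cross7_swap: "cross7 v u = - cross7 u v"
  by (simp add: cross7_def vec_eq_iff phi0_swap12[of v])

lemma linear_cross7_1: "linear (\<lambda>u. cross7 u v)"
  by (rule linearI) (simp_all add: cross7_def vec_eq_iff phi0_add phi0_scale)

lemma linear_cross7_2: "linear (cross7 u)"
proof -
  have "cross7 u = (\<lambda>v. - cross7 v u)" by (rule ext) (rule cross7_swap)
  then show ?thesis by (simp only: linear_compose_neg[OF linear_cross7_1])
qed

lemma cross7_nth:
  "cross7 u v $ 1 = u$2 * v$3 - u$3 * v$2 + u$4 * v$5 - u$5 * v$4 + u$6 * v$7 - u$7 * v$6"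
  "cross7 u v $ 2 = u$3 * v$1 - u$1 * v$3 + u$4 * v$6 - u$6 * v$4 - u$5 * v$7 + u$7 * v$5"
  "cross7 u v $ 3 = u$1 * v$2 - u$2 * v$1 - u$4 * v$7 + u$7 * v$4 - u$5 * v$6 + u$6 * v$5"
  "cross7 u v $ 4 = u$5 * v$1 - u$1 * v$5 + u$6 * v$2 - u$2 * v$6 + u$3 * v$7 - u$7 * v$3"
  "cross7 u v $ 5 = u$1 * v$4 - u$4 * v$1 - u$7 * v$2 + u$2 * v$7 + u$3 * v$6 - u$6 * v$3"
  "cross7 u v $ 6 = u$7 * v$1 - u$1 * v$7 + u$2 * v$4 - u$4 * v$2 - u$3 * v$5 + u$5 * v$3"
  "cross7 u v $ 7 = u$1 * v$6 - u$6 * v$1 - u$2 * v$5 + u$5 * v$2 - u$3 * v$4 + u$4 * v$3"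
  unfolding cross7_def phi0_poly by (simp_all add: axis_def)

lemma cross7_cross7: "cross7 u (cross7 u v) = (u \<bullet> v) *\<^sub>R u - (u \<bullet> u) *\<^sub>R v"
  unfolding vec_eq_iff forall_7
  by (simp add: cross7_nth inner_vec_def sum_7 algebra_simps power2_eq_square)

lemma cross7_self [simp]: "cross7 u u = 0"
  by (simp add: vec_eq_iff forall_7 cross7_nth)

lemma cross7_orth [simp]: "u \<bullet> cross7 u v = 0" "cross7 u v \<bullet> u = 0"
proof -
  have "cross7 u v \<bullet> u = - (cross7 u v \<bullet> u)"
    using phi0_swap12[of v u u] phi0_swap23[of u v u] phi0_swap12[of u u v] phi0_swap23[of v u u]
    by (simp add: phi0_eq_cross7[symmetric])
  then show "cross7 u v \<bullet> u = 0" by simp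
  then show "u \<bullet> cross7 u v = 0" by (simp add: inner_commute)
qed

lemma cross7_adjoint: "cross7 u x \<bullet> y = - (x \<bullet> cross7 u y)"
  using phi0_swap23[of u y x] by (simp add: phi0_eq_cross7 inner_commute)

text \<open>
  Determinants of maps rather than matrices, so that the factorizations below can be verified
  pointwise.
\<close>

definition map_det :: "(real^'n \<Rightarrow> real^'n) \<Rightarrow> real" where "map_det f = det (matrix f)"

lemma map_det_compose: "linear f \<Longrightarrow> linear g \<Longrightarrow> map_det (\<lambda>x. g (f x)) = map_det g * map_det f"
  using matrix_compose[of f g] by (simp add: map_det_def o_def det_mul)

lemma map_det_ident [simp]: "map_det (\<lambda>x. x) = 1"
  by (simp add: map_det_def matrix_id_mat_1[unfolded id_def])

lemma map_det_adjoint: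
  assumes "linear f" "\<And>x y. f x \<bullet> y = x \<bullet> g y" shows "map_det g = map_det f"
proof -
  have "adjoint f = g" using assms(2) by (intro adjoint_unique) auto
  then show ?thesis using matrix_adjoint[OF assms(1)] by (simp add: map_det_def)
qed

lemma linear_rank1: "linear (\<lambda>x. (b \<bullet> x) *\<^sub>R u)" for b u :: "real^'n"
  by (rule linearI) (simp_all add: inner_add_right scaleR_add_left)

lemma linear_cross7_rank1: "linear (\<lambda>x. cross7 u x + (t * (b \<bullet> x)) *\<^sub>R w)"
  using linear_compose_add[OF linear_cross7_2[of u] linear_rank1[of "t *\<^sub>R b" w]] by simp

lemma linear_ident_rank1: "linear (\<lambda>x. x + (t * (b \<bullet> x)) *\<^sub>R w)" for b w :: "real^'n"
  using linear_compose_add[OF linear_ident linear_rank1[of "t *\<^sub>R b" w]] by simp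

text \<open>
  The product of this map with its adjoint is \<open>|u|\<^sup>2\<close> times the identity.
\<close>

lemma map_det_cross7_unit:
  assumes "u \<noteq> 0" shows "\<bar>map_det (\<lambda>x. cross7 u x + (1 / norm u * (u \<bullet> x)) *\<^sub>R u)\<bar> = norm u ^ 7"
proof -
  let ?M = "\<lambda>x. cross7 u x + (1 / norm u * (u \<bullet> x)) *\<^sub>R u"
  let ?M' = "\<lambda>x. - cross7 u x + (1 / norm u * (u \<bullet> x)) *\<^sub>R u"
  have N: "norm u \<noteq> 0" "u \<bullet> u = norm u * norm u" using assms by (simp_all add: dot_square_norm power2_eq_square)
  note lM = linear_cross7_rank1[of u "1 / norm u" u u]
  have "map_det ?M' = map_det ?M"
  proof (rule map_det_adjoint[OF lM])
    fix x y
    show "?M x \<bullet> y = x \<bullet> ?M' y"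
      using cross7_adjoint[of u x y] by (simp add: inner_add_left inner_diff_right inner_commute[of u])
  qed
  moreover have "map_det (\<lambda>x. ?M' (?M x)) = map_det ?M' * map_det ?M"
  proof (rule map_det_compose[OF lM])
    show "linear ?M'"
      using linear_compose_add[OF linear_compose_neg[OF linear_cross7_2[of u]] linear_rank1[of "(1 / norm u) *\<^sub>R u" u]] by simp
  qed
  moreover have "(\<lambda>x. ?M' (?M x)) = (*\<^sub>R) (norm u ^ 2)"
  proof
    fix x
    have "cross7 u (?M x) = cross7 u (cross7 u x)"
      by (simp add: linear_add[OF linear_cross7_2] linear_scale[OF linear_cross7_2])
    moreover have "u \<bullet> ?M x = norm u * (u \<bullet> x)" using N by (simp add: inner_add_right)
    ultimately show "?M' (?M x) = norm u ^ 2 *\<^sub>R x"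
      using N by (simp add: cross7_cross7 power2_eq_square)
  qed
  ultimately have "map_det ?M * map_det ?M = map_det ((*\<^sub>R) (norm u ^ 2) :: real^7 \<Rightarrow> real^7)" by simp
  also have "\<dots> = (norm u ^ 7) * (norm u ^ 7)"
    unfolding map_det_def det_matrix_scaleR by (simp add: power_mult[symmetric] power_add[symmetric])
  finally have "(map_det ?M)\<^sup>2 = (norm u ^ 7)\<^sup>2" by (simp add: power2_eq_square)
  then have "\<bar>map_det ?M\<bar> = \<bar>norm u ^ 7\<bar>" by (rule power2_eq_iff[THEN iffD1, THEN disjE]) simp_all
  then show ?thesis by simp
qed

text \<open>
  A rotation that carries a basis vector to \<open>u / |u|\<close> makes the map diagonal.
\<close>

lemma map_det_ident_rank1:
  fixes u :: "real^'n" assumes "u \<noteq> 0"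
  shows "map_det (\<lambda>x. x + (k * (u \<bullet> x)) *\<^sub>R u) = 1 + k * norm u ^ 2"
proof -
  obtain i0 :: 'n where True by blast
  define e where "e = u /\<^sub>R norm u"
  have ne: "norm e = 1" using assms by (simp add: e_def)
  obtain Q where Q: "orthogonal_matrix Q" "Q *v axis i0 1 = e"
    by (rule orthogonal_matrix_exists_basis[OF ne])
  define K where "K = k * norm u ^ 2"
  let ?D = "\<lambda>y. y + (K * (axis i0 1 \<bullet> y)) *\<^sub>R axis i0 1 :: real^'n"
  have QQ: "Q *v (transpose Q *v x) = x" for x
    using Q(1) unfolding orthogonal_matrix_def by (metis matrix_vector_mul_assoc matrix_vector_mul_lid)
  have ue: "u = norm u *\<^sub>R e" using assms by (simp add: e_def)
  have "x + (k * (u \<bullet> x)) *\<^sub>R u = Q *v ?D (transpose Q *v x)" for x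
  proof -
    have "axis i0 1 \<bullet> (transpose Q *v x) = e \<bullet> x"
      using dot_lmul_matrix[of x Q "axis i0 1"] by (simp add: Q(2) inner_commute)
    then have "Q *v ?D (transpose Q *v x) = x + (K * (e \<bullet> x)) *\<^sub>R e"
      using QQ by (simp add: matrix_vector_right_distrib matrix_vector_mult_scaleR Q(2) del: transpose_matrix_vector)
    also have "\<dots> = x + (k * (u \<bullet> x)) *\<^sub>R u"
    proof -
      have "u \<bullet> x = norm u * (e \<bullet> x)" by (metis ue inner_scaleR_left)
      then have "(k * (u \<bullet> x)) *\<^sub>R u = (k * (norm u * (e \<bullet> x))) *\<^sub>R (norm u *\<^sub>R e)"
        by (simp only: ue[symmetric])
      then show ?thesis by (simp add: K_def power2_eq_square mult_ac)
    qed
    finally show ?thesis by simp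
  qed
  then have "map_det (\<lambda>x. x + (k * (u \<bullet> x)) *\<^sub>R u) = map_det (\<lambda>x. Q *v ?D (transpose Q *v x))" by presburger
  also have "\<dots> = map_det ((*v) Q) * (map_det ?D * map_det ((*v) (transpose Q)))"
    using map_det_compose[OF linear_compose[OF matrix_vector_mul_linear linear_ident_rank1[of K "axis i0 1" "axis i0 1"], unfolded o_def, of "transpose Q"] matrix_vector_mul_linear[of Q]]
      map_det_compose[OF matrix_vector_mul_linear[of "transpose Q"] linear_ident_rank1[of K "axis i0 1" "axis i0 1"]]
    by (simp only:)
  also have "\<dots> = (det Q * det Q) * map_det ?D" by (simp add: map_det_def del: transpose_matrix_vector)
  also have "det Q * det Q = 1" using det_orthogonal_matrix[OF Q(1)] by auto
  also have "map_det ?D = 1 + K"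
  proof -
    have m: "matrix ?D $ i $ j = (if i = j then (if i = i0 then 1 + K else 1) else 0)" for i j
      unfolding matrix_def inner_axis' by (auto simp: axis_def)
    have "map_det ?D = (\<Prod>i\<in>UNIV. matrix ?D $ i $ i)" unfolding map_det_def by (rule det_diagonal) (simp add: m)
    also have "\<dots> = 1 + K" by (simp add: m prod.delta)
    finally show ?thesis .
  qed
  finally show ?thesis by (simp add: K_def)
qed

text \<open>
  Since \<open>u \<times> u = 0\<close>, the map is the one with \<open>t = 1 / |u|\<close> composed with a map
  \<open>x \<mapsto> x + k (u \<bullet> x) u\<close>.
\<close>

lemma map_det_cross7_rank1_self:
  assumes "u \<noteq> 0" shows "\<bar>map_det (\<lambda>x. cross7 u x + (t * (u \<bullet> x)) *\<^sub>R u)\<bar> = \<bar>t\<bar> * norm u ^ 8"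
proof -
  define N where "N = norm u"
  have N: "N > 0" "u \<bullet> u = N * N" using assms by (simp_all add: N_def dot_square_norm power2_eq_square)
  \<comment> \<open>solves \<open>1 / N + k N = t\<close>, the coefficient of the composition\<close>
  define k where "k = (t * N - 1) / N ^ 2"
  let ?M = "\<lambda>x. cross7 u x + (1 / N * (u \<bullet> x)) *\<^sub>R u" and ?R = "\<lambda>x. x + (k * (u \<bullet> x)) *\<^sub>R u"
  have "?M (?R x) = cross7 u x + (t * (u \<bullet> x)) *\<^sub>R u" for x
  proof -
    have "cross7 u (?R x) = cross7 u x" by (simp add: linear_add[OF linear_cross7_2] linear_scale[OF linear_cross7_2])
    moreover have "1 / N * (u \<bullet> ?R x) = t * (u \<bullet> x)"
      using N by (simp add: inner_add_right k_def field_simps power2_eq_square)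
    ultimately show ?thesis by simp
  qed
  then have "map_det (\<lambda>x. cross7 u x + (t * (u \<bullet> x)) *\<^sub>R u) = map_det ?M * map_det ?R"
    using map_det_compose[OF linear_ident_rank1[of k u u] linear_cross7_rank1[of u "1 / N" u u]] by presburger
  also have "\<bar>\<dots>\<bar> = N ^ 7 * \<bar>t * N\<bar>"
    using map_det_cross7_unit[OF assms] map_det_ident_rank1[OF assms, of k] N by (simp add: abs_mult N_def[symmetric] k_def)
  finally show ?thesis using N by (simp add: abs_mult N_def[symmetric] power_numeral_reduce)
qed

text \<open>
  The reflection in the hyperplane orthogonal to \<open>u\<close> conjugates the shear to its inverse.
\<close>

lemma map_det_shear:
  fixes u b :: "real^'n" assumes "b \<bullet> u = 0"
  shows "map_det (\<lambda>x. x + (1 * (b \<bullet> x)) *\<^sub>R u) ^ 2 = 1"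
proof (cases "u = 0")
  case False
  let ?S = "\<lambda>s x. x + (s * (b \<bullet> x)) *\<^sub>R u" and ?R = "\<lambda>x. x + (- 2 / norm u ^ 2 * (u \<bullet> x)) *\<^sub>R u"
  note lS = linear_ident_rank1[of _ b u] and lR = linear_ident_rank1[of "- 2 / norm u ^ 2" u u]
  have N: "u \<bullet> u = norm u ^ 2" by (simp add: dot_square_norm)
  have "(\<lambda>x. ?S 1 (?S (- 1) x)) = (\<lambda>x. x)" using assms by (simp add: inner_add_right inner_diff_right)
  then have 1: "map_det (?S 1) * map_det (?S (- 1)) = 1" using map_det_compose[OF lS[of "- 1"] lS[of 1]] by simp
  have RR: "?R (?S 1 (?R x)) = ?S (- 1) x" for x
    using False assms by (simp add: inner_add_right inner_diff_right inner_commute[of u b] N algebra_simps)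
      (simp add: vec_eq_iff)
  have "map_det (\<lambda>x. ?R (?S 1 (?R x))) = map_det ?R * map_det (\<lambda>x. ?S 1 (?R x))"
    by (rule map_det_compose[OF linear_compose[OF lR lS, unfolded o_def] lR])
  also have "map_det (\<lambda>x. ?S 1 (?R x)) = map_det (?S 1) * map_det ?R" by (rule map_det_compose[OF lR lS])
  also have "(\<lambda>x. ?R (?S 1 (?R x))) = ?S (- 1)" using RR by (rule ext)
  finally have "map_det (?S (- 1)) = map_det ?R * (map_det (?S 1) * map_det ?R)" .
  moreover have "map_det ?R = - 1" using map_det_ident_rank1[OF False, of "- 2 / norm u ^ 2"] False by simp
  ultimately show ?thesis using 1 by (simp add: power2_eq_square)
qed simp

text \<open>
  A shear \<open>S\<close> along \<open>u\<close> does not change the bilinear form of \<open>u \<times> _\<close>, of which \<open>u\<close> spans the kernel.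
  Its adjoint moves \<open>w\<close> to any other vector with the same inner product with \<open>u\<close>, for instance to
  a multiple of \<open>u\<close>, where the previous lemmas apply.
\<close>

lemma map_det_cross7_rank1:
  assumes "u \<noteq> 0" "u \<bullet> w \<noteq> 0"
  shows "\<bar>map_det (\<lambda>x. cross7 u x + (1 * (w \<bullet> x)) *\<^sub>R w)\<bar> = (u \<bullet> w) ^ 2 * norm u ^ 4"
proof -
  define s N where "s = u \<bullet> w" and "N = norm u"
  have N: "N > 0" "u \<bullet> u = N * N" "s \<noteq> 0" using assms by (simp_all add: s_def N_def dot_square_norm power2_eq_square)
  define w' where "w' = (s / N ^ 2) *\<^sub>R u"
  define b where "b = (w - w') /\<^sub>R s"
  have uw': "u \<bullet> w' = s" using N by (simp add: w'_def power2_eq_square)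
  have bu: "b \<bullet> u = 0" using uw' by (simp add: b_def inner_diff_left inner_diff_right inner_commute[of _ u] s_def)
  let ?S = "\<lambda>x. x + (1 * (b \<bullet> x)) *\<^sub>R u" and ?S' = "\<lambda>x. x + (1 * (u \<bullet> x)) *\<^sub>R b"
  let ?A = "\<lambda>w x. cross7 u x + (1 * (w \<bullet> x)) *\<^sub>R w"
  have w: "w = w' + s *\<^sub>R b" using N by (simp add: b_def)
  have "?S' (?A w' (?S x)) = ?A w x" for x
  proof -
    have 1: "cross7 u (?S x) = cross7 u x" by (simp add: linear_add[OF linear_cross7_2] linear_scale[OF linear_cross7_2])
    have 2: "w' \<bullet> ?S x = w \<bullet> x" using uw' by (subst w) (simp add: inner_add_right inner_add_left inner_commute)
    have "?A w' (?S x) = cross7 u x + (w \<bullet> x) *\<^sub>R w'" using 1 2 by simp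
    then have "?S' (?A w' (?S x)) = cross7 u x + (w \<bullet> x) *\<^sub>R (w' + s *\<^sub>R b)"
      using uw' by (simp add: inner_add_right scaleR_add_right mult.commute)
    then show ?thesis using w by simp
  qed
  then have "map_det (?A w) = map_det (\<lambda>x. ?S' (?A w' (?S x)))" by presburger
  also have "\<dots> = map_det ?S' * map_det (\<lambda>x. ?A w' (?S x))"
    by (rule map_det_compose[OF linear_compose[OF linear_ident_rank1 linear_cross7_rank1, unfolded o_def] linear_ident_rank1])
  also have "map_det (\<lambda>x. ?A w' (?S x)) = map_det (?A w') * map_det ?S" by (rule map_det_compose[OF linear_ident_rank1 linear_cross7_rank1])
  also have "map_det ?S' = map_det ?S"
    by (rule map_det_adjoint[OF linear_ident_rank1]) (simp add: inner_add_left inner_add_right inner_commute)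
  finally have "map_det (?A w) = map_det (?A w') * map_det ?S ^ 2" by (simp add: power2_eq_square)
  also have "map_det ?S ^ 2 = 1" by (rule map_det_shear[OF bu])
  finally have "map_det (?A w) = map_det (?A w')" by simp
  also have "?A w' = (\<lambda>x. cross7 u x + (s ^ 2 / N ^ 4 * (u \<bullet> x)) *\<^sub>R u)"
    by (simp add: w'_def fun_eq_iff power2_eq_square power_numeral_reduce mult_ac)
  also have "\<bar>map_det \<dots>\<bar> = \<bar>s ^ 2 / N ^ 4\<bar> * N ^ 8" unfolding N_def by (rule map_det_cross7_rank1_self[OF assms(1)])
  also have "\<dots> = s ^ 2 * N ^ 4" using N by (simp add: field_simps power_numeral_reduce)
  finally show ?thesis by (simp add: s_def N_def)
qed

text \<open>
  Let \<open>A\<^sub>u\<close> be the skew map \<open>u \<times> _\<close>. For \<open>h \<in> G\<^sub>2\<close> invariance of \<open>\<phi>\<^sub>0\<close> reads \<open>h\<^sup>T A\<^sub>h\<^sub>u h = A\<^sub>u\<close>. In odd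
  dimension these determinants vanish, so the rank one term \<open>w w\<^sup>T\<close> with \<open>w = h u\<close> is added to
  \<open>A\<^sub>h\<^sub>u\<close>; comparing determinants gives \<open>(det h)\<^sup>2 |h u|\<^sup>8 = |h u|\<^sup>4 |u|\<^sup>4\<close>.
\<close>

lemma G2_det_norm:
  assumes h: "h \<in> G2" shows "\<bar>det h\<bar> * norm (h *v u) ^ 2 = norm u ^ 2"
proof (cases "u = 0")
  case False
  have inv: "invertible h" and pr: "\<And>u v w. \<phi>\<^sub>0 (h *v u) (h *v v) (h *v w) = \<phi>\<^sub>0 u v w"
    using h by (auto simp: G2_def)
  define u' where "u' = h *v u"
  have u': "u' \<noteq> 0"
    unfolding u'_def using False inv invertible_eq_bij[of h] matrix_vector_mult_0_right[of h] by (metis bij_def inj_eq)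
  define w where "w = transpose h *v u'"
  have wx: "w \<bullet> x = u' \<bullet> (h *v x)" for x
    unfolding w_def using dot_lmul_matrix[of u' h x] by simp
  have eq: "transpose h *v (cross7 u' (h *v x) + (1 * (u' \<bullet> (h *v x))) *\<^sub>R u') = cross7 u x + (1 * (w \<bullet> x)) *\<^sub>R w" for x
  proof -
    have "transpose h *v cross7 u' (h *v x) = cross7 u x"
    proof (rule vector_eq_rdot[THEN iffD1, rule_format])
      fix y
      have "(transpose h *v cross7 u' (h *v x)) \<bullet> y = cross7 u' (h *v x) \<bullet> (h *v y)"
        using dot_lmul_matrix[of "cross7 u' (h *v x)" h y] by simp
      also have "\<dots> = cross7 u x \<bullet> y"
        using pr[of u x y] by (simp add: phi0_eq_cross7 u'_def)
      finally show "(transpose h *v cross7 u' (h *v x)) \<bullet> y = cross7 u x \<bullet> y" .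
    qed
    then show ?thesis
      by (simp add: matrix_vector_right_distrib matrix_vector_mult_scaleR wx w_def[symmetric] del: transpose_matrix_vector)
  qed
  let ?A = "\<lambda>u w x. cross7 u x + (1 * (w \<bullet> x)) *\<^sub>R w"
  have "map_det (?A u w) = map_det (\<lambda>x. transpose h *v (?A u' u' (h *v x)))" using eq by presburger
  also have "\<dots> = map_det ((*v) (transpose h)) * map_det (\<lambda>x. ?A u' u' (h *v x))"
    by (rule map_det_compose[OF linear_compose[OF matrix_vector_mul_linear linear_cross7_rank1, unfolded o_def] matrix_vector_mul_linear])
  also have "map_det (\<lambda>x. ?A u' u' (h *v x)) = map_det (?A u' u') * map_det ((*v) h)"
    by (rule map_det_compose[OF matrix_vector_mul_linear linear_cross7_rank1])
  finally have "map_det (?A u w) = det h ^ 2 * map_det (?A u' u')"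
    by (simp add: map_det_def power2_eq_square del: transpose_matrix_vector)
  then have 1: "\<bar>map_det (?A u w)\<bar> = det h ^ 2 * \<bar>map_det (?A u' u')\<bar>" by (simp add: abs_mult)
  have uw: "u \<bullet> w = norm u' ^ 2" using wx[of u] by (simp add: inner_commute u'_def[symmetric] dot_square_norm)
  then have uw0: "u \<bullet> w \<noteq> 0" using u' by simp
  have "(norm u' ^ 2) ^ 2 * norm u ^ 4 = det h ^ 2 * ((norm u' ^ 2) ^ 2 * norm u' ^ 4)"
    using 1 map_det_cross7_rank1[OF False uw0] map_det_cross7_rank1[OF u', of u'] u' by (simp add: uw dot_square_norm)
  then have "(norm u' ^ 2) ^ 2 * norm u ^ 4 = (norm u' ^ 2) ^ 2 * (det h ^ 2 * norm u' ^ 4)"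
    by (simp only: mult.left_commute)
  then have "norm u ^ 4 = det h ^ 2 * norm u' ^ 4"
    by (rule mult_left_cancel[THEN iffD1, rotated]) (use u' in simp)
  then have "(norm u ^ 2) ^ 2 = (\<bar>det h\<bar> * norm u' ^ 2) ^ 2" by (simp add: power_mult_distrib)
  then have "norm u ^ 2 = \<bar>det h\<bar> * norm u' ^ 2" by (rule power2_eq_imp_eq) simp_all
  then show ?thesis by (simp add: u'_def)
qed simp

text \<open>
  By the previous lemma \<open>|det h|\<^sup>1\<^sup>/\<^sup>2 h\<close> is an isometry, so \<open>|det h|\<^sup>7\<^sup>/\<^sup>2\<^sup>+\<^sup>1 = 1\<close> and the factor is \<open>1\<close>.
\<close>

lemma G2_orthogonal:
  assumes h: "h \<in> G2" shows "orthogonal_matrix h"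
proof -
  have dn: "det h \<noteq> 0" using h invertible_det_nz by (auto simp: G2_def)
  define r where "r = sqrt \<bar>det h\<bar>"
  have r: "r > 0" "r ^ 2 = \<bar>det h\<bar>" using dn by (auto simp: r_def)
  have nr: "norm (r *\<^sub>R (h *v x)) = norm x" for x
  proof -
    have "(norm (r *\<^sub>R (h *v x))) ^ 2 = norm x ^ 2"
      using G2_det_norm[OF h, of x] r by (simp add: power_mult_distrib)
    then show ?thesis by (rule power2_eq_imp_eq) simp_all
  qed
  have lr: "linear (\<lambda>x. r *\<^sub>R (h *v x))" by (intro linear_compose_scale_right matrix_vector_mul_linear)
  have "orthogonal_transformation (\<lambda>x. r *\<^sub>R (h *v x))" unfolding orthogonal_transformation using lr nr by blast
  then have "orthogonal_matrix (matrix (\<lambda>x. r *\<^sub>R (h *v x)))" using orthogonal_transformation_matrix by blast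
  then have "\<bar>map_det (\<lambda>x. r *\<^sub>R (h *v x))\<bar> = 1" using det_orthogonal_matrix by (force simp: map_det_def)
  moreover have "map_det (\<lambda>x. r *\<^sub>R (h *v x)) = map_det ((*\<^sub>R) r :: real^7 \<Rightarrow> real^7) * map_det ((*v) h)"
    by (rule map_det_compose) auto
  ultimately have "r ^ 7 * r ^ 2 = 1" using r by (simp add: map_det_def abs_mult)
  then have "r ^ 9 = 1 ^ 9" by (simp add: power_add[symmetric])
  then have "r = 1" using r power_eq_imp_eq_base[of r 9 1] by simp
  then have "orthogonal_transformation ((*v) h)"
    unfolding orthogonal_transformation using nr by simp
  then show ?thesis using orthogonal_transformation_matrix[of "(*v) h"] by simp
qed

lemma G2_invertible: "h \<in> G2 \<Longrightarrow> invertible h" by (simp add: G2_def)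

lemma G2_phi0: "h \<in> G2 \<Longrightarrow> \<phi>\<^sub>0 (h *v u) (h *v v) (h *v w) = \<phi>\<^sub>0 u v w" by (simp add: G2_def)

lemma G2_mult: "h \<in> G2 \<Longrightarrow> k \<in> G2 \<Longrightarrow> h ** k \<in> G2"
  by (simp add: G2_def invertible_mult matrix_vector_mul_assoc[symmetric])

lemma invertible_matrix_inv: "invertible (h :: real^'n^'n) \<Longrightarrow> invertible (matrix_inv h)"
  using matrix_inv_both invertible_def by blast

lemma G2_inv:
  assumes "h \<in> G2" shows "matrix_inv h \<in> G2"
proof -
  have i: "invertible h" using assms by (rule G2_invertible)
  have "\<phi>\<^sub>0 (matrix_inv h *v u) (matrix_inv h *v v) (matrix_inv h *v w) = \<phi>\<^sub>0 u v w" for u v w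
    using G2_phi0[OF assms, of "matrix_inv h *v u" "matrix_inv h *v v" "matrix_inv h *v w"]
    by (simp add: matrix_inv_cancel[OF i])
  then show ?thesis using invertible_matrix_inv[OF i] by (simp add: G2_def)
qed

lemma G2_one: "mat 1 \<in> G2"
  by (simp add: G2_def invertible_def)

lemma phi0_nondegenerate:
  assumes "\<And>v w. \<phi>\<^sub>0 u v w = 0" shows "u = 0"
proof -
  have c: "cross7 u v = 0" for v by (simp add: vec_eq_iff cross7_def assms)
  show ?thesis
    using c[of "axis 1 1", unfolded vec_eq_iff forall_7 cross7_nth] c[of "axis 2 1", unfolded vec_eq_iff forall_7 cross7_nth]
    unfolding vec_eq_iff forall_7 by (simp add: axis_def)
qed

text \<open>
  A vector \<open>y\<close> is determined by the numbers \<open>\<phi>\<^sub>0 y v w\<close>, and these are prescribed by any \<open>x\<close> related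
  to \<open>y\<close>; so \<open>R\<close> is single valued, and linear because \<open>\<phi>\<^sub>0\<close> is. With \<open>R\<close> the relation between the
  end values of parallel fields, uniqueness and linearity of parallel transport come for free.
\<close>

lemma phi0_relation:
  assumes tot: "\<And>x. \<exists>y. R x y" and sur: "\<And>y. \<exists>x. R x y"
    and pr: "\<And>x1 x2 x3 y1 y2 y3. R x1 y1 \<Longrightarrow> R x2 y2 \<Longrightarrow> R x3 y3 \<Longrightarrow> \<phi>\<^sub>0 x1 x2 x3 = \<phi>\<^sub>0 y1 y2 y3"
  shows "\<exists>k\<in>G2. \<forall>x y. R x y \<longleftrightarrow> y = k *v x"
proof -
  obtain \<kappa> where \<kappa>: "\<And>x. R x (\<kappa> x)" using tot by metis
  have eqI: "y = y'" if "\<And>v w x' x''. R x' v \<Longrightarrow> R x'' w \<Longrightarrow> \<phi>\<^sub>0 y v w = \<phi>\<^sub>0 y' v w" for y y'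
  proof -
    have "\<phi>\<^sub>0 (y - y') v w = 0" for v w
    proof -
      obtain x' x'' where "R x' v" "R x'' w" using sur by blast
      then show ?thesis using that linear_diff[OF linear_phi0_1[of v w], of y y'] by simp
    qed
    then show ?thesis using phi0_nondegenerate[of "y - y'"] by simp
  qed
  have uniq: "y = \<kappa> x" if "R x y" for x y
    by (rule eqI) (metis pr[OF that] pr[OF \<kappa>])
  have lin: "linear \<kappa>"
  proof (rule linearI)
    show "\<kappa> (x + x') = \<kappa> x + \<kappa> x'" for x x'
      by (rule eqI) (simp add: phi0_add pr[OF \<kappa>, symmetric])
    show "\<kappa> (r *\<^sub>R x) = r *\<^sub>R \<kappa> x" for r x
      by (rule eqI) (simp add: phi0_scale pr[OF \<kappa>, symmetric])
  qed
  have k: "matrix \<kappa> *v x = \<kappa> x" for x using matrix_vector_mul(2)[OF lin] by (rule fun_cong)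
  show ?thesis
  proof (intro bexI[of _ "matrix \<kappa>"] allI)
    show "R x y \<longleftrightarrow> y = matrix \<kappa> *v x" for x y using uniq \<kappa> k by metis
    have pres: "\<phi>\<^sub>0 (\<kappa> u) (\<kappa> v) (\<kappa> w) = \<phi>\<^sub>0 u v w" for u v w using pr[OF \<kappa> \<kappa> \<kappa>] by simp
    have "inj \<kappa>"
    proof (rule linear_injective_0[OF lin, THEN iffD2], intro allI impI)
      fix x assume "\<kappa> x = 0"
      then have "\<phi>\<^sub>0 x v w = 0" for v w using pres[of x v w] linear_0[OF linear_phi0_1] by simp
      then show "x = 0" by (rule phi0_nondegenerate)
    qed
    moreover have "surj \<kappa>" using sur uniq by (metis surj_def)
    moreover have "(*v) (matrix \<kappa>) = \<kappa>" using k by (rule ext)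
    ultimately have "invertible (matrix \<kappa>)" unfolding invertible_eq_bij by (simp add: bij_def)
    then show "matrix \<kappa> \<in> G2" using pres k by (simp add: G2_def)
  qed
qed

lemma cross7_polar:
  "cross7 u (cross7 v w) = (u \<bullet> w) *\<^sub>R v + (v \<bullet> w) *\<^sub>R u - (2 * (u \<bullet> v)) *\<^sub>R w - cross7 v (cross7 u w)"
proof -
  have "cross7 (u + v) (cross7 (u + v) w) = ((u + v) \<bullet> w) *\<^sub>R (u + v) - ((u + v) \<bullet> (u + v)) *\<^sub>R w"
    by (rule cross7_cross7)
  moreover have "cross7 (u + v) (cross7 (u + v) w)
      = cross7 u (cross7 u w) + cross7 v (cross7 v w) + (cross7 u (cross7 v w) + cross7 v (cross7 u w))"
    by (simp add: linear_add[OF linear_cross7_1] linear_add[OF linear_cross7_2])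
  ultimately have "cross7 u (cross7 v w) + cross7 v (cross7 u w) =
      ((u + v) \<bullet> w) *\<^sub>R (u + v) - ((u + v) \<bullet> (u + v)) *\<^sub>R w - cross7 u (cross7 u w) - cross7 v (cross7 v w)"
    by (simp add: algebra_simps)
  also have "\<dots> = (u \<bullet> w) *\<^sub>R v + (v \<bullet> w) *\<^sub>R u - (2 * (u \<bullet> v)) *\<^sub>R w"
    by (simp add: cross7_cross7 inner_add_left inner_add_right inner_commute[of v u] scaleR_add_left scaleR_add_right scaleR_diff_left)
  finally show ?thesis by (simp add: algebra_simps)
qed

lemma cross7_inner: "cross7 u v \<bullet> cross7 u w = (u \<bullet> u) * (v \<bullet> w) - (u \<bullet> v) * (u \<bullet> w)"
  using cross7_adjoint[of u v "cross7 u w"] by (simp add: cross7_cross7 inner_diff_right inner_commute algebra_simps)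

lemma cross7_cyclic: "cross7 u v \<bullet> w = cross7 v w \<bullet> u"
  using phi0_swap12[of u v w] phi0_swap23[of v u w] by (simp add: phi0_eq_cross7)

lemma phi0_axis3: "\<phi>\<^sub>0 u v (axis k 1) = cross7 u v $ k"
  by (simp add: cross7_def)

text \<open>
  The standard basis satisfies \<open>e\<^sub>3 = e\<^sub>1 \<times> e\<^sub>2\<close>, \<open>e\<^sub>5 = e\<^sub>1 \<times> e\<^sub>4\<close>, \<open>e\<^sub>6 = e\<^sub>2 \<times> e\<^sub>4\<close>, \<open>e\<^sub>7 = e\<^sub>1 \<times> e\<^sub>6\<close>. The
  product is a parameter, to be instantiated also with the cross product of a rotated \<open>\<phi>\<^sub>0\<close>.
\<close>

definition g2_frame :: "(real^7 \<Rightarrow> real^7 \<Rightarrow> real^7) \<Rightarrow> real^7 \<Rightarrow> real^7 \<Rightarrow> real^7 \<Rightarrow> 7 \<Rightarrow> real^7" where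
  "g2_frame X a b d i = (if i = 1 then a else if i = 2 then b else if i = 3 then X a b else if i = 4 then d
     else if i = 5 then X a d else if i = 6 then X b d else X a (X b d))"

lemma trilinear_phi0_ext:
  assumes lin: "linear m"
    and basis: "\<And>i j k. \<phi>\<^sub>0 (m (axis i 1)) (m (axis j 1)) (m (axis k 1)) = \<phi>\<^sub>0 (axis i 1) (axis j 1) (axis k 1)"
  shows "\<phi>\<^sub>0 (m x) (m y) (m z) = \<phi>\<^sub>0 x y z"
proof -
  have 1: "\<phi>\<^sub>0 (m (axis i 1)) (m (axis j 1)) (m z) = \<phi>\<^sub>0 (axis i 1) (axis j 1) z" for i j z
    using linear_vec_expand[OF linear_compose[OF lin linear_phi0_3[of "m (axis i 1)" "m (axis j 1)"], unfolded o_def], of z]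
      linear_vec_expand[OF linear_phi0_3[of "axis i 1" "axis j 1"], of z] by (simp only: basis)
  have 2: "\<phi>\<^sub>0 (m (axis i 1)) (m y) (m z) = \<phi>\<^sub>0 (axis i 1) y z" for i y z
    using linear_vec_expand[OF linear_compose[OF lin linear_phi0_2[of "m (axis i 1)" "m z"], unfolded o_def], of y]
      linear_vec_expand[OF linear_phi0_2[of "axis i 1" z], of y] by (simp only: 1)
  show ?thesis
    using linear_vec_expand[OF linear_compose[OF lin linear_phi0_1[of "m y" "m z"], unfolded o_def], of x]
      linear_vec_expand[OF linear_phi0_1[of y z], of x] by (simp only: 2)
qed

text \<open>
  The identity for \<open>u \<times> (v \<times> w) + v \<times> (u \<times> w)\<close> computes the products of the seven vectors from
  their inner products; the result is the multiplication table of the standard basis.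
\<close>

lemma g2_frame_in_G2:
  assumes n: "a \<bullet> a = 1" "b \<bullet> b = 1" "d \<bullet> d = 1" and o: "a \<bullet> b = 0" "a \<bullet> d = 0" "b \<bullet> d = 0" "cross7 a b \<bullet> d = 0"
  shows "(\<chi> i j. g2_frame cross7 a b d j $ i) \<in> G2"
proof -
  define c e f where "c = cross7 a b" and "e = cross7 a d" and "f = cross7 b d"
  define g where "g = cross7 a f"
  have ab: "cross7 a b = c" and ad: "cross7 a d = e" and bd: "cross7 b d = f" and af: "cross7 a f = g"
    by (simp_all add: c_def e_def f_def g_def)
  have o': "b \<bullet> a = 0" "d \<bullet> a = 0" "d \<bullet> b = 0" using o by (simp_all add: inner_commute)
  have cd0: "c \<bullet> d = 0" using o by (simp add: c_def)
  have fa0: "f \<bullet> a = 0" using cross7_cyclic[of a b d] cd0 by (simp add: f_def c_def)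
  have eb0: "e \<bullet> b = 0" using cross7_cyclic[of b a d] cd0 cross7_swap[of a b] by (simp add: e_def c_def)
  have ca0: "c \<bullet> a = 0" "c \<bullet> b = 0" using cross7_orth(2)[of b a] cross7_swap[of b a] by (simp_all add: c_def)
  have ea0: "e \<bullet> a = 0" "e \<bullet> d = 0" using cross7_orth(2)[of d a] cross7_swap[of d a] by (simp_all add: e_def)
  have fb0: "f \<bullet> b = 0" "f \<bullet> d = 0" using cross7_orth(2)[of d b] cross7_swap[of d b] by (simp_all add: f_def)
  have ga0: "g \<bullet> a = 0" "g \<bullet> f = 0" using cross7_orth(2)[of f a] cross7_swap[of f a] by (simp_all add: g_def)
  have ce0: "c \<bullet> e = 0" using cross7_inner[of a b d] n o by (simp add: c_def e_def)
  have cf0: "c \<bullet> f = 0" using cross7_inner[of b a d] n o o' cross7_swap[of a b] by (simp add: c_def f_def)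
  have ef0: "e \<bullet> f = 0" using cross7_inner[of d a b] n o o' cross7_swap[of a d] cross7_swap[of b d] by (simp add: e_def f_def)
  have ff: "f \<bullet> f = 1" using cross7_inner[of b d d] n o by (simp add: f_def)
  have ee: "e \<bullet> e = 1" using cross7_inner[of a d d] n o by (simp add: e_def)
  have cc: "c \<bullet> c = 1" using cross7_inner[of a b b] n o by (simp add: c_def)
  have gg: "g \<bullet> g = 1" using cross7_inner[of a f f] n o fa0 ff by (simp add: g_def inner_commute)
  have cg0: "c \<bullet> g = 0" using cross7_inner[of a b f] n o fa0 fb0 by (simp add: c_def g_def inner_commute)
  have eg0: "e \<bullet> g = 0" using cross7_inner[of a d f] n o fa0 fb0 by (simp add: e_def g_def inner_commute)
  have gd0: "g \<bullet> d = 0" using cross7_cyclic[of a f d] cross7_cyclic[of d a f] cross7_swap[of d a] ef0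
    by (simp add: g_def e_def inner_commute)
  have gb0: "g \<bullet> b = 0" using cross7_cyclic[of a f b] cross7_cyclic[of b a f] cross7_swap[of b a] cf0
    by (simp add: g_def c_def inner_commute)
  note zeros = o o' cd0 fa0 eb0 ca0 ea0 fb0 ga0 ce0 cf0 ef0 cg0 eg0 gd0 gb0
  note zeros' = zeros zeros[unfolded inner_commute[of _ d]] zeros[unfolded inner_commute[of _ a]] zeros[unfolded inner_commute[of _ b]]
    zeros[unfolded inner_commute[of _ e]] zeros[unfolded inner_commute[of _ f]] zeros[unfolded inner_commute[of _ g]]
  have neg: "cross7 u (- v) = - cross7 u v" for u v using linear_neg[OF linear_cross7_2] .
  have ac: "cross7 a c = - b" using cross7_cross7[of a b] n o by (simp add: c_def)
  have ae: "cross7 a e = - d" using cross7_cross7[of a d] n o by (simp add: e_def)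
  have ag: "cross7 a g = - f" using cross7_cross7[of a f] n fa0 by (simp add: g_def inner_commute)
  have ba: "cross7 b a = - c" using cross7_swap[of b a] by (simp add: c_def)
  have bc: "cross7 b c = a" using cross7_cross7[of b a] n o' ba by (simp add: neg)
  have bf: "cross7 b f = - d" using cross7_cross7[of b d] n o by (simp add: f_def)
  have be: "cross7 b e = - g" using cross7_polar[of b a d] o o' by (simp add: e_def[symmetric] bd af)
  have bg: "cross7 b g = e" using cross7_polar[of b a f] o o' fa0 fb0 by (simp add: g_def[symmetric] bf neg ad inner_commute)
  have db: "cross7 d b = - f" using cross7_swap[of d b] by (simp add: f_def)
  have da: "cross7 d a = - e" using cross7_swap[of d a] by (simp add: e_def)
  have dc: "cross7 d c = g" using cross7_polar[of d a b] o o' by (simp add: ab db neg af)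
  have cd: "cross7 c d = - g" using cross7_swap[of c d] dc by simp
  have ce: "cross7 c e = - f" using cross7_polar[of c a d] o o' cd0 ca0 by (simp add: ad cd neg ag inner_commute)
  have cf: "cross7 c f = e" using cross7_polar[of c b d] o o' cd0 ca0 by (simp add: bd cd neg bg inner_commute)
  have cg: "cross7 c g = d" using cross7_polar[of c a f] fa0 ca0 cf0 by (simp add: af cf ae inner_commute)
  have de: "cross7 d e = a" using cross7_cross7[of d a] n o' by (simp add: da neg)
  have df: "cross7 d f = b" using cross7_cross7[of d b] n o' by (simp add: db neg)
  have dg: "cross7 d g = - c" using cross7_polar[of d a f] o o' fa0 fb0 by (simp add: af df ab inner_commute)
  have ed: "cross7 e d = - a" using cross7_swap[of e d] de by simp
  have ef: "cross7 e f = - c" using cross7_polar[of e b d] o o' ea0 eb0 by (simp add: bd ed neg ba inner_commute)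
  have eg: "cross7 e g = - b" using cross7_polar[of e a f] fa0 ea0 ef0 by (simp add: af ef neg ac inner_commute)
  have fa: "cross7 f a = - g" using cross7_swap[of f a] by (simp add: g_def)
  have fg: "cross7 f g = a" using cross7_cross7[of f a] ff fa0 by (simp add: fa neg)
  note table1 = ab ad bd af ac ae ag bc bf be bg cd ce cf cg de df dg ef eg fg
  note table2 = ba da db fa ed dc cross7_swap[of c a] cross7_swap[of e a] cross7_swap[of g a] cross7_swap[of c b]
    cross7_swap[of f b] cross7_swap[of e b] cross7_swap[of g b] cross7_swap[of e c] cross7_swap[of f c] cross7_swap[of g c]
    cross7_swap[of f d] cross7_swap[of g d] cross7_swap[of f e] cross7_swap[of g e] cross7_swap[of g f]
  define G where "G = g2_frame cross7 a b d"
  have G: "G 1 = a" "G 2 = b" "G 3 = c" "G 4 = d" "G 5 = e" "G 6 = f" "G 7 = g"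
    by (simp_all add: G_def g2_frame_def table1)
  have prod: "\<forall>i j. cross7 (G i) (G j) = (\<Sum>k\<in>UNIV. \<phi>\<^sub>0 (axis i 1) (axis j 1) (axis k 1) *\<^sub>R G k)"
    unfolding forall_7 sum_7 G phi0_axis3 cross7_nth
    by (intro conjI; simp add: axis_def; simp add: table2 table1)
  have orth: "\<forall>i j. G i \<bullet> G j = (if i = j then 1 else 0)"
    unfolding forall_7 G by (simp add: n cc ee ff gg zeros zeros')
  define K where "K = (\<chi> i j. G j $ i)"
  have Kcol: "K *v axis j 1 = G j" for j
    by (simp add: K_def matrix_vector_mult_basis column_def vec_eq_iff)
  have str: "\<phi>\<^sub>0 (G i) (G j) (G k) = \<phi>\<^sub>0 (axis i 1) (axis j 1) (axis k 1)" for i j k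
    by (simp add: phi0_eq_cross7[of "G i"] prod inner_sum_left orth if_distrib cong: if_cong)
  have pr: "\<phi>\<^sub>0 (K *v x) (K *v y) (K *v z) = \<phi>\<^sub>0 x y z" for x y z
    by (rule trilinear_phi0_ext[where m = "(*v) K"], rule matrix_vector_mul_linear) (simp only: Kcol str)
  have "transpose K ** K = mat 1"
    unfolding matrix_mult_transpose_dot_column by (simp add: vec_eq_iff column_def K_def orth mat_def)
  then have "invertible K" using orthogonal_matrix[of K] by (auto simp: orthogonal_matrix_def invertible_def)
  then show ?thesis using pr by (simp add: G2_def K_def G_def)
qed

section \<open>Manifolds: coordinates, vector fields, derivatives\<close>

locale smooth_manifold =
  fixes \<A> :: "'a::topological_space chart set"
  assumes atlas: "smooth_atlas \<A>"
begin

abbreviation T :: "'a \<Rightarrow> 'a tvec set" where "T p \<equiv> tangent_space \<A> p"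
abbreviation E :: "'a chart \<Rightarrow> 'a \<Rightarrow> real^7 \<Rightarrow> 'a tvec" where "E c p v \<equiv> coord_vec \<A> c p v"
abbreviation TD :: "'a chart \<Rightarrow> 'a chart \<Rightarrow> 'a \<Rightarrow> real^7 \<Rightarrow> real^7" where
  "TD c c' p \<equiv> frechet_derivative (coord c' \<circ> chart_inv c) (at (coord c p))"

lemma chart_open [simp, intro]: "c \<in> \<A> \<Longrightarrow> open (dom_chart c)"
  and chart_homeo: "c \<in> \<A> \<Longrightarrow> homeomorphism (dom_chart c) (coord c ` dom_chart c) (coord c) (chart_inv c)"
  and coord_image_open': "c \<in> \<A> \<Longrightarrow> open (coord c ` dom_chart c)"
  and transition_smooth: "c \<in> \<A> \<Longrightarrow> c' \<in> \<A> \<Longrightarrow>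
    smooth_on (coord c ` (dom_chart c \<inter> dom_chart c')) (coord c' \<circ> chart_inv c)"
  using atlas unfolding smooth_atlas_def by blast+

lemma chart_cover: obtains c where "c \<in> \<A>" "p \<in> dom_chart c"
  using atlas unfolding smooth_atlas_def by blast

lemma chart_inv_coord [simp]: "c \<in> \<A> \<Longrightarrow> q \<in> dom_chart c \<Longrightarrow> chart_inv c (coord c q) = q"
  using chart_homeo homeomorphism_def by metis

lemma coord_chart_inv [simp]: "c \<in> \<A> \<Longrightarrow> y \<in> coord c ` dom_chart c \<Longrightarrow> coord c (chart_inv c y) = y"
  by auto

lemma chart_inv_in: "c \<in> \<A> \<Longrightarrow> W \<subseteq> dom_chart c \<Longrightarrow> y \<in> coord c ` W \<Longrightarrow> chart_inv c y \<in> W"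
  by (auto simp: subset_iff)

lemma chart_inv_continuous: "c \<in> \<A> \<Longrightarrow> continuous_on (coord c ` dom_chart c) (chart_inv c)"
  using chart_homeo homeomorphism_def by blast

lemma coord_continuous: "c \<in> \<A> \<Longrightarrow> continuous_on (dom_chart c) (coord c)"
  using chart_homeo homeomorphism_def by blast

lemma coord_image_open:
  assumes "c \<in> \<A>" "open W" "W \<subseteq> dom_chart c"
  shows "open (coord c ` W)"
proof -
  have "coord c ` W = coord c ` dom_chart c \<inter> chart_inv c -` W"
    using assms by (auto simp: image_iff subset_iff)
  then show ?thesis
    using continuous_open_preimage[OF chart_inv_continuous coord_image_open' assms(2)] assms(1) by metis
qed

lemma TD_has_derivative:
  assumes "c \<in> \<A>" "c' \<in> \<A>" "p \<in> dom_chart c" "p \<in> dom_chart c'"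
  shows "((coord c' \<circ> chart_inv c) has_derivative TD c c' p) (at (coord c p))"
  by (rule smooth_on_has_derivative[OF transition_smooth[OF assms(1,2)]]) (use assms in auto)

lemma TD_linear:
  assumes "c \<in> \<A>" "c' \<in> \<A>" "p \<in> dom_chart c" "p \<in> dom_chart c'"
  shows "linear (TD c c' p)"
  using has_derivative_linear[OF TD_has_derivative[OF assms]] .

lemma TD_TD:
  assumes "c \<in> \<A>" "c' \<in> \<A>" "c'' \<in> \<A>" "p \<in> dom_chart c" "p \<in> dom_chart c'" "p \<in> dom_chart c''"
  shows "TD c' c'' p (TD c c' p v) = TD c c'' p v"
proof -
  have p: "(coord c' \<circ> chart_inv c) (coord c p) = coord c' p" using assms by simp
  have "((\<lambda>y. (coord c'' \<circ> chart_inv c') ((coord c' \<circ> chart_inv c) y)) has_derivative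
      (\<lambda>v. TD c' c'' p (TD c c' p v))) (at (coord c p))"
    by (rule has_derivative_compose[OF TD_has_derivative[OF assms(1,2,4,5)]])
      (unfold p, rule TD_has_derivative[OF assms(2,3,5,6)])
  then have "((coord c'' \<circ> chart_inv c) has_derivative (\<lambda>v. TD c' c'' p (TD c c' p v))) (at (coord c p))"
  proof (rule has_derivative_transform_within_open)
    show "open (coord c ` (dom_chart c \<inter> dom_chart c'))"
      using assms by (intro coord_image_open) auto
  qed (use assms in auto)
  then show ?thesis using frechet_derivative_eqI by metis
qed

lemma TD_self:
  assumes "c \<in> \<A>" "p \<in> dom_chart c" shows "TD c c p v = v"
proof -
  have "((\<lambda>y. y) has_derivative (\<lambda>v. v)) (at (coord c p))" by (rule has_derivative_ident)
  then have "((coord c \<circ> chart_inv c) has_derivative (\<lambda>v. v)) (at (coord c p))"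
    by (rule has_derivative_transform_within_open[OF _ coord_image_open'[OF assms(1)]]) (use assms in auto)
  then show ?thesis using frechet_derivative_eqI by metis
qed

lemma coord_vec_apply:
  "c' \<in> \<A> \<Longrightarrow> p \<in> dom_chart c' \<Longrightarrow> E c p v c' = TD c c' p v"
  by (simp add: coord_vec_def)

lemma coord_vec_self [simp]: "c \<in> \<A> \<Longrightarrow> p \<in> dom_chart c \<Longrightarrow> E c p v c = v"
  by (simp add: coord_vec_apply TD_self)

lemma coord_vec_tangent: "c \<in> \<A> \<Longrightarrow> p \<in> dom_chart c \<Longrightarrow> E c p v \<in> T p"
  unfolding tangent_space_def by (auto simp: coord_vec_def TD_TD)

lemma tangent_change:
  "X \<in> T p \<Longrightarrow> c \<in> \<A> \<Longrightarrow> c' \<in> \<A> \<Longrightarrow> p \<in> dom_chart c \<Longrightarrow> p \<in> dom_chart c' \<Longrightarrow> X c' = TD c c' p (X c)"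
  unfolding tangent_space_def by blast

lemma tangent_eq_coord_vec:
  assumes "X \<in> T p" "c \<in> \<A>" "p \<in> dom_chart c" shows "E c p (X c) = X"
proof
  fix c'
  show "E c p (X c) c' = X c'"
  proof (cases "c' \<in> \<A> \<and> p \<in> dom_chart c'")
    case True
    then show ?thesis using tangent_change[OF assms(1,2) _ assms(3), of c'] by (simp add: coord_vec_def)
  next
    case False
    then have "X c' = 0" using assms(1) unfolding tangent_space_def by blast
    then show ?thesis unfolding coord_vec_def using False by (simp only: if_False)
  qed
qed

lemma tangent_eqI:
  "X \<in> T p \<Longrightarrow> Y \<in> T p \<Longrightarrow> c \<in> \<A> \<Longrightarrow> p \<in> dom_chart c \<Longrightarrow> X c = Y c \<Longrightarrow> X = Y"
  using tangent_eq_coord_vec by metis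

lemma linear_coord_vec:
  assumes "c \<in> \<A>" "p \<in> dom_chart c" shows "linear (\<lambda>v. E c p v)"
proof (rule linearI; rule ext)
  fix v w c'
  show "E c p (v + w) c' = (E c p v + E c p w) c'"
    using linear_add[OF TD_linear[OF assms(1) _ assms(2)]] by (simp add: coord_vec_def plus_fun_def)
next
  fix r v c'
  show "E c p (r *\<^sub>R v) c' = (r *\<^sub>R E c p v) c'"
    using linear_scale[OF TD_linear[OF assms(1) _ assms(2)]] by (simp add: coord_vec_def scaleR_fun_def)
qed

lemma T_image: "c \<in> \<A> \<Longrightarrow> p \<in> dom_chart c \<Longrightarrow> T p = range (E c p)"
  using coord_vec_tangent tangent_eq_coord_vec by (metis (no_types, lifting) image_subset_iff rangeI subsetI subset_antisym)

lemma subspace_T: "subspace (T p)"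
proof -
  obtain c where "c \<in> \<A>" "p \<in> dom_chart c" by (rule chart_cover)
  then show ?thesis using T_image linear_coord_vec linear_subspace_image subspace_UNIV by metis
qed

lemmas T_add = subspace_add[OF subspace_T] and T_scale = subspace_scale[OF subspace_T]
  and T_diff = subspace_diff[OF subspace_T] and T_0 = subspace_0[OF subspace_T]
  and T_sum = subspace_sum[OF subspace_T]

lemma transition_smooth_subset:
  assumes "c \<in> \<A>" "c' \<in> \<A>" "W \<subseteq> dom_chart c \<inter> dom_chart c'"
  shows "smooth_on (coord c ` W) (\<lambda>y. coord c' (chart_inv c y))"
  using smooth_on_subset[OF transition_smooth[OF assms(1,2)], of "coord c ` W"] assms(3)
  by (auto simp: o_def image_mono)

lemma smooth_on_change_chart:
  assumes "open W" "c \<in> \<A>" "c' \<in> \<A>" "W \<subseteq> dom_chart c" "W \<subseteq> dom_chart c'"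
    and "smooth_on (coord c ` W) (\<lambda>y. g (chart_inv c y))"
  shows "smooth_on (coord c' ` W) (\<lambda>y. g (chart_inv c' y))"
proof -
  have o: "open (coord c ` W)" "open (coord c' ` W)" using assms by (auto intro: coord_image_open)
  have "smooth_on (coord c' ` W) (\<lambda>y. (\<lambda>y. g (chart_inv c y)) (coord c (chart_inv c' y)))"
    by (rule smooth_on_compose[OF o(2,1)])
      (use assms in \<open>auto intro!: transition_smooth_subset simp: subset_iff\<close>)
  moreover have "chart_inv c (coord c (chart_inv c' y)) = chart_inv c' y" if "y \<in> coord c' ` W" for y
    using that assms by (auto simp: subset_iff)
  ultimately show ?thesis
    by (subst smooth_on_cong[OF o(2), of _ "\<lambda>y. g (chart_inv c (coord c (chart_inv c' y)))"]) simp_all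
qed

lemma TD_smooth:
  assumes "open W" "c \<in> \<A>" "c' \<in> \<A>" "W \<subseteq> dom_chart c" "W \<subseteq> dom_chart c'"
  shows "smooth_on (coord c ` W) (\<lambda>y. TD c c' (chart_inv c y) v)"
proof -
  have o: "open (coord c ` W)" using assms by (auto intro: coord_image_open)
  have "smooth_on (coord c ` W) (\<lambda>y. frechet_derivative (coord c' \<circ> chart_inv c) (at y) v)"
    by (intro smooth_on_frechet_derivative smooth_on_subset[OF transition_smooth]) (use assms in auto)
  then show ?thesis
    by (subst smooth_on_cong[OF o, of _ "\<lambda>y. frechet_derivative (coord c' \<circ> chart_inv c) (at y) v"])
      (use assms in auto)
qed

text \<open>
  In another chart the components differ by the derivative of the change of coordinates, which
  is smooth; so one chart suffices.
\<close>

lemma smooth_vfI: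
  assumes "open W" "c \<in> \<A>" "W \<subseteq> dom_chart c" "\<And>q. q \<in> W \<Longrightarrow> Y q \<in> T q"
    and "smooth_on (coord c ` W) (\<lambda>y. Y (chart_inv c y) c)"
  shows "smooth_vf \<A> W Y"
  unfolding smooth_vf_def
proof (intro conjI ballI assms(1,4))
  fix c' assume c': "c' \<in> \<A>"
  let ?W = "W \<inter> dom_chart c'"
  have W: "open ?W" "?W \<subseteq> dom_chart c" "?W \<subseteq> dom_chart c'" using assms c' by auto
  have o: "open (coord c ` ?W)" using assms W by (auto intro: coord_image_open)
  have "smooth_on (coord c ` ?W) (\<lambda>y. TD c c' (chart_inv c y) (Y (chart_inv c y) c))"
  proof (rule smooth_on_apply_linear[where L = "\<lambda>y. TD c c' (chart_inv c y)", OF o])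
    show "linear (TD c c' (chart_inv c y))" if "y \<in> coord c ` ?W" for y
      using that chart_inv_in[OF assms(2) W(2)] W by (intro TD_linear assms c') auto
    show "smooth_on (coord c ` ?W) (\<lambda>y. TD c c' (chart_inv c y) v)" for v
      using W assms c' by (intro TD_smooth)
    show "smooth_on (coord c ` ?W) (\<lambda>y. Y (chart_inv c y) c)"
      using assms(5) by (rule smooth_on_subset) auto
  qed
  moreover have "TD c c' (chart_inv c y) (Y (chart_inv c y) c) = Y (chart_inv c y) c'" if "y \<in> coord c ` ?W" for y
  proof -
    have q: "chart_inv c y \<in> ?W" by (rule chart_inv_in[OF assms(2) W(2) that])
    show ?thesis
      by (rule tangent_change[symmetric, OF assms(4) assms(2) c']) (use q assms(3) in auto)
  qed
  ultimately have "smooth_on (coord c ` ?W) (\<lambda>y. Y (chart_inv c y) c')"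
    by (subst smooth_on_cong[OF o, of _ "\<lambda>y. TD c c' (chart_inv c y) (Y (chart_inv c y) c)"]) simp_all
  then show "smooth_on (coord c' ` ?W) (\<lambda>y. Y (chart_inv c' y) c')"
    by (rule smooth_on_change_chart[OF W(1) assms(2) c' W(2,3)])
qed

lemma smooth_vf_coord_vec:
  assumes "c \<in> \<A>" shows "smooth_vf \<A> (dom_chart c) (\<lambda>r. E c r w)"
proof (rule smooth_vfI[OF chart_open assms])
  show "smooth_on (coord c ` dom_chart c) (\<lambda>y. E c (chart_inv c y) w c)"
    using smooth_on_cong[OF coord_image_open'[OF assms], of "\<lambda>y. E c (chart_inv c y) w c" "\<lambda>y. w"]
      smooth_on_const[OF coord_image_open'[OF assms]] assms by (simp add: chart_inv_in)
qed (use assms coord_vec_tangent in auto)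

lemma smooth_vf_open: "smooth_vf \<A> W Y \<Longrightarrow> open W" by (simp add: smooth_vf_def)
lemma smooth_vf_tangent: "smooth_vf \<A> W Y \<Longrightarrow> q \<in> W \<Longrightarrow> Y q \<in> T q" by (simp add: smooth_vf_def)

lemma smooth_vf_chart:
  assumes "smooth_vf \<A> W Y" "c \<in> \<A>" "W' \<subseteq> W" "W' \<subseteq> dom_chart c"
  shows "smooth_on (coord c ` W') (\<lambda>y. Y (chart_inv c y) c)"
proof -
  have "smooth_on (coord c ` (W \<inter> dom_chart c)) (\<lambda>y. Y (chart_inv c y) c)"
    using assms by (simp add: smooth_vf_def)
  then show ?thesis by (rule smooth_on_subset) (use assms in auto)
qed

lemma smooth_vf_subset: "smooth_vf \<A> W Y \<Longrightarrow> open W' \<Longrightarrow> W' \<subseteq> W \<Longrightarrow> smooth_vf \<A> W' Y"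
  unfolding smooth_vf_def by (meson Int_mono image_mono order_refl smooth_on_subset subsetD)

lemma smooth_vf_sum:
  assumes "\<And>i. i \<in> I \<Longrightarrow> smooth_vf \<A> W (Y i)" "open W"
  shows "smooth_vf \<A> W (\<lambda>q. \<Sum>i\<in>I. Y i q)"
  unfolding smooth_vf_def
proof (intro conjI ballI assms(2))
  fix q assume "q \<in> W" then show "(\<Sum>i\<in>I. Y i q) \<in> T q" using assms by (intro T_sum smooth_vf_tangent)
next
  fix c assume c: "c \<in> \<A>"
  have "open (coord c ` (W \<inter> dom_chart c))" using c assms by (intro coord_image_open) auto
  then have "smooth_on (coord c ` (W \<inter> dom_chart c)) (\<lambda>y. \<Sum>i\<in>I. Y i (chart_inv c y) c)"
    using assms(1) c unfolding smooth_vf_def by (intro smooth_on_sum) auto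
  moreover have "(\<lambda>y. \<Sum>i\<in>I. Y i (chart_inv c y) c) = (\<lambda>y. (\<Sum>i\<in>I. Y i (chart_inv c y)) c)"
  proof
    fix y show "(\<Sum>i\<in>I. Y i (chart_inv c y) c) = (\<Sum>i\<in>I. Y i (chart_inv c y)) c"
      by (induction I rule: infinite_finite_induct) (auto simp: plus_fun_def zero_fun_def)
  qed
  ultimately show "smooth_on (coord c ` (W \<inter> dom_chart c)) (\<lambda>y. (\<Sum>i\<in>I. Y i (chart_inv c y)) c)" by simp
qed

lemma smooth_vf_fun_scale:
  assumes "smooth_vf \<A> W Y" "smooth_fun \<A> W h"
  shows "smooth_vf \<A> W (\<lambda>q. h q *\<^sub>R Y q)"
  unfolding smooth_vf_def
proof (intro conjI ballI smooth_vf_open[OF assms(1)])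
  fix q assume "q \<in> W" then show "h q *\<^sub>R Y q \<in> T q" using assms by (intro T_scale smooth_vf_tangent)
next
  fix c assume c: "c \<in> \<A>"
  have "open (coord c ` (W \<inter> dom_chart c))"
    using c smooth_vf_open[OF assms(1)] by (intro coord_image_open) auto
  then have "smooth_on (coord c ` (W \<inter> dom_chart c)) (\<lambda>y. h (chart_inv c y) *\<^sub>R Y (chart_inv c y) c)"
    using assms c unfolding smooth_vf_def smooth_fun_def by (intro smooth_on_scaleR) auto
  then show "smooth_on (coord c ` (W \<inter> dom_chart c)) (\<lambda>y. (h (chart_inv c y) *\<^sub>R Y (chart_inv c y)) c)"
    by (simp add: scaleR_fun_def)
qed

lemma smooth_funI:
  assumes "open W" "c \<in> \<A>" "W \<subseteq> dom_chart c" "smooth_on (coord c ` W) (\<lambda>y. h (chart_inv c y))"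
  shows "smooth_fun \<A> W h"
  unfolding smooth_fun_def
proof (intro conjI ballI assms(1))
  fix c' assume c': "c' \<in> \<A>"
  show "smooth_on (coord c' ` (W \<inter> dom_chart c')) (\<lambda>y. h (chart_inv c' y))"
    by (rule smooth_on_change_chart[of _ c]) (use assms c' in \<open>auto intro: smooth_on_subset\<close>)
qed

text \<open>
  The chain rule makes the chart chosen in the definition irrelevant.
\<close>

lemma dir_deriv_chart:
  assumes "c \<in> \<A>" "p \<in> dom_chart c" "X \<in> T p"
    and "((\<lambda>y. h (chart_inv c y)) has_derivative h') (at (coord c p))"
  shows "dir_deriv \<A> p X h = h' (X c)"
proof -
  define c0 where "c0 = (SOME c. c \<in> \<A> \<and> p \<in> dom_chart c)"
  have c0: "c0 \<in> \<A>" "p \<in> dom_chart c0"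
    using someI[of "\<lambda>c. c \<in> \<A> \<and> p \<in> dom_chart c" c] assms by (auto simp: c0_def)
  have p: "(coord c \<circ> chart_inv c0) (coord c0 p) = coord c p" using c0 by simp
  have "((\<lambda>y. (\<lambda>y. h (chart_inv c y)) ((coord c \<circ> chart_inv c0) y)) has_derivative
      (\<lambda>v. h' (TD c0 c p v))) (at (coord c0 p))"
    by (rule has_derivative_compose[OF TD_has_derivative[OF c0(1) assms(1) c0(2) assms(2)]])
      (unfold p, rule assms(4))
  then have "((\<lambda>y. h (chart_inv c0 y)) has_derivative (\<lambda>v. h' (TD c0 c p v))) (at (coord c0 p))"
  proof (rule has_derivative_transform_within_open)
    show "open (coord c0 ` (dom_chart c0 \<inter> dom_chart c))"
      using assms c0 by (intro coord_image_open) auto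
  qed (use assms c0 in auto)
  from frechet_derivative_eqI[OF this] show ?thesis
    unfolding dir_deriv_def Let_def c0_def[symmetric]
    using tangent_change[OF assms(3) c0(1) assms(1) c0(2) assms(2)] by simp
qed

lemma dir_deriv_cong:
  assumes "open W" "p \<in> W" "\<And>q. q \<in> W \<Longrightarrow> h q = h' q"
  shows "dir_deriv \<A> p X h = dir_deriv \<A> p X h'"
proof -
  define c0 where "c0 = (SOME c. c \<in> \<A> \<and> p \<in> dom_chart c)"
  obtain c where "c \<in> \<A>" "p \<in> dom_chart c" by (rule chart_cover)
  then have c0: "c0 \<in> \<A>" "p \<in> dom_chart c0"
    using someI[of "\<lambda>c. c \<in> \<A> \<and> p \<in> dom_chart c" c] by (auto simp: c0_def)
  have "frechet_derivative (\<lambda>y. h (chart_inv c0 y)) (at (coord c0 p)) =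
      frechet_derivative (\<lambda>y. h' (chart_inv c0 y)) (at (coord c0 p))"
  proof (rule frechet_derivative_cong_open(1))
    show "open (coord c0 ` (W \<inter> dom_chart c0))"
      using assms c0 by (intro coord_image_open) auto
  qed (use assms c0 in auto)
  then show ?thesis unfolding dir_deriv_def Let_def c0_def[symmetric] by simp
qed

end

section \<open>Connections in coordinates\<close>

lemma sum_fun_apply: "(\<Sum>i\<in>I. f i) x = (\<Sum>i\<in>I. f i x)"
  by (induction I rule: infinite_finite_induct) (auto simp: plus_fun_def zero_fun_def)

locale smooth_connection = smooth_manifold \<A> + connection \<A> D
  for \<A> :: "'a::topological_space chart set" and D :: "'a conn"
begin

abbreviation \<Gamma> :: "'a chart \<Rightarrow> 'a \<Rightarrow> real^7 \<Rightarrow> real^7 \<Rightarrow> real^7" where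
  "\<Gamma> c q v w \<equiv> christoffel \<A> D c q v w"

lemma christoffel_linear1:
  assumes "c \<in> \<A>" "q \<in> dom_chart c"
  shows "linear (\<lambda>v. \<Gamma> c q v w)"
proof (rule linearI)
  note vf = smooth_vf_coord_vec[OF assms(1)]
  show "\<Gamma> c q (v + v') w = \<Gamma> c q v w + \<Gamma> c q v' w" for v v'
    using add_left[OF vf assms(2) coord_vec_tangent[OF assms, of v] coord_vec_tangent[OF assms, of v']]
    by (simp add: christoffel_def linear_add[OF linear_coord_vec[OF assms]] plus_fun_def)
  show "\<Gamma> c q (r *\<^sub>R v) w = r *\<^sub>R \<Gamma> c q v w" for r v
    using scale_left[OF vf assms(2) coord_vec_tangent[OF assms, of v]]
    by (simp add: christoffel_def linear_scale[OF linear_coord_vec[OF assms]] scaleR_fun_def)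
qed

lemma dir_deriv_const:
  assumes "X \<in> T p" shows "dir_deriv \<A> p X (\<lambda>q. a) = 0"
proof -
  obtain c where c: "c \<in> \<A>" "p \<in> dom_chart c" by (rule chart_cover)
  show ?thesis by (rule dir_deriv_chart[OF c assms has_derivative_const])
qed

lemma D_const_scale:
  assumes "smooth_vf \<A> W Y" "c \<in> \<A>" "W \<subseteq> dom_chart c" "p \<in> W" "X \<in> T p"
  shows "D p X (\<lambda>q. a *\<^sub>R Y q) = a *\<^sub>R D p X Y"
proof -
  have "smooth_fun \<A> W (\<lambda>q. a)"
    using assms smooth_vf_open by (intro smooth_funI[of _ c] smooth_on_const coord_image_open)
  from Leibniz[OF this assms(1,4,5)] show ?thesis by (simp add: dir_deriv_const[OF assms(5)])
qed

lemma christoffel_linear2: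
  assumes "c \<in> \<A>" "q \<in> dom_chart c"
  shows "linear (\<lambda>w. \<Gamma> c q v w)"
proof (rule linearI)
  note vf = smooth_vf_coord_vec[OF assms(1)] and X = coord_vec_tangent[OF assms, of v]
  show "\<Gamma> c q v (w + w') = \<Gamma> c q v w + \<Gamma> c q v w'" for w w'
  proof -
    have "D q (E c q v) (\<lambda>r. E c r w + E c r w') = D q (E c q v) (\<lambda>r. E c r (w + w'))"
      by (rule local[OF vf assms(2) X]) (simp add: linear_add[OF linear_coord_vec[OF assms(1)]])
    then show ?thesis
      using add_right[OF vf vf assms(2) X, of w w'] by (simp add: christoffel_def plus_fun_def)
  qed
  show "\<Gamma> c q v (r *\<^sub>R w) = r *\<^sub>R \<Gamma> c q v w" for r w
  proof -
    have "D q (E c q v) (\<lambda>s. r *\<^sub>R E c s w) = D q (E c q v) (\<lambda>s. E c s (r *\<^sub>R w))"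
      by (rule local[OF vf assms(2) X]) (simp add: linear_scale[OF linear_coord_vec[OF assms(1)]])
    then show ?thesis
      using D_const_scale[OF vf assms(1) order_refl assms(2) X, of r w]
      by (simp add: christoffel_def scaleR_fun_def)
  qed
qed

lemma christoffel_smooth:
  assumes "c \<in> \<A>"
  shows "smooth_on (coord c ` dom_chart c) (\<lambda>y. \<Gamma> c (chart_inv c y) v w)"
  unfolding christoffel_def
  using smooth_vf_chart[OF smooth[OF smooth_vf_coord_vec[OF assms, of v] smooth_vf_coord_vec[OF assms, of w]] assms order_refl order_refl] .

lemma D_sum:
  assumes "finite I" "I \<noteq> {}" "\<And>i. i \<in> I \<Longrightarrow> smooth_vf \<A> W (Y i)" "p \<in> W" "X \<in> T p"
  shows "D p X (\<lambda>q. \<Sum>i\<in>I. Y i q) = (\<Sum>i\<in>I. D p X (Y i))"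
  using assms(1-3)
proof (induction I rule: finite_ne_induct)
  case (insert i I)
  have "open W" using insert.prems smooth_vf_open by blast
  then have "smooth_vf \<A> W (\<lambda>q. \<Sum>i\<in>I. Y i q)" using insert.prems by (intro smooth_vf_sum) auto
  from add_right[OF insert.prems[OF insertI1] this assms(4,5)]
  have "D p X (\<lambda>q. Y i q + (\<Sum>i\<in>I. Y i q)) = D p X (Y i) + (\<Sum>i\<in>I. D p X (Y i))"
    using insert.IH insert.prems by (simp only: insertI2)
  then show ?case by (simp only: sum.insert[OF insert.hyps(1,3)])
qed (simp only: sum.insert[OF finite.emptyI] sum.empty empty_iff not_False_eq_True add_0_right)

text \<open>
  Write \<open>Y\<close> as a combination of coordinate fields and apply the Leibniz rule.
\<close>

lemma D_in_chart:
  assumes Y: "smooth_vf \<A> W Y" and p: "p \<in> W" "c \<in> \<A>" "p \<in> dom_chart c" and X: "X \<in> T p"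
    and Y': "((\<lambda>y. Y (chart_inv c y) c) has_derivative Y') (at (coord c p))"
  shows "D p X Y c = Y' (X c) + \<Gamma> c p (X c) (Y p c)"
proof -
  define W' where "W' = W \<inter> dom_chart c"
  have W': "open W'" "W' \<subseteq> W" "W' \<subseteq> dom_chart c" "p \<in> W'"
    using smooth_vf_open[OF Y] p by (auto simp: W'_def)
  note YW' = smooth_vf_subset[OF Y W'(1,2)]
  have EW': "smooth_vf \<A> W' (\<lambda>r. E c r v)" for v
    by (rule smooth_vf_subset[OF smooth_vf_coord_vec[OF p(2)] W'(1,3)])
  define h where "h i q = Y q c $ i" for i q
  have h: "smooth_fun \<A> W' (h i)" for i
    unfolding h_def using p(2) W'
    by (intro smooth_funI[OF W'(1) p(2) W'(3)] smooth_on_nth coord_image_open smooth_vf_chart[OF Y p(2)])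
  have Yexp: "(\<Sum>i\<in>UNIV. h i q *\<^sub>R E c q (axis i 1)) = Y q" if "q \<in> W'" for q
  proof -
    have q: "q \<in> dom_chart c" "q \<in> W" using that W' by auto
    have "E c q (Y q c) = (\<Sum>i\<in>UNIV. (Y q c $ i) *\<^sub>R E c q (axis i 1))"
      by (rule linear_vec_expand[OF linear_coord_vec[OF p(2) q(1)]])
    then show ?thesis
      using tangent_eq_coord_vec[OF smooth_vf_tangent[OF Y q(2)] p(2) q(1)] by (simp add: h_def)
  qed
  have "D p X Y = D p X (\<lambda>q. \<Sum>i\<in>UNIV. h i q *\<^sub>R E c q (axis i 1))"
    by (rule local[symmetric, OF YW' W'(4) X]) (rule Yexp)
  also have "\<dots> = (\<Sum>i\<in>UNIV. D p X (\<lambda>q. h i q *\<^sub>R E c q (axis i 1)))"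
    by (rule D_sum[OF _ _ smooth_vf_fun_scale[OF EW' h] W'(4) X]) auto
  also have "\<dots> = (\<Sum>i\<in>UNIV. dir_deriv \<A> p X (h i) *\<^sub>R E c p (axis i 1) + h i p *\<^sub>R D p X (\<lambda>q. E c q (axis i 1)))"
    by (intro sum.cong refl Leibniz[OF h EW' W'(4) X])
  finally have "D p X Y c = (\<Sum>i\<in>UNIV. dir_deriv \<A> p X (h i) *\<^sub>R axis i 1 + (Y p c $ i) *\<^sub>R \<Gamma> c p (X c) (axis i 1))"
    using p tangent_eq_coord_vec[OF X p(2,3)]
    by (simp add: sum_fun_apply plus_fun_def scaleR_fun_def christoffel_def h_def)
  moreover have "dir_deriv \<A> p X (h i) = Y' (X c) $ i" for i
    unfolding h_def
    by (rule dir_deriv_chart[OF p(2,3) X]) (rule bounded_linear.has_derivative[OF bounded_linear_vec_nth Y'])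
  ultimately show ?thesis
    using linear_vec_expand[OF christoffel_linear2[OF p(2,3)], of "X c" "Y p c"]
      linear_vec_expand[OF linear_ident, of "Y' (X c)"]
    by (simp add: sum.distrib)
qed

lemma smooth_vf_has_derivative:
  assumes Y: "smooth_vf \<A> W Y" and p: "p \<in> W" "c \<in> \<A>" "p \<in> dom_chart c"
  shows "((\<lambda>y. Y (chart_inv c y) c) has_derivative frechet_derivative (\<lambda>y. Y (chart_inv c y) c) (at (coord c p))) (at (coord c p))"
proof (rule smooth_on_has_derivative)
  show "smooth_on (coord c ` (W \<inter> dom_chart c)) (\<lambda>y. Y (chart_inv c y) c)"
    by (rule smooth_vf_chart[OF Y p(2)]) auto
qed (use p in auto)

abbreviation comp :: "'a form3 \<Rightarrow> 'a chart \<Rightarrow> 'a \<Rightarrow> real^7 \<Rightarrow> real^7 \<Rightarrow> real^7 \<Rightarrow> real" where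
  "comp \<omega> c q u v w \<equiv> \<omega> q (E c q u) (E c q v) (E c q w)"

lemma alt3_swap:
  assumes "alt3_at \<A> p \<omega>" "u \<in> T p" "v \<in> T p" "w \<in> T p"
  shows "\<omega> v u w = - \<omega> u v w" "\<omega> u w v = - \<omega> u v w"
  using assms unfolding alt3_at_def Let_def by blast+

lemma alt3_add_scale:
  assumes "alt3_at \<A> p \<omega>" "u \<in> T p" "u' \<in> T p" "v \<in> T p" "w \<in> T p"
  shows "\<omega> (u + u') v w = \<omega> u v w + \<omega> u' v w" "\<omega> (r *\<^sub>R u) v w = r * \<omega> u v w"
  using assms unfolding alt3_at_def Let_def by blast+

lemma comp_linear1:
  assumes "alt3_at \<A> q (\<omega> q)" "c \<in> \<A>" "q \<in> dom_chart c"
  shows "linear (\<lambda>u. comp \<omega> c q u v w)"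
  using alt3_add_scale[OF assms(1) coord_vec_tangent[OF assms(2,3)] coord_vec_tangent[OF assms(2,3)]
    coord_vec_tangent[OF assms(2,3)] coord_vec_tangent[OF assms(2,3)]]
    linear_add[OF linear_coord_vec[OF assms(2,3)]] linear_scale[OF linear_coord_vec[OF assms(2,3)]]
  by (intro linearI) auto

lemma comp_swap:
  assumes "alt3_at \<A> q (\<omega> q)" "c \<in> \<A>" "q \<in> dom_chart c"
  shows "comp \<omega> c q v u w = - comp \<omega> c q u v w" "comp \<omega> c q u w v = - comp \<omega> c q u v w"
  by (rule alt3_swap[where \<omega> = "\<omega> q", OF assms(1)]; rule coord_vec_tangent[OF assms(2,3)])+

lemma comp_linear2:
  assumes "alt3_at \<A> q (\<omega> q)" "c \<in> \<A>" "q \<in> dom_chart c"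
  shows "linear (\<lambda>v. comp \<omega> c q u v w)"
proof -
  have "(\<lambda>v. comp \<omega> c q u v w) = (\<lambda>v. - comp \<omega> c q v u w)"
    by (rule ext) (rule comp_swap(1)[where \<omega> = \<omega>, OF assms])
  then show ?thesis by (simp only: linear_compose_neg[OF comp_linear1[where \<omega> = \<omega>, OF assms]])
qed

lemma comp_linear3:
  assumes "alt3_at \<A> q (\<omega> q)" "c \<in> \<A>" "q \<in> dom_chart c"
  shows "linear (\<lambda>w. comp \<omega> c q u v w)"
proof -
  have "(\<lambda>w. comp \<omega> c q u v w) = (\<lambda>w. - comp \<omega> c q u w v)"
    by (rule ext) (rule comp_swap(2)[where \<omega> = \<omega>, OF assms])
  then show ?thesis by (simp only: linear_compose_neg[OF comp_linear2[where \<omega> = \<omega>, OF assms]])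
qed

text \<open>
  The equation \<open>D\<omega> = 0\<close> for coordinate vector fields; it determines all partial derivatives of the
  components of \<open>\<omega>\<close>.
\<close>

definition parallel_components :: "'a form3 \<Rightarrow> bool" where
  "parallel_components \<omega> \<longleftrightarrow> (\<forall>c\<in>\<A>. \<forall>q\<in>dom_chart c. \<forall>u v w.
     ((\<lambda>y. comp \<omega> c (chart_inv c y) u v w) has_derivative
      (\<lambda>x. comp \<omega> c q (\<Gamma> c q x u) v w + comp \<omega> c q u (\<Gamma> c q x v) w + comp \<omega> c q u v (\<Gamma> c q x w)))
     (at (coord c q)))"

text \<open>
  The product rule along a map \<open>q\<close> into the manifold, which will be a curve or the inverse of a
  chart. The Christoffel terms of the form combine with the derivatives of the arguments to
  covariant derivatives.
\<close>

lemma form_covariant_derivative: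
  assumes alt: "\<And>p. alt3_at \<A> p (\<omega> p)" and par: "parallel_components \<omega>"
    and c: "c \<in> \<A>" and t: "t \<in> S" and q: "\<forall>\<^sub>F s in at t within S. q s \<in> dom_chart c" "q t \<in> dom_chart c"
    and x: "((\<lambda>s. coord c (q s)) has_derivative x') (at t within S)"
    and u1: "(u1 has_derivative u1') (at t within S)"
    and u2: "(u2 has_derivative u2') (at t within S)"
    and u3: "(u3 has_derivative u3') (at t within S)"
  shows "((\<lambda>s. comp \<omega> c (q s) (u1 s) (u2 s) (u3 s)) has_derivative
    (\<lambda>h. comp \<omega> c (q t) (u1' h + \<Gamma> c (q t) (x' h) (u1 t)) (u2 t) (u3 t)
       + comp \<omega> c (q t) (u1 t) (u2' h + \<Gamma> c (q t) (x' h) (u2 t)) (u3 t)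
       + comp \<omega> c (q t) (u1 t) (u2 t) (u3' h + \<Gamma> c (q t) (x' h) (u3 t)))) (at t within S)"
proof -
  let ?P = "\<lambda>x u v w. comp \<omega> c (q t) (\<Gamma> c (q t) x u) v w + comp \<omega> c (q t) u (\<Gamma> c (q t) x v) w
    + comp \<omega> c (q t) u v (\<Gamma> c (q t) x w)"
  have 0: "((\<lambda>s. comp \<omega> c (q s) u v w) has_derivative (\<lambda>h. ?P (x' h) u v w)) (at t within S)" for u v w
  proof -
    have "((\<lambda>y. comp \<omega> c (chart_inv c y) u v w) has_derivative (\<lambda>x. ?P x u v w)) (at (coord c (q t)))"
      using par c q(2) unfolding parallel_components_def by blast
    from has_derivative_compose[OF x this]
    show ?thesis
    proof (rule has_derivative_transform_eventually)
      show "\<forall>\<^sub>F s in at t within S. comp \<omega> c (chart_inv c (coord c (q s))) u v w = comp \<omega> c (q s) u v w"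
        using q(1) by eventually_elim (use c in simp)
    qed (use c q(2) t in auto)
  qed
  have lin: "\<forall>\<^sub>F s in at t within S. linear (\<lambda>u. comp \<omega> c (q s) u (v s) (w s))"
    "\<forall>\<^sub>F s in at t within S. linear (\<lambda>v. comp \<omega> c (q s) (u s) v (w s))"
    "\<forall>\<^sub>F s in at t within S. linear (\<lambda>w. comp \<omega> c (q s) (u s) (v s) w)" for u v w
    using q(1) by (eventually_elim; simp add: comp_linear1 comp_linear2 comp_linear3 alt c)+
  note lint = comp_linear1[where \<omega> = \<omega>, OF alt c q(2)] comp_linear2[where \<omega> = \<omega>, OF alt c q(2)] comp_linear3[where \<omega> = \<omega>, OF alt c q(2)]
  have 1: "((\<lambda>s. comp \<omega> c (q s) (u1 s) v w) has_derivative
      (\<lambda>h. ?P (x' h) (u1 t) v w + comp \<omega> c (q t) (u1' h) v w)) (at t within S)" for v w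
    by (rule has_derivative_apply_linear[where L = "\<lambda>s u. comp \<omega> c (q s) u v w", OF t lin(1) lint(1) 0 u1])
  have 2: "((\<lambda>s. comp \<omega> c (q s) (u1 s) (u2 s) w) has_derivative
      (\<lambda>h. (?P (x' h) (u1 t) (u2 t) w + comp \<omega> c (q t) (u1' h) (u2 t) w) + comp \<omega> c (q t) (u1 t) (u2' h) w)) (at t within S)" for w
    by (rule has_derivative_apply_linear[where L = "\<lambda>s v. comp \<omega> c (q s) (u1 s) v w", OF t lin(2) lint(2) 1 u2])
  have 3: "((\<lambda>s. comp \<omega> c (q s) (u1 s) (u2 s) (u3 s)) has_derivative
      (\<lambda>h. ((?P (x' h) (u1 t) (u2 t) (u3 t) + comp \<omega> c (q t) (u1' h) (u2 t) (u3 t))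
        + comp \<omega> c (q t) (u1 t) (u2' h) (u3 t)) + comp \<omega> c (q t) (u1 t) (u2 t) (u3' h))) (at t within S)"
    by (rule has_derivative_apply_linear[where L = "\<lambda>s w. comp \<omega> c (q s) (u1 s) (u2 s) w", OF t lin(3) lint(3) 2 u3])
  show ?thesis
    by (rule has_derivative_eq_rhs[OF 3])
      (simp add: fun_eq_iff linear_add[OF lint(1)] linear_add[OF lint(2)] linear_add[OF lint(3)])
qed

lemma parallel_form3_imp_components:
  assumes "smooth_form3 \<A> \<omega>" "parallel_form3 \<A> D \<omega>"
  shows "parallel_components \<omega>"
  unfolding parallel_components_def
proof (intro ballI allI)
  fix c q u v w assume c: "c \<in> \<A>" and q: "q \<in> dom_chart c"
  let ?F = "\<lambda>y. comp \<omega> c (chart_inv c y) u v w"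
  have "smooth_on (coord c ` dom_chart c) ?F"
    using assms(1) c unfolding smooth_form3_def Let_def by blast
  from smooth_on_has_derivative[OF this, of "coord c q"]
  have F: "(?F has_derivative frechet_derivative ?F (at (coord c q))) (at (coord c q))"
    using q by blast
  have DE: "D q (E c q x) (\<lambda>r. E c r v) = E c q (\<Gamma> c q x v)" for x v
    using tangent_eq_coord_vec[OF in_tangent_space[OF smooth_vf_coord_vec[OF c] q coord_vec_tangent[OF c q]] c q]
    by (simp add: christoffel_def)
  have "frechet_derivative ?F (at (coord c q)) x =
      comp \<omega> c q (\<Gamma> c q x u) v w + comp \<omega> c q u (\<Gamma> c q x v) w + comp \<omega> c q u v (\<Gamma> c q x w)" for x
  proof -
    have "dir_deriv \<A> q (E c q x) (\<lambda>r. comp \<omega> c r u v w) = frechet_derivative ?F (at (coord c q)) (E c q x c)"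
      by (rule dir_deriv_chart[OF c q coord_vec_tangent[OF c q] F])
    moreover have "dir_deriv \<A> q (E c q x) (\<lambda>r. comp \<omega> c r u v w)
        - \<omega> q (D q (E c q x) (\<lambda>r. E c r u)) (E c q v) (E c q w)
        - \<omega> q (E c q u) (D q (E c q x) (\<lambda>r. E c r v)) (E c q w)
        - \<omega> q (E c q u) (E c q v) (D q (E c q x) (\<lambda>r. E c r w)) = 0"
      using assms(2)[unfolded parallel_form3_def, rule_format, OF q coord_vec_tangent[OF c q]
        smooth_vf_coord_vec[OF c] smooth_vf_coord_vec[OF c] smooth_vf_coord_vec[OF c]] .
    ultimately show ?thesis using c q by (simp add: DE)
  qed
  then show "(?F has_derivative (\<lambda>x. comp \<omega> c q (\<Gamma> c q x u) v w + comp \<omega> c q u (\<Gamma> c q x v) w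
      + comp \<omega> c q u v (\<Gamma> c q x w))) (at (coord c q))"
    by (intro has_derivative_eq_rhs[OF F] ext)
qed

lemma parallel_components_imp_form3:
  assumes alt: "\<And>p. alt3_at \<A> p (\<omega> p)" and par: "parallel_components \<omega>"
  shows "parallel_form3 \<A> D \<omega>"
  unfolding parallel_form3_def
proof (intro allI impI)
  fix W p X Y1 Y2 Y3
  assume p: "p \<in> W" and X: "X \<in> T p" and Y: "smooth_vf \<A> W Y1" "smooth_vf \<A> W Y2" "smooth_vf \<A> W Y3"
  obtain c where c: "c \<in> \<A>" "p \<in> dom_chart c" by (rule chart_cover)
  define S where "S = coord c ` (W \<inter> dom_chart c)"
  have S: "open S" "coord c p \<in> S" using p c smooth_vf_open[OF Y(1)] by (auto simp: S_def intro!: coord_image_open)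
  have inS: "chart_inv c y \<in> W" "chart_inv c y \<in> dom_chart c" "coord c (chart_inv c y) = y" if "y \<in> S" for y
  proof -
    have "chart_inv c y \<in> W \<inter> dom_chart c"
      using that unfolding S_def by (rule chart_inv_in[OF c(1) Int_lower2])
    moreover have "y \<in> coord c ` dom_chart c" using that by (auto simp: S_def)
    ultimately show "chart_inv c y \<in> W" "chart_inv c y \<in> dom_chart c" "coord c (chart_inv c y) = y"
      using coord_chart_inv[OF c(1)] by blast+
  qed
  have ev: "\<forall>\<^sub>F y in at (coord c p). y \<in> S" by (rule eventually_at_in_open'[OF S])
  have x: "((\<lambda>y. coord c (chart_inv c y)) has_derivative (\<lambda>h. h)) (at (coord c p))"
    by (rule has_derivative_transform_within_open[OF has_derivative_ident S]) (use inS in simp)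
  have q0: "chart_inv c (coord c p) \<in> dom_chart c" using c by simp
  let ?d = "\<lambda>Y. frechet_derivative (\<lambda>y. Y (chart_inv c y) c) (at (coord c p))"
  let ?N = "\<lambda>Y. ?d Y (X c) + \<Gamma> c p (X c) (Y p c)"
  have "((\<lambda>y. comp \<omega> c (chart_inv c y) (Y1 (chart_inv c y) c) (Y2 (chart_inv c y) c) (Y3 (chart_inv c y) c)) has_derivative
    (\<lambda>h. comp \<omega> c p (?d Y1 h + \<Gamma> c p h (Y1 p c)) (Y2 p c) (Y3 p c)
       + comp \<omega> c p (Y1 p c) (?d Y2 h + \<Gamma> c p h (Y2 p c)) (Y3 p c)
       + comp \<omega> c p (Y1 p c) (Y2 p c) (?d Y3 h + \<Gamma> c p h (Y3 p c)))) (at (coord c p))"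
    using form_covariant_derivative[where q = "chart_inv c", OF alt par c(1) UNIV_I eventually_mono[OF ev inS(2)] q0 x
      smooth_vf_has_derivative[OF Y(1) p c] smooth_vf_has_derivative[OF Y(2) p c] smooth_vf_has_derivative[OF Y(3) p c]]
    by (simp only: chart_inv_coord[OF c])
  then have "((\<lambda>y. \<omega> (chart_inv c y) (Y1 (chart_inv c y)) (Y2 (chart_inv c y)) (Y3 (chart_inv c y))) has_derivative
    (\<lambda>h. comp \<omega> c p (?d Y1 h + \<Gamma> c p h (Y1 p c)) (Y2 p c) (Y3 p c)
       + comp \<omega> c p (Y1 p c) (?d Y2 h + \<Gamma> c p h (Y2 p c)) (Y3 p c)
       + comp \<omega> c p (Y1 p c) (Y2 p c) (?d Y3 h + \<Gamma> c p h (Y3 p c)))) (at (coord c p))"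
  proof (rule has_derivative_transform_within_open[OF _ S])
    fix y assume "y \<in> S"
    note in' = inS[OF this]
    show "comp \<omega> c (chart_inv c y) (Y1 (chart_inv c y) c) (Y2 (chart_inv c y) c) (Y3 (chart_inv c y) c) =
      \<omega> (chart_inv c y) (Y1 (chart_inv c y)) (Y2 (chart_inv c y)) (Y3 (chart_inv c y))"
      by (simp add: tangent_eq_coord_vec[OF smooth_vf_tangent[OF Y(1) in'(1)] c(1) in'(2)]
        tangent_eq_coord_vec[OF smooth_vf_tangent[OF Y(2) in'(1)] c(1) in'(2)]
        tangent_eq_coord_vec[OF smooth_vf_tangent[OF Y(3) in'(1)] c(1) in'(2)])
  qed
  from dir_deriv_chart[OF c X, of "\<lambda>q. \<omega> q (Y1 q) (Y2 q) (Y3 q)", OF this]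
  have "dir_deriv \<A> p X (\<lambda>q. \<omega> q (Y1 q) (Y2 q) (Y3 q)) =
      comp \<omega> c p (?N Y1) (Y2 p c) (Y3 p c) + comp \<omega> c p (Y1 p c) (?N Y2) (Y3 p c) + comp \<omega> c p (Y1 p c) (Y2 p c) (?N Y3)" .
  moreover have "E c p (?N Z) = D p X Z" if Z: "smooth_vf \<A> W Z" for Z
    using tangent_eq_coord_vec[OF in_tangent_space[OF Z p X] c]
      D_in_chart[OF Z p c X smooth_vf_has_derivative[OF Z p c]] by simp
  moreover have "E c p (Z p c) = Z p" if Z: "smooth_vf \<A> W Z" for Z
    by (rule tangent_eq_coord_vec[OF smooth_vf_tangent[OF Z p] c])
  ultimately show "dir_deriv \<A> p X (\<lambda>q. \<omega> q (Y1 q) (Y2 q) (Y3 q)) - \<omega> p (D p X Y1) (Y2 p) (Y3 p)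
      - \<omega> p (Y1 p) (D p X Y2) (Y3 p) - \<omega> p (Y1 p) (Y2 p) (D p X Y3) = 0"
    using Y by simp
qed

end

section \<open>Parallel fields along curves\<close>

text \<open>
  \<open>chain R a b\<close>: the interval from \<open>a\<close> to \<open>b\<close> has a subdivision whose pieces satisfy \<open>R\<close>. The
  inductive form makes curves easy to join.
\<close>

inductive chain :: "(real \<Rightarrow> real \<Rightarrow> bool) \<Rightarrow> real \<Rightarrow> real \<Rightarrow> bool" for R where
  base: "a < b \<Longrightarrow> R a b \<Longrightarrow> chain R a b"
| step: "chain R a b \<Longrightarrow> b < c \<Longrightarrow> R b c \<Longrightarrow> chain R a c"

lemma chain_less: "chain R a b \<Longrightarrow> a < b"
  by (induction rule: chain.induct) auto

lemma chain_trans: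
  assumes "chain R b c" "chain R a b" shows "chain R a c"
  using assms by (induction rule: chain.induct) (auto intro: chain.step)

lemma chain_mono:
  assumes "chain R a b" "\<And>s t. a \<le> s \<Longrightarrow> s < t \<Longrightarrow> t \<le> b \<Longrightarrow> R s t \<Longrightarrow> R' s t"
  shows "chain R' a b"
  using assms
proof (induction rule: chain.induct)
  case (base a b) then show ?case by (intro chain.base) auto
next
  case (step a b c)
  have "chain R' a b" using step by (intro step.IH) auto
  then show ?case using step chain_less[OF step.hyps(1)] by (intro chain.step[of R' a b c]) auto
qed

lemma chain_image:
  assumes "chain R a b" "\<And>s t. s < t \<Longrightarrow> f s < f t" "\<And>s t. s < t \<Longrightarrow> R s t \<Longrightarrow> R' (f s) (f t)"
  shows "chain R' (f a) (f b)"
  using assms(1) by (induction rule: chain.induct) (auto intro: chain.intros assms)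

lemma chain_image_rev:
  assumes "chain R a b" "\<And>s t. s < t \<Longrightarrow> f t < f s" "\<And>s t. s < t \<Longrightarrow> R s t \<Longrightarrow> R' (f t) (f s)"
  shows "chain R' (f b) (f a)"
  using assms(1) by (induction rule: chain.induct) (auto intro: chain.base chain_trans assms)

lemma chain_right:
  assumes "chain R a b" "a \<le> x" "x < b"
    and her: "\<And>s t s' t'. R s t \<Longrightarrow> s \<le> s' \<Longrightarrow> s' < t' \<Longrightarrow> t' \<le> t \<Longrightarrow> R s' t'"
  shows "\<exists>y>x. R x y"
  using assms(1-3)
proof (induction rule: chain.induct)
  case (base a b) then show ?case using her[of a b x b] by blast
next
  case (step a b c)
  then show ?case using her[of b c x c] by (cases "x < b") auto
qed

lemma chain_left:
  assumes "chain R a b" "a < x" "x \<le> b"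
    and her: "\<And>s t s' t'. R s t \<Longrightarrow> s \<le> s' \<Longrightarrow> s' < t' \<Longrightarrow> t' \<le> t \<Longrightarrow> R s' t'"
  shows "\<exists>y<x. R y x"
  using assms(1-3)
proof (induction rule: chain.induct)
  case (base a b) then show ?case using her[of a b a x] by blast
next
  case (step a b c)
  then show ?case using her[of b c b x] by (cases "x \<le> b") (auto intro: exI[of _ b])
qed

lemma chain_iff_partition:
  "chain R a b \<longleftrightarrow> (\<exists>n t. 0 < n \<and> t 0 = a \<and> t n = b \<and> (\<forall>i<n. t i < t (Suc i)) \<and> (\<forall>i<n. R (t i) (t (Suc i))))"
proof
  assume "chain R a b"
  then show "\<exists>n t. 0 < n \<and> t 0 = a \<and> t n = b \<and> (\<forall>i<n. t i < t (Suc i)) \<and> (\<forall>i<n. R (t i) (t (Suc i)))"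
  proof (induction rule: chain.induct)
    case (base a b)
    then show ?case by (intro exI[of _ 1] exI[of _ "\<lambda>i. if i = 0 then a else b"]) auto
  next
    case (step a b c)
    then obtain n and t :: "nat \<Rightarrow> real" where t: "0 < n" "t 0 = a" "t n = b" "\<forall>i<n. t i < t (Suc i)" "\<forall>i<n. R (t i) (t (Suc i))"
      by blast
    show ?case
      by (rule exI[of _ "Suc n"], rule exI[of _ "t(Suc n := c)"]) (use t step in \<open>auto simp: less_Suc_eq\<close>)
  qed
next
  assume "\<exists>n t. 0 < n \<and> t 0 = a \<and> t n = b \<and> (\<forall>i<n. t i < t (Suc i)) \<and> (\<forall>i<n. R (t i) (t (Suc i)))"
  then obtain n and t :: "nat \<Rightarrow> real" where t: "0 < n" "t 0 = a" "t n = b" "\<forall>i<n. t i < t (Suc i)" "\<forall>i<n. R (t i) (t (Suc i))"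
    by blast
  have "chain R (t 0) (t (Suc k))" if "k < n" for k
    using that
  proof (induction k)
    case 0 then show ?case using t by (intro chain.base) auto
  next
    case (Suc k)
    have "chain R (t 0) (t (Suc k))" using Suc by linarith
    moreover have "t (Suc k) < t (Suc (Suc k))" using t(4) Suc.prems by blast
    moreover have "R (t (Suc k)) (t (Suc (Suc k)))" using t(5) Suc.prems by blast
    ultimately show ?case by (rule chain.step)
  qed
  from this[of "n - 1"] show "chain R a b" using t(1-3) by simp
qed

context smooth_connection
begin

definition smooth_piece :: "(real \<Rightarrow> 'a) \<Rightarrow> real \<Rightarrow> real \<Rightarrow> bool" where
  "smooth_piece \<gamma> a b \<longleftrightarrow> smooth_curve_on \<A> a b \<gamma>"

definition parallel_piece :: "(real \<Rightarrow> 'a) \<Rightarrow> (real \<Rightarrow> 'a tvec) \<Rightarrow> real \<Rightarrow> real \<Rightarrow> bool" where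
  "parallel_piece \<gamma> V a b \<longleftrightarrow> smooth_curve_on \<A> a b \<gamma> \<and> parallel_on \<A> D \<gamma> a b V"

text \<open>
  The velocity \<open>v c\<close> in a chart is that of the smooth extension of the curve, restricted to the
  closed interval; this covers the one-sided derivatives at the end points.
\<close>

lemma smooth_curve_velocity:
  assumes "smooth_curve_on \<A> a b \<gamma>" "a < b"
  obtains v where
    "\<And>c t. c \<in> \<A> \<Longrightarrow> t \<in> {a..b} \<Longrightarrow> \<gamma> t \<in> dom_chart c \<Longrightarrow>
      ((\<lambda>s. coord c (\<gamma> s)) has_vector_derivative v c t) (at t within {a..b})"
    "\<And>c s t. c \<in> \<A> \<Longrightarrow> {s..t} \<subseteq> {a..b} \<Longrightarrow> \<gamma> ` {s..t} \<subseteq> dom_chart c \<Longrightarrow> continuous_on {s..t} (v c)"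
    "continuous_on {a..b} \<gamma>"
proof -
  obtain e \<sigma> where e: "e > 0" and \<sigma>: "continuous_on {a - e<..<b + e} \<sigma>" "\<And>t. t \<in> {a..b} \<Longrightarrow> \<sigma> t = \<gamma> t"
    and sm: "\<And>c. c \<in> \<A> \<Longrightarrow> smooth_on {t \<in> {a - e<..<b + e}. \<sigma> t \<in> dom_chart c} (coord c \<circ> \<sigma>)"
    using assms unfolding smooth_curve_on_def by blast
  define v where "v c t = frechet_derivative (coord c \<circ> \<sigma>) (at t) 1" for c t
  have sub: "{a..b} \<subseteq> {a - e<..<b + e}" using e by auto
  show ?thesis
  proof
    fix c t assume c: "c \<in> \<A>" and t: "t \<in> {a..b}" and d: "\<gamma> t \<in> dom_chart c"
    have tS: "t \<in> {t \<in> {a - e<..<b + e}. \<sigma> t \<in> dom_chart c}"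
      using t d \<sigma>(2)[OF t] sub by auto
    have h: "((coord c \<circ> \<sigma>) has_derivative frechet_derivative (coord c \<circ> \<sigma>) (at t)) (at t)"
      by (rule smooth_on_has_derivative[OF sm[OF c] tS])
    have "frechet_derivative (coord c \<circ> \<sigma>) (at t) x = x *\<^sub>R v c t" for x
      using linear_scale[OF has_derivative_linear[OF h], of x 1] by (simp add: v_def)
    then have "((coord c \<circ> \<sigma>) has_vector_derivative v c t) (at t)"
      unfolding has_vector_derivative_def by (intro has_derivative_eq_rhs[OF h] ext)
    then have "((coord c \<circ> \<sigma>) has_vector_derivative v c t) (at t within {a..b})"
      by (rule has_vector_derivative_at_within)
    then show "((\<lambda>s. coord c (\<gamma> s)) has_vector_derivative v c t) (at t within {a..b})"
      by (rule has_vector_derivative_transform[OF t, rotated]) (simp add: \<sigma>(2))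
  next
    fix c s t assume c: "c \<in> \<A>" and st: "{s..t} \<subseteq> {a..b}" and d: "\<gamma> ` {s..t} \<subseteq> dom_chart c"
    have "smooth_on {t \<in> {a - e<..<b + e}. \<sigma> t \<in> dom_chart c} (v c)"
      unfolding v_def by (rule smooth_on_frechet_derivative[OF sm[OF c]])
    from smooth_on_imp_continuous_on[OF this] show "continuous_on {s..t} (v c)"
    proof (rule continuous_on_subset)
      show "{s..t} \<subseteq> {t \<in> {a - e<..<b + e}. \<sigma> t \<in> dom_chart c}"
      proof
        fix r assume "r \<in> {s..t}"
        then have "r \<in> {a..b}" "\<gamma> r \<in> dom_chart c" using st d by auto
        then show "r \<in> {t \<in> {a - e<..<b + e}. \<sigma> t \<in> dom_chart c}" using sub \<sigma>(2) by auto
      qed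
    qed
  next
    show "continuous_on {a..b} \<gamma>"
      using continuous_on_subset[OF \<sigma>(1) sub] by (rule continuous_on_eq) (rule \<sigma>(2))
  qed
qed

lemma curve_has_velocity:
  assumes "smooth_curve_on \<A> a b \<gamma>" "a < b" "t \<in> {a..b}" "c \<in> \<A>" "\<gamma> t \<in> dom_chart c"
  shows "\<exists>x. ((\<lambda>s. coord c (\<gamma> s)) has_vector_derivative x) (at t within {a..b})"
  by (rule smooth_curve_velocity[OF assms(1,2)]) (use assms(3-5) in blast)

lemma smooth_curve_subset:
  assumes "smooth_curve_on \<A> a b \<gamma>" "a \<le> a'" "b' \<le> b"
  shows "smooth_curve_on \<A> a' b' \<gamma>"
proof -
  obtain e \<sigma> where e: "e > 0" and \<sigma>: "continuous_on {a - e<..<b + e} \<sigma>" "\<And>t. t \<in> {a..b} \<Longrightarrow> \<sigma> t = \<gamma> t"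
    and sm: "\<And>c. c \<in> \<A> \<Longrightarrow> smooth_on {t \<in> {a - e<..<b + e}. \<sigma> t \<in> dom_chart c} (coord c \<circ> \<sigma>)"
    using assms unfolding smooth_curve_on_def by blast
  show ?thesis unfolding smooth_curve_on_def
  proof (intro exI[of _ e] conjI exI[of _ \<sigma>] e ballI)
    show "continuous_on {a' - e<..<b' + e} \<sigma>"
      by (rule continuous_on_subset[OF \<sigma>(1)]) (use assms in auto)
    show "\<sigma> t = \<gamma> t" if "t \<in> {a'..b'}" for t using that assms \<sigma>(2) by auto
    show "smooth_on {t \<in> {a' - e<..<b' + e}. \<sigma> t \<in> dom_chart c} (coord c \<circ> \<sigma>)" if "c \<in> \<A>" for c
      by (rule smooth_on_subset[OF sm[OF that]]) (use assms in auto)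
  qed
qed

lemma smooth_curve_affine:
  assumes "smooth_curve_on \<A> a b \<gamma>" "m \<noteq> 0" "a' \<le> b'" "\<And>t. t \<in> {a'..b'} \<Longrightarrow> m * t + k \<in> {a..b}"
  shows "smooth_curve_on \<A> a' b' (\<lambda>t. \<gamma> (m * t + k))"
proof -
  obtain e \<sigma> where e: "e > 0" and \<sigma>: "continuous_on {a - e<..<b + e} \<sigma>" "\<And>t. t \<in> {a..b} \<Longrightarrow> \<sigma> t = \<gamma> t"
    and sm: "\<And>c. c \<in> \<A> \<Longrightarrow> smooth_on {t \<in> {a - e<..<b + e}. \<sigma> t \<in> dom_chart c} (coord c \<circ> \<sigma>)"
    using assms unfolding smooth_curve_on_def by blast
  define e' where "e' = e / \<bar>m\<bar>"
  have e': "e' > 0" using e assms by (simp add: e'_def)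
  have in': "m * t + k \<in> {a - e<..<b + e}" if t: "t \<in> {a' - e'<..<b' + e'}" for t
  proof -
    define t0 where "t0 = max a' (min b' t)"
    have t0: "t0 \<in> {a'..b'}" "\<bar>t - t0\<bar> < e'" using t assms(3) e' by (auto simp: t0_def)
    have "\<bar>t - t0\<bar> * \<bar>m\<bar> < e" using t0(2) assms(2) by (simp add: e'_def pos_less_divide_eq)
    then have "\<bar>m * (t - t0)\<bar> < e" by (simp only: abs_mult mult.commute)
    moreover have "m * t + k = m * (t - t0) + (m * t0 + k)" by (simp add: algebra_simps)
    ultimately show ?thesis using assms(4)[OF t0(1)] by auto
  qed
  have sm0: "smooth_on UNIV (\<lambda>t::real. m * t + k)"
    by (intro smooth_on_add smooth_on_bounded_linear smooth_on_const open_UNIV bounded_linear_mult_right)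
  have cont: "continuous_on {a' - e'<..<b' + e'} (\<lambda>t. \<sigma> (m * t + k))"
    by (rule continuous_on_compose2[OF \<sigma>(1)]) (use in' in \<open>auto intro!: continuous_intros\<close>)
  show ?thesis unfolding smooth_curve_on_def
  proof (intro exI[of _ e'] conjI exI[of _ "\<lambda>t. \<sigma> (m * t + k)"] e' cont ballI)
    show "\<sigma> (m * t + k) = \<gamma> (m * t + k)" if "t \<in> {a'..b'}" for t using that assms(4) \<sigma>(2) by auto
    fix c assume c: "c \<in> \<A>"
    have o: "open {t \<in> {a - e<..<b + e}. \<sigma> t \<in> dom_chart c}"
      using continuous_open_preimage[OF \<sigma>(1) _ chart_open[OF c]] by (simp add: vimage_def Int_def)
    have o': "open {t \<in> {a' - e'<..<b' + e'}. \<sigma> (m * t + k) \<in> dom_chart c}"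
      using continuous_open_preimage[OF cont _ chart_open[OF c]] by (simp add: vimage_def Int_def)
    have "smooth_on {t \<in> {a' - e'<..<b' + e'}. \<sigma> (m * t + k) \<in> dom_chart c} (\<lambda>t. (coord c \<circ> \<sigma>) (m * t + k))"
      by (rule smooth_on_compose[OF o' o smooth_on_subset[OF sm0] sm[OF c]]) (use in' in auto)
    then show "smooth_on {t \<in> {a' - e'<..<b' + e'}. \<sigma> (m * t + k) \<in> dom_chart c} (coord c \<circ> (\<lambda>t. \<sigma> (m * t + k)))"
      by (simp add: o_def)
  qed
qed

lemma smooth_curve_cong:
  "smooth_curve_on \<A> a b \<gamma> \<Longrightarrow> (\<And>t. t \<in> {a..b} \<Longrightarrow> \<gamma> t = \<gamma>' t) \<Longrightarrow> smooth_curve_on \<A> a b \<gamma>'"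
  unfolding smooth_curve_on_def by fastforce

lemma smooth_segment:
  assumes c: "c \<in> \<A>" and B: "ball y0 R \<subseteq> coord c ` dom_chart c" and y: "y1 \<in> ball y0 R" "y2 \<in> ball y0 R"
  shows "smooth_curve_on \<A> 0 1 (\<lambda>s. chart_inv c (y1 + s *\<^sub>R (y2 - y1)))"
proof -
  let ?l = "\<lambda>s. y1 + s *\<^sub>R (y2 - y1)"
  have lc: "continuous_on UNIV ?l" by (intro continuous_intros)
  have oB: "open (?l -` ball y0 R)"
    using continuous_open_preimage[OF lc open_UNIV open_ball[of y0 R]] by simp
  have "{0..1} \<subseteq> ?l -` ball y0 R"
  proof
    fix s :: real assume "s \<in> {0..1}"
    then have "(1 - s) *\<^sub>R y1 + s *\<^sub>R y2 \<in> ball y0 R"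
      using convexD[OF convex_ball y, of "1 - s" s] by auto
    then show "s \<in> ?l -` ball y0 R" by (simp add: algebra_simps)
  qed
  then obtain e where e: "e > 0" "(\<Union>x\<in>{0..1}. ball x e) \<subseteq> ?l -` ball y0 R"
    using compact_subset_open_imp_ball_epsilon_subset[OF compact_Icc oB] by metis
  have in': "?l s \<in> ball y0 R" if "s \<in> {0 - e<..<1 + e}" for s
  proof -
    have "s \<in> ball (max 0 (min 1 s)) e" using that e by (auto simp: dist_real_def)
    moreover have "max 0 (min 1 s) \<in> {0..1}" by auto
    ultimately show ?thesis using e(2) by blast
  qed
  have cont: "continuous_on {0 - e<..<1 + e} (\<lambda>s. chart_inv c (?l s))"
    by (rule continuous_on_compose2[OF chart_inv_continuous[OF c] continuous_on_subset[OF lc]]) (use in' B in auto)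
  have sml: "smooth_on UNIV ?l"
    by (intro smooth_on_add smooth_on_const smooth_on_bounded_linear open_UNIV bounded_linear_scaleR_left)
  show ?thesis unfolding smooth_curve_on_def
  proof (intro exI[of _ e] conjI exI[of _ "\<lambda>s. chart_inv c (?l s)"] e cont ballI refl)
    fix c' assume c': "c' \<in> \<A>"
    have o: "open {s \<in> {0 - e<..<1 + e}. chart_inv c (?l s) \<in> dom_chart c'}"
      using continuous_open_preimage[OF cont _ chart_open[OF c']] by (simp add: vimage_def Int_def)
    have o': "open (coord c ` (dom_chart c \<inter> dom_chart c'))"
      by (rule coord_image_open[OF c]) (use c c' in auto)
    have "smooth_on {s \<in> {0 - e<..<1 + e}. chart_inv c (?l s) \<in> dom_chart c'} (\<lambda>s. (coord c' \<circ> chart_inv c) (?l s))"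
    proof (rule smooth_on_compose[OF o o' smooth_on_subset[OF sml] transition_smooth[OF c c']])
      show "?l ` {s \<in> {0 - e<..<1 + e}. chart_inv c (?l s) \<in> dom_chart c'} \<subseteq> coord c ` (dom_chart c \<inter> dom_chart c')"
      proof
        fix y assume "y \<in> ?l ` {s \<in> {0 - e<..<1 + e}. chart_inv c (?l s) \<in> dom_chart c'}"
        then obtain s where s: "s \<in> {0 - e<..<1 + e}" "chart_inv c (?l s) \<in> dom_chart c'" "y = ?l s" by blast
        have yi: "y \<in> coord c ` dom_chart c" using in'[OF s(1)] s(3) B by blast
        have "chart_inv c y \<in> dom_chart c \<inter> dom_chart c'"
          using chart_inv_in[OF c order_refl yi] s(2,3) by blast
        moreover have "y = coord c (chart_inv c y)" using coord_chart_inv[OF c yi] by simp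
        ultimately show "y \<in> coord c ` (dom_chart c \<inter> dom_chart c')" by blast
      qed
    qed simp
    then show "smooth_on {s \<in> {0 - e<..<1 + e}. chart_inv c (?l s) \<in> dom_chart c'} (coord c' \<circ> (\<lambda>s. chart_inv c (?l s)))"
      by (simp add: o_def)
  qed
qed

text \<open>
  On a nondegenerate interval derivatives are unique, so any derivative of the curve may take the
  place of the velocity in the parallel transport equation, here and in \<open>parallel_onI\<close>.
\<close>

lemma parallel_onD:
  assumes "smooth_curve_on \<A> a b \<gamma>" "a < b" "parallel_on \<A> D \<gamma> a b V" "t \<in> {a..b}"
  shows "V t \<in> T (\<gamma> t)"
    and "c \<in> \<A> \<Longrightarrow> \<gamma> t \<in> dom_chart c \<Longrightarrow> ((\<lambda>s. coord c (\<gamma> s)) has_vector_derivative x) (at t within {a..b}) \<Longrightarrow>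
      ((\<lambda>s. V s c) has_vector_derivative - \<Gamma> c (\<gamma> t) x (V t c)) (at t within {a..b})"
proof -
  show "V t \<in> T (\<gamma> t)" using assms(3,4) unfolding parallel_on_def by blast
  assume c: "c \<in> \<A>" "\<gamma> t \<in> dom_chart c" and x: "((\<lambda>s. coord c (\<gamma> s)) has_vector_derivative x) (at t within {a..b})"
  have "vector_derivative (\<lambda>s. coord c (\<gamma> s)) (at t within {a..b}) = x"
    by (rule vector_derivative_within_closed_interval[OF assms(2,4) x])
  then show "((\<lambda>s. V s c) has_vector_derivative - \<Gamma> c (\<gamma> t) x (V t c)) (at t within {a..b})"
    using assms(3,4) c unfolding parallel_on_def by blast
qed

lemma parallel_onI:
  assumes "a < b" "\<And>t. t \<in> {a..b} \<Longrightarrow> V t \<in> T (\<gamma> t)"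
    and "\<And>t c. t \<in> {a..b} \<Longrightarrow> c \<in> \<A> \<Longrightarrow> \<gamma> t \<in> dom_chart c \<Longrightarrow>
      \<exists>x. ((\<lambda>s. coord c (\<gamma> s)) has_vector_derivative x) (at t within {a..b}) \<and>
        ((\<lambda>s. V s c) has_vector_derivative - \<Gamma> c (\<gamma> t) x (V t c)) (at t within {a..b})"
  shows "parallel_on \<A> D \<gamma> a b V"
  unfolding parallel_on_def
proof (intro ballI conjI impI assms(2))
  fix t c assume t: "t \<in> {a..b}" and c: "c \<in> \<A>" "\<gamma> t \<in> dom_chart c"
  obtain x where x: "((\<lambda>s. coord c (\<gamma> s)) has_vector_derivative x) (at t within {a..b})"
    "((\<lambda>s. V s c) has_vector_derivative - \<Gamma> c (\<gamma> t) x (V t c)) (at t within {a..b})"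
    using assms(3)[OF t c] by blast
  show "((\<lambda>s. V s c) has_vector_derivative - \<Gamma> c (\<gamma> t) (vector_derivative (\<lambda>s. coord c (\<gamma> s)) (at t within {a..b})) (V t c))
        (at t within {a..b})"
    using x(2) vector_derivative_within_closed_interval[OF assms(1) t x(1)] by simp
qed

lemma parallel_piece_subset:
  assumes "parallel_piece \<gamma> V a b" "a \<le> a'" "a' < b'" "b' \<le> b"
  shows "parallel_piece \<gamma> V a' b'"
proof -
  have ab: "a < b" and sm: "smooth_curve_on \<A> a b \<gamma>" and par: "parallel_on \<A> D \<gamma> a b V"
    using assms unfolding parallel_piece_def by auto
  have sub: "{a'..b'} \<subseteq> {a..b}" using assms by auto
  have "parallel_on \<A> D \<gamma> a' b' V"
  proof (rule parallel_onI[OF assms(3)])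
    fix t assume "t \<in> {a'..b'}"
    then have t: "t \<in> {a..b}" using sub by blast
    show "V t \<in> T (\<gamma> t)" by (rule parallel_onD(1)[OF sm ab par t])
    fix c assume c: "c \<in> \<A>" "\<gamma> t \<in> dom_chart c"
    obtain x where vt: "((\<lambda>s. coord c (\<gamma> s)) has_vector_derivative x) (at t within {a..b})"
      using curve_has_velocity[OF sm ab t c] ..
    show "\<exists>x. ((\<lambda>s. coord c (\<gamma> s)) has_vector_derivative x) (at t within {a'..b'}) \<and>
        ((\<lambda>s. V s c) has_vector_derivative - \<Gamma> c (\<gamma> t) x (V t c)) (at t within {a'..b'})"
      using has_vector_derivative_within_subset[OF vt sub]
        has_vector_derivative_within_subset[OF parallel_onD(2)[OF sm ab par t c vt] sub] by blast
  qed
  then show ?thesis using smooth_curve_subset[OF sm assms(2,4)] by (simp add: parallel_piece_def)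
qed

lemma parallel_piece_cong:
  assumes "parallel_piece \<gamma> V a b" "a < b" "\<And>t. t \<in> {a..b} \<Longrightarrow> \<gamma> t = \<gamma>' t" "\<And>t. t \<in> {a..b} \<Longrightarrow> V t = V' t"
  shows "parallel_piece \<gamma>' V' a b"
proof -
  have sm: "smooth_curve_on \<A> a b \<gamma>" and par: "parallel_on \<A> D \<gamma> a b V"
    using assms unfolding parallel_piece_def by auto
  have "parallel_on \<A> D \<gamma>' a b V'"
  proof (rule parallel_onI[OF assms(2)])
    fix t assume t: "t \<in> {a..b}"
    note eq = assms(3)[OF t, symmetric] assms(4)[OF t, symmetric]
    show "V' t \<in> T (\<gamma>' t)" unfolding eq by (rule parallel_onD(1)[OF sm assms(2) par t])
    fix c assume c: "c \<in> \<A>" "\<gamma>' t \<in> dom_chart c"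
    obtain x where vt: "((\<lambda>s. coord c (\<gamma> s)) has_vector_derivative x) (at t within {a..b})"
      using curve_has_velocity[OF sm assms(2) t c(1) c(2)[unfolded eq]] ..
    have "((\<lambda>s. coord c (\<gamma>' s)) has_vector_derivative x) (at t within {a..b})"
      by (rule has_vector_derivative_transform[OF t _ vt]) (simp add: assms(3))
    moreover have "((\<lambda>s. V' s c) has_vector_derivative - \<Gamma> c (\<gamma> t) x (V t c)) (at t within {a..b})"
      by (rule has_vector_derivative_transform[OF t _ parallel_onD(2)[OF sm assms(2) par t c(1) c(2)[unfolded eq] vt]])
        (simp add: assms(4))
    ultimately show "\<exists>x. ((\<lambda>s. coord c (\<gamma>' s)) has_vector_derivative x) (at t within {a..b}) \<and>
        ((\<lambda>s. V' s c) has_vector_derivative - \<Gamma> c (\<gamma>' t) x (V' t c)) (at t within {a..b})"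
      unfolding eq by blast
  qed
  then show ?thesis using smooth_curve_cong[OF sm assms(3)] by (simp add: parallel_piece_def)
qed

lemma parallel_piece_affine:
  assumes "parallel_piece \<gamma> V a b" "a < b" "m \<noteq> 0" "a' < b'" "\<And>t. t \<in> {a'..b'} \<Longrightarrow> m * t + k \<in> {a..b}"
  shows "parallel_piece (\<lambda>t. \<gamma> (m * t + k)) (\<lambda>t. V (m * t + k)) a' b'"
proof -
  have sm: "smooth_curve_on \<A> a b \<gamma>" and par: "parallel_on \<A> D \<gamma> a b V"
    using assms unfolding parallel_piece_def by auto
  let ?f = "\<lambda>t. m * t + k"
  have f: "(?f has_vector_derivative m) (at t within {a'..b'})" for t
    by (auto intro!: derivative_eq_intros)
  have sub: "?f ` {a'..b'} \<subseteq> {a..b}" using assms(5) by blast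
  have "parallel_on \<A> D (\<lambda>t. \<gamma> (m * t + k)) a' b' (\<lambda>t. V (m * t + k))"
  proof (rule parallel_onI[OF assms(4)])
    fix t assume "t \<in> {a'..b'}"
    then have t: "?f t \<in> {a..b}" by (rule assms(5))
    show "V (?f t) \<in> T (\<gamma> (?f t))" by (rule parallel_onD(1)[OF sm assms(2) par t])
    fix c assume c: "c \<in> \<A>" "\<gamma> (?f t) \<in> dom_chart c"
    obtain x where vt: "((\<lambda>s. coord c (\<gamma> s)) has_vector_derivative x) (at (?f t) within {a..b})"
      using curve_has_velocity[OF sm assms(2) t c] ..
    have 1: "((\<lambda>s. coord c (\<gamma> (?f s))) has_vector_derivative (m *\<^sub>R x)) (at t within {a'..b'})"
      using vector_diff_chain_within[OF f has_vector_derivative_within_subset[OF vt sub]] by (simp add: o_def)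
    have 2: "((\<lambda>s. V (?f s) c) has_vector_derivative (m *\<^sub>R (- \<Gamma> c (\<gamma> (?f t)) x (V (?f t) c)))) (at t within {a'..b'})"
      using vector_diff_chain_within[OF f has_vector_derivative_within_subset[OF parallel_onD(2)[OF sm assms(2) par t c vt] sub]]
      by (simp add: o_def)
    have 3: "m *\<^sub>R (- \<Gamma> c (\<gamma> (?f t)) x (V (?f t) c)) = - \<Gamma> c (\<gamma> (?f t)) (m *\<^sub>R x) (V (?f t) c)"
      by (simp add: linear_scale[OF christoffel_linear1[OF c]])
    show "\<exists>x. ((\<lambda>s. coord c (\<gamma> (?f s))) has_vector_derivative x) (at t within {a'..b'}) \<and>
        ((\<lambda>s. V (?f s) c) has_vector_derivative - \<Gamma> c (\<gamma> (?f t)) x (V (?f t) c)) (at t within {a'..b'})"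
      using 1 2[unfolded 3] by blast
  qed
  then show ?thesis
    using smooth_curve_affine[OF sm assms(3) _ assms(5)] assms(4) by (simp add: parallel_piece_def)
qed

end

lemma has_derivative_imp_has_vector_derivative:
  "(f has_derivative F) net \<Longrightarrow> (f has_vector_derivative F 1) net" for F :: "real \<Rightarrow> _"
  unfolding has_vector_derivative_def
  by (rule has_derivative_eq_rhs, assumption, rule ext)
    (metis has_derivative_linear linear_scale mult.right_neutral real_scaleR_def)

context smooth_connection
begin

text \<open>
  Let \<open>Y\<close> be the field with constant components in \<open>c'\<close> that agrees with \<open>V t\<close> at \<open>\<gamma> t\<close>. The
  components of \<open>V\<close> in \<open>c\<close> are those in \<open>c'\<close>, inserted into coordinate fields of \<open>c'\<close>; so the
  derivative of \<open>V\<close> in \<open>c\<close> is that of \<open>Y\<close> plus the image of the derivative of \<open>V\<close> in \<open>c'\<close>. By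
  \<open>D_in_chart\<close> the parallel transport equation in \<open>c\<close> then says that the derivative in \<open>c'\<close> is
  the vector \<open>- D\<^sub>x Y\<close>, whose components in \<open>c'\<close> are Christoffel symbols. The second
  derivative of the change of coordinates enters through its existence only.
\<close>

lemma parallel_change_chart:
  assumes ab: "a < b" and t: "t \<in> {a..b}" and c: "c \<in> \<A>" "\<gamma> t \<in> dom_chart c" and c': "c' \<in> \<A>" "\<gamma> t \<in> dom_chart c'"
    and cont: "continuous_on {a..b} \<gamma>" and V: "\<And>s. s \<in> {a..b} \<Longrightarrow> V s \<in> T (\<gamma> s)"
    and x: "((\<lambda>s. coord c (\<gamma> s)) has_vector_derivative x) (at t within {a..b})"
    and x': "((\<lambda>s. coord c' (\<gamma> s)) has_vector_derivative x') (at t within {a..b})"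
    and Vc: "((\<lambda>s. V s c) has_vector_derivative - \<Gamma> c (\<gamma> t) x (V t c)) (at t within {a..b})"
  shows "((\<lambda>s. V s c') has_vector_derivative - \<Gamma> c' (\<gamma> t) x' (V t c')) (at t within {a..b})"
proof -
  let ?S = "{a..b}" and ?q = "\<gamma> t" and ?U = "dom_chart c \<inter> dom_chart c'"
  have oU: "open ?U" using c c' by auto
  have "(\<gamma> \<longlongrightarrow> \<gamma> t) (at t within ?S)" using cont t by (simp add: continuous_on_def)
  from topological_tendstoD[OF this oU] have ev1: "\<forall>\<^sub>F s in at t within ?S. \<gamma> s \<in> ?U" using c c' by blast
  have ev2: "\<forall>\<^sub>F s in at t within ?S. s \<in> ?S" by (simp add: eventually_at_filter)
  have ev: "\<forall>\<^sub>F s in at t within ?S. V s \<in> T (\<gamma> s) \<and> \<gamma> s \<in> dom_chart c \<and> \<gamma> s \<in> dom_chart c'"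
    using ev1 ev2 by eventually_elim (use V in blast)
  have xd: "((\<lambda>s. coord c (\<gamma> s)) has_derivative (\<lambda>h. h *\<^sub>R x)) (at t within ?S)"
    using x by (simp add: has_vector_derivative_def)
  have Vd: "((\<lambda>s. V s c) has_derivative (\<lambda>h. h *\<^sub>R (- \<Gamma> c ?q x (V t c)))) (at t within ?S)"
    using Vc unfolding has_vector_derivative_def .
  \<comment> \<open>some derivative \<open>A'\<close> of the components in \<open>c'\<close>, to be identified below\<close>
  define M where "M w = frechet_derivative (\<lambda>y. frechet_derivative (coord c' \<circ> chart_inv c) (at y) w) (at (coord c ?q))" for w
  have "((\<lambda>y. frechet_derivative (coord c' \<circ> chart_inv c) (at y) w) has_derivative M w) (at (coord c ?q))" for w
    unfolding M_def
    by (rule smooth_on_has_derivative[OF smooth_on_frechet_derivative[OF transition_smooth[OF c(1) c'(1)]]]) (use c c' in blast)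
  from has_derivative_compose[OF xd this]
  have TDd: "((\<lambda>s. TD c c' (\<gamma> s) w) has_derivative (\<lambda>h. M w (h *\<^sub>R x))) (at t within ?S)" for w .
  have linTD: "\<forall>\<^sub>F s in at t within ?S. linear (TD c c' (\<gamma> s))"
    using ev by eventually_elim (use TD_linear[OF c(1) c'(1)] in blast)
  define A' where "A' h = M (V t c) (h *\<^sub>R x) + TD c c' ?q (h *\<^sub>R (- \<Gamma> c ?q x (V t c)))" for h
  have "((\<lambda>s. TD c c' (\<gamma> s) (V s c)) has_derivative A') (at t within ?S)"
    unfolding A'_def
    by (rule has_derivative_apply_linear[where L = "\<lambda>s. TD c c' (\<gamma> s)", OF t linTD TD_linear[OF c(1) c'(1) c(2) c'(2)] TDd Vd])
  then have A': "((\<lambda>s. V s c') has_derivative A') (at t within ?S)"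
  proof (rule has_derivative_transform_eventually[OF _ _ _ t])
    show "\<forall>\<^sub>F s in at t within ?S. TD c c' (\<gamma> s) (V s c) = V s c'"
      using ev by eventually_elim (metis tangent_change c(1) c'(1))
    show "TD c c' ?q (V t c) = V t c'" by (rule tangent_change[symmetric, OF V[OF t] c(1) c'(1) c(2) c'(2)])
  qed
  \<comment> \<open>\<open>V\<close> in the chart \<open>c\<close>, through coordinate fields of \<open>c'\<close>\<close>
  define Y' where "Y' w = frechet_derivative (\<lambda>y. E c' (chart_inv c y) w c) (at (coord c ?q))" for w
  have Y': "((\<lambda>y. E c' (chart_inv c y) w c) has_derivative Y' w) (at (coord c ?q))" for w
    unfolding Y'_def by (rule smooth_vf_has_derivative[OF smooth_vf_coord_vec[OF c'(1)] c'(2) c])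
  have Ld: "((\<lambda>s. E c' (\<gamma> s) w c) has_derivative (\<lambda>h. Y' w (h *\<^sub>R x))) (at t within ?S)" for w
  proof (rule has_derivative_transform_eventually[OF has_derivative_compose[OF xd Y'] _ _ t])
    show "\<forall>\<^sub>F s in at t within ?S. E c' (chart_inv c (coord c (\<gamma> s))) w c = E c' (\<gamma> s) w c"
      using ev by eventually_elim (simp add: c(1))
    show "E c' (chart_inv c (coord c ?q)) w c = E c' ?q w c" by (simp add: c)
  qed
  have linE: "\<forall>\<^sub>F s in at t within ?S. linear (\<lambda>w. E c' (\<gamma> s) w c)"
    using ev by eventually_elim (simp add: coord_vec_apply[OF c(1)] TD_linear[OF c'(1) c(1)])
  have linEt: "linear (\<lambda>w. E c' ?q w c)"
    by (simp add: coord_vec_apply[OF c] TD_linear[OF c'(1) c(1) c'(2) c(2)])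
  have "((\<lambda>s. E c' (\<gamma> s) (V s c') c) has_derivative (\<lambda>h. Y' (V t c') (h *\<^sub>R x) + E c' ?q (A' h) c)) (at t within ?S)"
    by (rule has_derivative_apply_linear[where L = "\<lambda>s w. E c' (\<gamma> s) w c", OF t linE linEt Ld A'])
  then have "((\<lambda>s. V s c) has_derivative (\<lambda>h. Y' (V t c') (h *\<^sub>R x) + E c' ?q (A' h) c)) (at t within ?S)"
  proof (rule has_derivative_transform_eventually[OF _ _ _ t])
    show "\<forall>\<^sub>F s in at t within ?S. E c' (\<gamma> s) (V s c') c = V s c"
      using ev by eventually_elim (metis tangent_eq_coord_vec c'(1))
    show "E c' ?q (V t c') c = V t c" using tangent_eq_coord_vec[OF V[OF t] c'] by simp
  qed
  from has_derivative_imp_has_vector_derivative[OF this]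
  have "((\<lambda>s. V s c) has_vector_derivative Y' (V t c') x + E c' ?q (A' 1) c) (at t within ?S)" by simp
  from vector_derivative_within_closed_interval[OF ab t this] vector_derivative_within_closed_interval[OF ab t Vc]
  have 1: "Y' (V t c') x + E c' ?q (A' 1) c = - \<Gamma> c ?q x (V t c)" by simp
  let ?X = "E c ?q x" and ?Y = "\<lambda>r. E c' r (V t c')"
  note Y = smooth_vf_coord_vec[OF c'(1)] and X = coord_vec_tangent[OF c, of x]
  have "D ?q ?X ?Y c = Y' (V t c') (?X c) + \<Gamma> c ?q (?X c) (?Y ?q c)"
    by (rule D_in_chart[OF Y c'(2) c X Y'])
  moreover have "?Y ?q c = V t c" using tangent_eq_coord_vec[OF V[OF t] c'] by simp
  ultimately have 2: "E c' ?q (A' 1) c = (- D ?q ?X ?Y) c"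
    using 1 by (simp add: c algebra_simps eq_neg_iff_add_eq_0)
  have 3: "E c' ?q (A' 1) = - D ?q ?X ?Y"
    by (rule tangent_eqI[OF coord_vec_tangent[OF c'] subspace_neg[OF subspace_T in_tangent_space[OF Y c'(2) X]] c 2])
  have 4: "D ?q ?X ?Y c' = \<Gamma> c' ?q (?X c') (V t c')"
    unfolding christoffel_def using tangent_eq_coord_vec[OF X c'] by simp
  have 5: "?X c' = x'"
  proof -
    have "(((\<lambda>s. (coord c' \<circ> chart_inv c) (coord c (\<gamma> s)))) has_derivative (\<lambda>h. TD c c' ?q (h *\<^sub>R x))) (at t within ?S)"
      by (rule has_derivative_compose[OF xd TD_has_derivative[OF c(1) c'(1) c(2) c'(2)]])
    then have "((\<lambda>s. coord c' (\<gamma> s)) has_derivative (\<lambda>h. TD c c' ?q (h *\<^sub>R x))) (at t within ?S)"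
    proof (rule has_derivative_transform_eventually[OF _ _ _ t])
      show "\<forall>\<^sub>F s in at t within ?S. (coord c' \<circ> chart_inv c) (coord c (\<gamma> s)) = coord c' (\<gamma> s)"
        using ev by eventually_elim (simp add: c(1))
    qed (simp add: c)
    from has_derivative_imp_has_vector_derivative[OF this]
    have "((\<lambda>s. coord c' (\<gamma> s)) has_vector_derivative TD c c' ?q x) (at t within ?S)" by simp
    from vector_derivative_within_closed_interval[OF ab t this] vector_derivative_within_closed_interval[OF ab t x']
    show ?thesis by (simp add: coord_vec_apply[OF c'])
  qed
  have "A' 1 = E c' ?q (A' 1) c'" by (simp add: c')
  also have "\<dots> = - \<Gamma> c' ?q x' (V t c')" using 3 4 5 by simp
  finally show ?thesis using has_derivative_imp_has_vector_derivative[OF A'] by simp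
qed

lemma parallel_exists_in_chart:
  assumes sm: "smooth_curve_on \<A> a b \<gamma>" and ab: "a < b" and c: "c \<in> \<A>" "\<gamma> ` {a..b} \<subseteq> dom_chart c" and v0: "v0 \<in> T (\<gamma> a)"
  shows "\<exists>V. parallel_piece \<gamma> V a b \<and> V a = v0"
proof (rule smooth_curve_velocity[OF sm ab])
  fix v
  assume
    v1: "\<And>c t. c \<in> \<A> \<Longrightarrow> t \<in> {a..b} \<Longrightarrow> \<gamma> t \<in> dom_chart c \<Longrightarrow>
      ((\<lambda>s. coord c (\<gamma> s)) has_vector_derivative v c t) (at t within {a..b})" and
    v2: "\<And>c s t. c \<in> \<A> \<Longrightarrow> {s..t} \<subseteq> {a..b} \<Longrightarrow> \<gamma> ` {s..t} \<subseteq> dom_chart c \<Longrightarrow> continuous_on {s..t} (v c)" and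
    v3: "continuous_on {a..b} \<gamma>"
  have dom: "\<gamma> t \<in> dom_chart c" if "t \<in> {a..b}" for t using c(2) that by blast
  have cc: "continuous_on {a..b} (\<lambda>t. coord c (\<gamma> t))"
    by (rule continuous_on_compose2[OF coord_continuous[OF c(1)] v3 c(2)])
  have "continuous_on {a..b} (\<lambda>t. \<Gamma> c (chart_inv c (coord c (\<gamma> t))) x w)" for x w
    by (rule continuous_on_compose2[OF smooth_on_imp_continuous_on[OF christoffel_smooth[OF c(1)]] cc]) (use c(2) in blast)
  then have cG: "continuous_on {a..b} (\<lambda>t. \<Gamma> c (\<gamma> t) x w)" for x w
    by (rule continuous_on_eq) (simp add: c(1) dom)
  have cA: "continuous_on {a..b} (\<lambda>t. - \<Gamma> c (\<gamma> t) (v c t) w)" for w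
    using continuous_on_apply_linear[where A = "\<lambda>t x. \<Gamma> c (\<gamma> t) x w", OF christoffel_linear1[OF c(1) dom] cG v2[OF c(1) order_refl c(2)]]
    by (rule continuous_on_minus)
  have "\<exists>u. u a = v0 c \<and> (\<forall>t\<in>{a..b}. (u has_vector_derivative - \<Gamma> c (\<gamma> t) (v c t) (u t)) (at t within {a..b}))"
    by (rule linear_ODE_exists[where A = "\<lambda>t w. - \<Gamma> c (\<gamma> t) (v c t) w", OF ab linear_compose_neg[OF christoffel_linear2[OF c(1) dom]] cA])
  then obtain u where u: "u a = v0 c" "\<And>t. t \<in> {a..b} \<Longrightarrow> (u has_vector_derivative - \<Gamma> c (\<gamma> t) (v c t) (u t)) (at t within {a..b})"
    by blast
  define V where "V s = E c (\<gamma> s) (u s)" for s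
  have VT: "V s \<in> T (\<gamma> s)" if "s \<in> {a..b}" for s unfolding V_def by (rule coord_vec_tangent[OF c(1) dom[OF that]])
  have Vc: "V s c = u s" if "s \<in> {a..b}" for s unfolding V_def by (rule coord_vec_self[OF c(1) dom[OF that]])
  have "parallel_on \<A> D \<gamma> a b V"
  proof (rule parallel_onI[OF ab VT])
    fix t c' assume t: "t \<in> {a..b}" and c': "c' \<in> \<A>" "\<gamma> t \<in> dom_chart c'"
    have "((\<lambda>s. V s c) has_vector_derivative - \<Gamma> c (\<gamma> t) (v c t) (V t c)) (at t within {a..b})"
      unfolding Vc[OF t] by (rule has_vector_derivative_transform[OF t Vc u(2)[OF t]])
    from parallel_change_chart[OF ab t c(1) dom[OF t] c' v3 VT v1[OF c(1) t dom[OF t]] v1[OF c'(1) t c'(2)] this]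
    show "\<exists>x. ((\<lambda>s. coord c' (\<gamma> s)) has_vector_derivative x) (at t within {a..b}) \<and>
        ((\<lambda>s. V s c') has_vector_derivative - \<Gamma> c' (\<gamma> t) x (V t c')) (at t within {a..b})"
      using v1[OF c'(1) t c'(2)] by blast
  qed
  moreover have "V a = v0" unfolding V_def u(1) by (rule tangent_eq_coord_vec[OF v0 c(1) dom]) (use ab in simp)
  ultimately show ?thesis using sm by (auto simp: parallel_piece_def)
qed

lemma chain_parallel_tangent:
  assumes "chain (parallel_piece \<gamma> V) a b" shows "V a \<in> T (\<gamma> a)" "V b \<in> T (\<gamma> b)"
proof -
  have "V a \<in> T (\<gamma> a) \<and> V b \<in> T (\<gamma> b)"
    using assms by (induction rule: chain.induct) (auto simp: parallel_piece_def parallel_on_def)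
  then show "V a \<in> T (\<gamma> a)" "V b \<in> T (\<gamma> b)" by auto
qed

lemma chain_parallel_join:
  assumes 1: "chain (parallel_piece \<gamma> V) a b" and 2: "chain (parallel_piece \<gamma>' V') b c" and eq: "\<gamma> b = \<gamma>' b" "V b = V' b"
  shows "chain (parallel_piece (\<lambda>r. if r \<le> b then \<gamma> r else \<gamma>' r) (\<lambda>r. if r \<le> b then V r else V' r)) a c"
proof (rule chain_trans)
  show "chain (parallel_piece (\<lambda>r. if r \<le> b then \<gamma> r else \<gamma>' r) (\<lambda>r. if r \<le> b then V r else V' r)) a b"
    by (rule chain_mono[OF 1]) (erule parallel_piece_cong; simp)
  show "chain (parallel_piece (\<lambda>r. if r \<le> b then \<gamma> r else \<gamma>' r) (\<lambda>r. if r \<le> b then V r else V' r)) b c"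
    by (rule chain_mono[OF 2]) (erule parallel_piece_cong; use eq in \<open>auto simp: le_less\<close>)
qed

lemma chain_smooth_join:
  assumes 1: "chain (smooth_piece \<gamma>) a b" and 2: "chain (smooth_piece \<gamma>') b c" and eq: "\<gamma> b = \<gamma>' b"
  shows "chain (smooth_piece (\<lambda>r. if r \<le> b then \<gamma> r else \<gamma>' r)) a c"
proof (rule chain_trans)
  show "chain (smooth_piece (\<lambda>r. if r \<le> b then \<gamma> r else \<gamma>' r)) a b"
    by (rule chain_mono[OF 1]) (unfold smooth_piece_def, erule smooth_curve_cong; simp)
  show "chain (smooth_piece (\<lambda>r. if r \<le> b then \<gamma> r else \<gamma>' r)) b c"
    by (rule chain_mono[OF 2]) (unfold smooth_piece_def, erule smooth_curve_cong; use eq in \<open>auto simp: le_less\<close>)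
qed

text \<open>
  By the bisection principle it is enough to treat short intervals, where the curve stays in one
  chart and the parallel transport equation is a linear differential equation.
\<close>

lemma parallel_exists_piece:
  assumes sm: "smooth_curve_on \<A> a b \<gamma>" and ab: "a < b" and v: "v \<in> T (\<gamma> a)"
  shows "\<exists>V. chain (parallel_piece \<gamma> V) a b \<and> V a = v"
proof -
  define P where "P s t \<longleftrightarrow> (a \<le> s \<longrightarrow> t \<le> b \<longrightarrow> s < t \<longrightarrow> (\<forall>v\<in>T (\<gamma> s). \<exists>V. chain (parallel_piece \<gamma> V) s t \<and> V s = v))" for s t
  have cont: "continuous_on {a..b} \<gamma>" by (rule smooth_curve_velocity[OF sm ab])
  have "P a b"
  proof (rule Bolzano)
    show "a \<le> b" using ab by simp
  next
    fix s t u assume 1: "P s t" and 2: "P t u" and le: "s \<le> t" "t \<le> u"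
    show "P s u" unfolding P_def
    proof (intro impI ballI)
      fix v assume h: "a \<le> s" "u \<le> b" "s < u" and v: "v \<in> T (\<gamma> s)"
      show "\<exists>V. chain (parallel_piece \<gamma> V) s u \<and> V s = v"
      proof (cases "s = t \<or> t = u")
        case True then show ?thesis using 1 2 h v unfolding P_def by auto
      next
        case False
        then have st: "s < t" "t < u" using le by auto
        obtain V where V: "chain (parallel_piece \<gamma> V) s t" "V s = v"
          using 1 h st v le unfolding P_def by force
        obtain V' where V': "chain (parallel_piece \<gamma> V') t u" "V' t = V t"
          using 2 h st le chain_parallel_tangent(2)[OF V(1)] unfolding P_def by force
        show ?thesis
          using chain_parallel_join[OF V(1) V'(1) refl V'(2)[symmetric]] V(2) st
          by (intro exI[of _ "\<lambda>r. if r \<le> t then V r else V' r"]) simp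
      qed
    qed
  next
    fix x assume x: "a \<le> x" "x \<le> b"
    obtain c where c: "c \<in> \<A>" "\<gamma> x \<in> dom_chart c" by (rule chart_cover)
    have "\<exists>d>0. \<forall>s\<in>{a..b}. dist s x < d \<longrightarrow> \<gamma> s \<in> dom_chart c"
    proof -
      have "(\<gamma> \<longlongrightarrow> \<gamma> x) (at x within {a..b})" using cont x by (simp add: continuous_on_def)
      from topological_tendstoD[OF this chart_open[OF c(1)] c(2)]
      obtain d where "d > 0" "\<forall>s\<in>{a..b}. s \<noteq> x \<and> dist s x < d \<longrightarrow> \<gamma> s \<in> dom_chart c"
        by (auto simp: eventually_at)
      then show ?thesis using c(2) by metis
    qed
    then obtain d where d: "d > 0" "\<And>s. s \<in> {a..b} \<Longrightarrow> dist s x < d \<Longrightarrow> \<gamma> s \<in> dom_chart c" by blast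
    have "P s t" if st: "s \<le> x" "x \<le> t" "t - s < d" for s t
      unfolding P_def
    proof (intro impI ballI)
      fix v assume h: "a \<le> s" "t \<le> b" "s < t" and v: "v \<in> T (\<gamma> s)"
      have dom: "\<gamma> ` {s..t} \<subseteq> dom_chart c"
      proof (rule image_subsetI)
        fix r assume "r \<in> {s..t}"
        then show "\<gamma> r \<in> dom_chart c" using h st by (intro d(2)) (auto simp: dist_real_def)
      qed
      from parallel_exists_in_chart[OF smooth_curve_subset[OF sm h(1,2)] h(3) c(1) dom v]
      show "\<exists>V. chain (parallel_piece \<gamma> V) s t \<and> V s = v" using chain.base[OF h(3)] by blast
    qed
    then show "\<exists>d>0. \<forall>s t. s \<le> x \<and> x \<le> t \<and> t - s < d \<longrightarrow> P s t" using d(1) by blast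
  qed
  then show ?thesis using ab v unfolding P_def by blast
qed

lemma parallel_exists:
  assumes "chain (smooth_piece \<gamma>) a b" "v \<in> T (\<gamma> a)"
  shows "\<exists>V. chain (parallel_piece \<gamma> V) a b \<and> V a = v"
  using assms
proof (induction rule: chain.induct)
  case (base a b)
  then show ?case using parallel_exists_piece[of a b \<gamma>] by (simp add: smooth_piece_def)
next
  case (step a b c)
  obtain V where V: "chain (parallel_piece \<gamma> V) a b" "V a = v" using step.IH[OF step.prems] by blast
  obtain V' where V': "chain (parallel_piece \<gamma> V') b c" "V' b = V b"
    using parallel_exists_piece[of b c \<gamma> "V b"] step.hyps chain_parallel_tangent(2)[OF V(1)]
    unfolding smooth_piece_def by blast
  show ?case
    using chain_parallel_join[OF V(1) V'(1) refl V'(2)[symmetric]] V(2) chain_less[OF V(1)]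
    by (intro exI[of _ "\<lambda>r. if r \<le> b then V r else V' r"]) simp
qed

lemma parallel_form_constant_piece:
  assumes alt: "\<And>p. alt3_at \<A> p (\<omega> p)" and par: "parallel_components \<omega>" and ab: "a < b"
    and V1: "parallel_piece \<gamma> V1 a b" and V2: "parallel_piece \<gamma> V2 a b" and V3: "parallel_piece \<gamma> V3 a b"
  shows "\<omega> (\<gamma> a) (V1 a) (V2 a) (V3 a) = \<omega> (\<gamma> b) (V1 b) (V2 b) (V3 b)"
proof -
  have sm: "smooth_curve_on \<A> a b \<gamma>" and p1: "parallel_on \<A> D \<gamma> a b V1" and p2: "parallel_on \<A> D \<gamma> a b V2"
    and p3: "parallel_on \<A> D \<gamma> a b V3"
    using V1 V2 V3 by (auto simp: parallel_piece_def)
  have cont: "continuous_on {a..b} \<gamma>" by (rule smooth_curve_velocity[OF sm ab])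
  let ?f = "\<lambda>s. \<omega> (\<gamma> s) (V1 s) (V2 s) (V3 s)"
  have zero: "(?f has_derivative (\<lambda>h. 0)) (at t within {a..b})" if t: "t \<in> {a..b}" for t
  proof -
    obtain c where c: "c \<in> \<A>" "\<gamma> t \<in> dom_chart c" by (rule chart_cover)
    obtain x where x: "((\<lambda>s. coord c (\<gamma> s)) has_vector_derivative x) (at t within {a..b})"
      using curve_has_velocity[OF sm ab t c] ..
    have "(\<gamma> \<longlongrightarrow> \<gamma> t) (at t within {a..b})" using cont t by (simp add: continuous_on_def)
    from topological_tendstoD[OF this chart_open[OF c(1)] c(2)]
    have ev1: "\<forall>\<^sub>F s in at t within {a..b}. \<gamma> s \<in> dom_chart c" .
    have ev2: "\<forall>\<^sub>F s in at t within {a..b}. s \<in> {a..b}" by (simp add: eventually_at_filter)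
    note T123 = parallel_onD(1)[OF sm ab p1] parallel_onD(1)[OF sm ab p2] parallel_onD(1)[OF sm ab p3]
    have eq: "comp \<omega> c (\<gamma> s) (V1 s c) (V2 s c) (V3 s c) = ?f s" if "s \<in> {a..b}" "\<gamma> s \<in> dom_chart c" for s
      by (simp only: tangent_eq_coord_vec[OF T123(1)[OF that(1)] c(1) that(2)]
        tangent_eq_coord_vec[OF T123(2)[OF that(1)] c(1) that(2)] tangent_eq_coord_vec[OF T123(3)[OF that(1)] c(1) that(2)])
    have d: "((\<lambda>s. comp \<omega> c (\<gamma> s) (V1 s c) (V2 s c) (V3 s c)) has_derivative (\<lambda>h. 0)) (at t within {a..b})"
    proof (rule has_derivative_eq_rhs)
      show "((\<lambda>s. comp \<omega> c (\<gamma> s) (V1 s c) (V2 s c) (V3 s c)) has_derivative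
        (\<lambda>h. comp \<omega> c (\<gamma> t) (h *\<^sub>R (- \<Gamma> c (\<gamma> t) x (V1 t c)) + \<Gamma> c (\<gamma> t) (h *\<^sub>R x) (V1 t c)) (V2 t c) (V3 t c)
           + comp \<omega> c (\<gamma> t) (V1 t c) (h *\<^sub>R (- \<Gamma> c (\<gamma> t) x (V2 t c)) + \<Gamma> c (\<gamma> t) (h *\<^sub>R x) (V2 t c)) (V3 t c)
           + comp \<omega> c (\<gamma> t) (V1 t c) (V2 t c) (h *\<^sub>R (- \<Gamma> c (\<gamma> t) x (V3 t c)) + \<Gamma> c (\<gamma> t) (h *\<^sub>R x) (V3 t c))))
        (at t within {a..b})"
        using parallel_onD(2)[OF sm ab p1 t c x] parallel_onD(2)[OF sm ab p2 t c x] parallel_onD(2)[OF sm ab p3 t c x] x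
        unfolding has_vector_derivative_def
        by (intro form_covariant_derivative[OF alt par c(1) t ev1 c(2)])
      note l = linear_0[OF comp_linear1[where \<omega> = \<omega>, OF alt c]] linear_0[OF comp_linear2[where \<omega> = \<omega>, OF alt c]]
        linear_0[OF comp_linear3[where \<omega> = \<omega>, OF alt c]]
      have z: "h *\<^sub>R (- \<Gamma> c (\<gamma> t) x w) + \<Gamma> c (\<gamma> t) (h *\<^sub>R x) w = 0" for h w
        by (simp add: linear_scale[OF christoffel_linear1[OF c]])
      show "(\<lambda>h. comp \<omega> c (\<gamma> t) (h *\<^sub>R (- \<Gamma> c (\<gamma> t) x (V1 t c)) + \<Gamma> c (\<gamma> t) (h *\<^sub>R x) (V1 t c)) (V2 t c) (V3 t c)
           + comp \<omega> c (\<gamma> t) (V1 t c) (h *\<^sub>R (- \<Gamma> c (\<gamma> t) x (V2 t c)) + \<Gamma> c (\<gamma> t) (h *\<^sub>R x) (V2 t c)) (V3 t c)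
           + comp \<omega> c (\<gamma> t) (V1 t c) (V2 t c) (h *\<^sub>R (- \<Gamma> c (\<gamma> t) x (V3 t c)) + \<Gamma> c (\<gamma> t) (h *\<^sub>R x) (V3 t c))) = (\<lambda>h. 0)"
        by (simp only: z l add_0_right)
    qed
    show ?thesis
    proof (rule has_derivative_transform_eventually[where g = ?f, OF d _ _ t])
      show "comp \<omega> c (\<gamma> t) (V1 t c) (V2 t c) (V3 t c) = ?f t" by (rule eq[OF t c(2)])
      show "\<forall>\<^sub>F s in at t within {a..b}. comp \<omega> c (\<gamma> s) (V1 s c) (V2 s c) (V3 s c) = ?f s"
        using ev1 ev2 by eventually_elim (rule eq)
    qed
  qed
  show ?thesis
    by (rule has_derivative_zero_unique[of "{a..b}" ?f, OF convex_closed_interval zero]) (use ab in auto)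
qed

lemma parallel_chain_right:
  assumes "chain (parallel_piece \<gamma> V) a b" "a \<le> x" "x < b" shows "\<exists>y>x. parallel_piece \<gamma> V x y"
  by (rule chain_right[OF assms]) (erule (3) parallel_piece_subset)

lemma parallel_chain_left:
  assumes "chain (parallel_piece \<gamma> V) a b" "a < x" "x \<le> b" shows "\<exists>y<x. parallel_piece \<gamma> V y x"
  by (rule chain_left[OF assms]) (erule (3) parallel_piece_subset)

text \<open>
  The three fields may come with different subdivisions. Locally this does not matter: to the
  left and to the right of each point there are common pieces, and the bisection principle
  globalizes.
\<close>

lemma parallel_form_constant:
  assumes alt: "\<And>p. alt3_at \<A> p (\<omega> p)" and par: "parallel_components \<omega>"
    and V1: "chain (parallel_piece \<gamma> V1) a b" and V2: "chain (parallel_piece \<gamma> V2) a b" and V3: "chain (parallel_piece \<gamma> V3) a b"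
  shows "\<omega> (\<gamma> a) (V1 a) (V2 a) (V3 a) = \<omega> (\<gamma> b) (V1 b) (V2 b) (V3 b)"
proof -
  have ab: "a < b" by (rule chain_less[OF V1])
  let ?f = "\<lambda>s. \<omega> (\<gamma> s) (V1 s) (V2 s) (V3 s)"
  define P where "P s t \<longleftrightarrow> (a \<le> s \<longrightarrow> t \<le> b \<longrightarrow> ?f s = ?f t)" for s t
  have "P a b"
  proof (rule Bolzano)
    show "a \<le> b" using ab by simp
  next
    fix s t u assume "P s t" "P t u" "s \<le> t" "t \<le> u" then show "P s u" unfolding P_def by simp
  next
    fix x assume x: "a \<le> x" "x \<le> b"
    have R: "\<exists>d>0. \<forall>t. x \<le> t \<and> t \<le> b \<and> t - x < d \<longrightarrow> ?f x = ?f t"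
    proof (cases "x = b")
      case True then show ?thesis by (auto intro!: exI[of _ 1])
    next
      case False
      then have xb: "x < b" using x by simp
      obtain y1 y2 y3 where y: "y1 > x" "parallel_piece \<gamma> V1 x y1" "y2 > x" "parallel_piece \<gamma> V2 x y2" "y3 > x" "parallel_piece \<gamma> V3 x y3"
        using parallel_chain_right[OF V1 x(1) xb] parallel_chain_right[OF V2 x(1) xb]
          parallel_chain_right[OF V3 x(1) xb] by blast
      have "min y1 (min y2 y3) - x > 0" using y(1,3,5) by simp
      moreover have "?f x = ?f t" if t: "x \<le> t" "t \<le> b" "t - x < min y1 (min y2 y3) - x" for t
      proof (cases "t = x")
        case False
        then have xt: "x < t" and ty: "t \<le> y1" "t \<le> y2" "t \<le> y3" using t by auto
        show ?thesis
          by (rule parallel_form_constant_piece[OF alt par xt parallel_piece_subset[OF y(2) order_refl xt ty(1)]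
            parallel_piece_subset[OF y(4) order_refl xt ty(2)] parallel_piece_subset[OF y(6) order_refl xt ty(3)]])
      qed simp
      ultimately show ?thesis by blast
    qed
    have L: "\<exists>d>0. \<forall>s. s \<le> x \<and> a \<le> s \<and> x - s < d \<longrightarrow> ?f s = ?f x"
    proof (cases "x = a")
      case True then show ?thesis by (auto intro!: exI[of _ 1])
    next
      case False
      then have ax: "a < x" using x by simp
      obtain y1 y2 y3 where y: "y1 < x" "parallel_piece \<gamma> V1 y1 x" "y2 < x" "parallel_piece \<gamma> V2 y2 x" "y3 < x" "parallel_piece \<gamma> V3 y3 x"
        using parallel_chain_left[OF V1 ax x(2)] parallel_chain_left[OF V2 ax x(2)]
          parallel_chain_left[OF V3 ax x(2)] by blast
      have "x - max y1 (max y2 y3) > 0" using y(1,3,5) by simp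
      moreover have "?f s = ?f x" if s: "s \<le> x" "a \<le> s" "x - s < x - max y1 (max y2 y3)" for s
      proof (cases "s = x")
        case False
        then have sx: "s < x" and sy: "y1 \<le> s" "y2 \<le> s" "y3 \<le> s" using s by auto
        show ?thesis
          by (rule parallel_form_constant_piece[OF alt par sx parallel_piece_subset[OF y(2) sy(1) sx order_refl]
            parallel_piece_subset[OF y(4) sy(2) sx order_refl] parallel_piece_subset[OF y(6) sy(3) sx order_refl]])
      qed simp
      ultimately show ?thesis by blast
    qed
    from R obtain d1 where d1: "d1 > 0" "\<forall>t. x \<le> t \<and> t \<le> b \<and> t - x < d1 \<longrightarrow> ?f x = ?f t" by (elim exE conjE)
    from L obtain d2 where d2: "d2 > 0" "\<forall>s. s \<le> x \<and> a \<le> s \<and> x - s < d2 \<longrightarrow> ?f s = ?f x" by (elim exE conjE)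
    have "P s t" if "s \<le> x" "x \<le> t" "t - s < min d1 d2" for s t
      unfolding P_def
    proof (intro impI)
      assume h: "a \<le> s" "t \<le> b"
      have "?f s = ?f x" by (rule d2(2)[rule_format]) (use that h in auto)
      also have "?f x = ?f t" by (rule d1(2)[rule_format]) (use that h in auto)
      finally show "?f s = ?f t" .
    qed
    moreover have "min d1 d2 > 0" using d1(1) d2(1) by simp
    ultimately show "\<exists>d>0. \<forall>s t. s \<le> x \<and> x \<le> t \<and> t - s < d \<longrightarrow> P s t" by blast
  qed
  then show ?thesis unfolding P_def by simp
qed

end

section \<open>Parallel transport along piecewise smooth curves\<close>

context smooth_connection
begin

definition pw_path :: "'a \<Rightarrow> 'a \<Rightarrow> (real \<Rightarrow> 'a) \<Rightarrow> bool" where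
  "pw_path p q \<gamma> \<longleftrightarrow> chain (smooth_piece \<gamma>) 0 1 \<and> \<gamma> 0 = p \<and> \<gamma> 1 = q"

text \<open>
  A relation, because uniqueness of parallel transport is only obtained below, from an invariant
  form.
\<close>

definition transports :: "(real \<Rightarrow> 'a) \<Rightarrow> 'a tvec \<Rightarrow> 'a tvec \<Rightarrow> bool" where
  "transports \<gamma> v w \<longleftrightarrow> (\<exists>V. chain (parallel_piece \<gamma> V) 0 1 \<and> V 0 = v \<and> V 1 = w)"

lemma chain_0_1_iff_partition:
  "chain R 0 1 \<longleftrightarrow> (\<exists>n t. partition_of_unit_interval n t \<and> (\<forall>i<n. R (t i) (t (Suc i))))"
  unfolding chain_iff_partition partition_of_unit_interval_def
proof
  assume "\<exists>n t. (t 0 = 0 \<and> t n = 1 \<and> (\<forall>i<n. t i < t (Suc i))) \<and> (\<forall>i<n. R (t i) (t (Suc i)))"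
  then obtain n t where t: "t 0 = (0::real)" "t n = 1" "\<forall>i<n. t i < t (Suc i)" "\<forall>i<n. R (t i) (t (Suc i))"
    by blast
  have "0 < n" using t(1,2) by (cases n) auto
  then show "\<exists>n t. 0 < n \<and> t 0 = 0 \<and> t n = 1 \<and> (\<forall>i<n. t i < t (Suc i)) \<and> (\<forall>i<n. R (t i) (t (Suc i)))"
    using t by blast
qed blast

lemma piecewise_smooth_curve_iff: "piecewise_smooth_curve \<A> \<gamma> \<longleftrightarrow> chain (smooth_piece \<gamma>) 0 1"
  unfolding chain_0_1_iff_partition piecewise_smooth_curve_def smooth_piece_def ..

lemma parallel_along_iff: "parallel_along \<A> D \<gamma> V \<longleftrightarrow> chain (parallel_piece \<gamma> V) 0 1"
  unfolding chain_0_1_iff_partition parallel_along_def parallel_piece_def ..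

lemma parallel_transport_eq: "parallel_transport \<A> D \<gamma> v = (THE w. transports \<gamma> v w)"
  unfolding parallel_transport_def transports_def parallel_along_iff ..

lemma transports_exists: "pw_path p q \<gamma> \<Longrightarrow> v \<in> T p \<Longrightarrow> \<exists>w. transports \<gamma> v w"
  unfolding pw_path_def transports_def using parallel_exists by blast

lemma transports_tangent:
  assumes "pw_path p q \<gamma>" "transports \<gamma> v w" shows "v \<in> T p" "w \<in> T q"
  using assms chain_parallel_tangent unfolding pw_path_def transports_def by blast+

lemma transports_form:
  assumes alt: "\<And>p. alt3_at \<A> p (\<omega> p)" and par: "parallel_components \<omega>"
    and "pw_path p q \<gamma>" "transports \<gamma> v1 w1" "transports \<gamma> v2 w2" "transports \<gamma> v3 w3"
  shows "\<omega> p v1 v2 v3 = \<omega> q w1 w2 w3"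
proof -
  obtain V1 V2 V3 where V: "chain (parallel_piece \<gamma> V1) 0 1" "V1 0 = v1" "V1 1 = w1"
    "chain (parallel_piece \<gamma> V2) 0 1" "V2 0 = v2" "V2 1 = w2"
    "chain (parallel_piece \<gamma> V3) 0 1" "V3 0 = v3" "V3 1 = w3"
    using assms(4-6) unfolding transports_def by (elim exE conjE)
  from parallel_form_constant[where \<omega> = \<omega>, OF alt par V(1,4,7)] show ?thesis
    using V assms(3) unfolding pw_path_def by simp
qed

text \<open>
  The reparametrization is written as \<open>m * t + k\<close>, the form in which \<open>parallel_piece_affine\<close> and
  \<open>smooth_curve_affine\<close> apply.
\<close>

lemma transports_reverse:
  assumes "transports \<gamma> v w" shows "transports (\<lambda>t. \<gamma> (- 1 * t + 1)) w v"
proof -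
  obtain V where V: "chain (parallel_piece \<gamma> V) 0 1" "V 0 = v" "V 1 = w"
    using assms unfolding transports_def by blast
  have "chain (parallel_piece (\<lambda>t. \<gamma> (- 1 * t + 1)) (\<lambda>t. V (- 1 * t + 1))) (1 - 1) (1 - 0)"
  proof (rule chain_image_rev[where f = "\<lambda>t. 1 - t", OF V(1)])
    fix s t :: real assume st: "s < t" "parallel_piece \<gamma> V s t"
    show "parallel_piece (\<lambda>t. \<gamma> (- 1 * t + 1)) (\<lambda>t. V (- 1 * t + 1)) (1 - t) (1 - s)"
      by (rule parallel_piece_affine[OF st(2,1)]) (use st(1) in auto)
  qed simp
  then show ?thesis
    unfolding transports_def using V(2,3) by (intro exI[of _ "\<lambda>t. V (- 1 * t + 1)"]) simp
qed

lemma pw_path_reverse: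
  assumes "pw_path p q \<gamma>"
  shows "\<exists>\<gamma>'. pw_path q p \<gamma>' \<and> (\<forall>v w. transports \<gamma>' w v \<longleftrightarrow> transports \<gamma> v w)"
proof (intro exI conjI allI iffI)
  let ?g = "\<lambda>t. \<gamma> (- 1 * t + 1)"
  have "chain (smooth_piece ?g) (1 - 1) (1 - 0)"
  proof (rule chain_image_rev[where f = "\<lambda>t. 1 - t"])
    show "chain (smooth_piece \<gamma>) 0 1" using assms by (simp add: pw_path_def)
    fix s t :: real assume "s < t" "smooth_piece \<gamma> s t"
    then show "smooth_piece ?g (1 - t) (1 - s)"
      unfolding smooth_piece_def by (intro smooth_curve_affine[of s t \<gamma> "- 1"]) auto
  qed simp
  then show "pw_path q p ?g" using assms by (simp add: pw_path_def)
  fix v w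
  show "transports ?g w v" if "transports \<gamma> v w" using that by (rule transports_reverse)
  show "transports \<gamma> v w" if "transports ?g w v" using transports_reverse[OF that] by simp
qed

lemma pw_path_join:
  assumes "pw_path p q \<gamma>" "pw_path q r \<gamma>'"
  shows "\<exists>\<delta>. pw_path p r \<delta> \<and> (\<forall>u v w. transports \<gamma> u v \<longrightarrow> transports \<gamma>' v w \<longrightarrow> transports \<delta> u w)"
proof (intro exI conjI allI impI)
  let ?s = "\<lambda>f g t. if t \<le> (1::real) then f t else g (1 * t + - 1)"
  let ?g = "?s \<gamma> \<gamma>'"
  have ch: "chain (smooth_piece \<gamma>) 0 1" "chain (smooth_piece \<gamma>') 0 1" and e: "\<gamma> 0 = p" "\<gamma> 1 = q" "\<gamma>' 0 = q" "\<gamma>' 1 = r"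
    using assms by (auto simp: pw_path_def)
  have sh: "chain (smooth_piece (\<lambda>t. \<gamma>' (1 * t + - 1))) (0 + 1) (1 + 1)"
  proof (rule chain_image[where f = "\<lambda>t. t + 1", OF ch(2)])
    fix s t :: real assume "s < t" "smooth_piece \<gamma>' s t"
    then show "smooth_piece (\<lambda>t. \<gamma>' (1 * t + - 1)) (s + 1) (t + 1)"
      unfolding smooth_piece_def by (intro smooth_curve_affine[of s t \<gamma>' 1]) auto
  qed simp
  have "chain (smooth_piece ?g) 0 (1 + 1)"
    by (rule chain_smooth_join[OF ch(1)]) (use sh e in simp_all)
  then have "chain (smooth_piece (\<lambda>t. ?g (2 * t + 0))) (0 / 2) ((1 + 1) / 2)"
  proof (rule chain_image[where f = "\<lambda>t. t / 2"])
    fix s t :: real assume "s < t" "smooth_piece ?g s t"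
    then show "smooth_piece (\<lambda>t. ?g (2 * t + 0)) (s / 2) (t / 2)"
      unfolding smooth_piece_def by (intro smooth_curve_affine[of s t ?g 2 "s / 2" "t / 2" 0]) auto
  qed simp
  then show "pw_path p r (\<lambda>t. ?g (2 * t + 0))" using e by (simp add: pw_path_def)
  fix u v w assume "transports \<gamma> u v" "transports \<gamma>' v w"
  then obtain V V' where V: "chain (parallel_piece \<gamma> V) 0 1" "V 0 = u" "V 1 = v"
    "chain (parallel_piece \<gamma>' V') 0 1" "V' 0 = v" "V' 1 = w"
    unfolding transports_def by (elim exE conjE)
  let ?V = "?s V V'"
  have shV: "chain (parallel_piece (\<lambda>t. \<gamma>' (1 * t + - 1)) (\<lambda>t. V' (1 * t + - 1))) (0 + 1) (1 + 1)"
  proof (rule chain_image[where f = "\<lambda>t. t + 1", OF V(4)])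
    fix s t :: real assume st: "s < t" "parallel_piece \<gamma>' V' s t"
    show "parallel_piece (\<lambda>t. \<gamma>' (1 * t + - 1)) (\<lambda>t. V' (1 * t + - 1)) (s + 1) (t + 1)"
      by (rule parallel_piece_affine[OF st(2,1)]) (use st(1) in auto)
  qed simp
  have "chain (parallel_piece ?g ?V) 0 (1 + 1)"
    by (rule chain_parallel_join[OF V(1)]) (use shV e V in simp_all)
  then have "chain (parallel_piece (\<lambda>t. ?g (2 * t + 0)) (\<lambda>t. ?V (2 * t + 0))) (0 / 2) ((1 + 1) / 2)"
  proof (rule chain_image[where f = "\<lambda>t. t / 2"])
    fix s t :: real assume st: "s < t" "parallel_piece ?g ?V s t"
    show "parallel_piece (\<lambda>t. ?g (2 * t + 0)) (\<lambda>t. ?V (2 * t + 0)) (s / 2) (t / 2)"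
      by (rule parallel_piece_affine[OF st(2,1)]) (use st(1) in auto)
  qed simp
  then show "transports (\<lambda>t. ?g (2 * t + 0)) u w"
    unfolding transports_def using V(2,6) by (intro exI[of _ "\<lambda>t. ?V (2 * t + 0)"]) simp
qed

lemma pw_path_segment:
  assumes c: "c \<in> \<A>" and B: "ball y0 R \<subseteq> coord c ` dom_chart c" and y: "y1 \<in> ball y0 R" "y2 \<in> ball y0 R"
  shows "pw_path (chart_inv c y1) (chart_inv c y2) (\<lambda>s. chart_inv c (y1 + s *\<^sub>R (y2 - y1)))"
  using chain.base[of 0 1 "smooth_piece (\<lambda>s. chart_inv c (y1 + s *\<^sub>R (y2 - y1)))"] smooth_segment[OF assms]
  by (simp add: pw_path_def smooth_piece_def)

lemma chart_ball:
  assumes "c \<in> \<A>" "q \<in> dom_chart c"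
  obtains R where "R > 0" "ball (coord c q) R \<subseteq> coord c ` dom_chart c"
  using coord_image_open'[OF assms(1)] assms(2) by (meson imageI open_contains_ball)

text \<open>
  Points of a coordinate ball are joined to its centre by segments in both directions, so the set
  of points that can be reached from \<open>p\<close> is open and closed.
\<close>

lemma pw_path_exists:
  assumes "connected (UNIV :: 'a set)" shows "\<exists>\<gamma>. pw_path p q \<gamma>"
proof -
  have loc: "\<exists>U. open U \<and> x \<in> U \<and> (\<forall>y\<in>U. (\<exists>\<gamma>. pw_path x y \<gamma>) \<and> (\<exists>\<gamma>. pw_path y x \<gamma>))" for x
  proof -
    obtain c where c: "c \<in> \<A>" "x \<in> dom_chart c" by (rule chart_cover)
    obtain R where R: "R > 0" "ball (coord c x) R \<subseteq> coord c ` dom_chart c" by (rule chart_ball[OF c])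
    define U where "U = dom_chart c \<inter> coord c -` ball (coord c x) R"
    have "open U" unfolding U_def
      by (rule continuous_open_preimage[OF coord_continuous[OF c(1)] chart_open[OF c(1)] open_ball])
    moreover have "x \<in> U" using c R by (simp add: U_def)
    moreover have "(\<exists>\<gamma>. pw_path x y \<gamma>) \<and> (\<exists>\<gamma>. pw_path y x \<gamma>)" if "y \<in> U" for y
    proof -
      have y: "y \<in> dom_chart c" "coord c y \<in> ball (coord c x) R" using that by (auto simp: U_def)
      have x: "coord c x \<in> ball (coord c x) R" using R by simp
      show ?thesis
        using pw_path_segment[OF c(1) R(2) x y(2)] pw_path_segment[OF c(1) R(2) y(2) x]
        unfolding chart_inv_coord[OF c] chart_inv_coord[OF c(1) y(1)] by blast
    qed
    ultimately show ?thesis by blast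
  qed
  define S where "S = {q. \<exists>\<gamma>. pw_path p q \<gamma>}"
  have "open S"
  proof (subst open_subopen, rule ballI)
    fix x assume "x \<in> S"
    then obtain \<gamma> where g: "pw_path p x \<gamma>" by (auto simp: S_def)
    obtain U where U: "open U" "x \<in> U" "\<And>y. y \<in> U \<Longrightarrow> \<exists>\<gamma>. pw_path x y \<gamma>" by (rule exE[OF loc[of x]]) blast
    have "U \<subseteq> S"
    proof
      fix y assume "y \<in> U"
      then obtain \<gamma>' where "pw_path x y \<gamma>'" using U(3) by blast
      from pw_path_join[OF g this] show "y \<in> S" unfolding S_def by blast
    qed
    then show "\<exists>T. open T \<and> x \<in> T \<and> T \<subseteq> S" using U by blast
  qed
  moreover have "open (- S)"
  proof (subst open_subopen, rule ballI)
    fix x assume x: "x \<in> - S"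
    obtain U where U: "open U" "x \<in> U" "\<And>y. y \<in> U \<Longrightarrow> \<exists>\<gamma>. pw_path y x \<gamma>" by (rule exE[OF loc[of x]]) blast
    have "U \<subseteq> - S"
    proof
      fix y assume y: "y \<in> U"
      show "y \<in> - S"
      proof
        assume "y \<in> S"
        then obtain \<gamma> where "pw_path p y \<gamma>" unfolding S_def by blast
        obtain \<gamma>' where "pw_path y x \<gamma>'" using U(3)[OF y] by blast
        from pw_path_join[OF \<open>pw_path p y \<gamma>\<close> this] show False using x unfolding S_def by blast
      qed
    qed
    then show "\<exists>T. open T \<and> x \<in> T \<and> T \<subseteq> - S" using U by blast
  qed
  moreover have "p \<in> S"
  proof -
    obtain U where "p \<in> U" "\<And>y. y \<in> U \<Longrightarrow> \<exists>\<gamma>. pw_path p y \<gamma>" by (rule exE[OF loc[of p]]) blast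
    then show ?thesis unfolding S_def by blast
  qed
  ultimately have "- S = {}"
    using connectedD[OF assms, of S "- S"] by blast
  then show ?thesis unfolding S_def by blast
qed

end

section \<open>Parallel forms and the holonomy group\<close>

context smooth_manifold
begin

lemma frame_add: "frame \<A> p f \<Longrightarrow> u \<in> T p \<Longrightarrow> v \<in> T p \<Longrightarrow> f (u + v) = f u + f v"
  and frame_scale: "frame \<A> p f \<Longrightarrow> u \<in> T p \<Longrightarrow> f (a *\<^sub>R u) = a *\<^sub>R f u"
  and frame_bij: "frame \<A> p f \<Longrightarrow> bij_betw f (T p) UNIV"
  unfolding frame_def by blast+

lemma frame_surj: "frame \<A> p f \<Longrightarrow> \<exists>v\<in>T p. f v = x"
  using frame_bij unfolding bij_betw_def by (metis UNIV_I imageE)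

lemma frame_inj: "frame \<A> p f \<Longrightarrow> u \<in> T p \<Longrightarrow> v \<in> T p \<Longrightarrow> f u = f v \<Longrightarrow> u = v"
  using frame_bij unfolding bij_betw_def inj_on_def by blast

lemma frame_inv: "frame \<A> p f \<Longrightarrow> inv_into (T p) f x \<in> T p" "frame \<A> p f \<Longrightarrow> f (inv_into (T p) f x) = x"
  using frame_bij unfolding bij_betw_def by (metis UNIV_I inv_into_into, metis UNIV_I f_inv_into_f)

lemma frame_act_frame:
  assumes f: "frame \<A> p f" and h: "invertible h" shows "frame \<A> p (frame_act f h)"
  unfolding frame_def
proof (intro conjI ballI allI)
  have "bij ((*v) (matrix_inv h))" using invertible_matrix_inv[OF h] by (simp add: invertible_eq_bij)
  from bij_betw_trans[OF frame_bij[OF f] this] show "bij_betw (frame_act f h) (T p) UNIV"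
    by (simp add: frame_act_def o_def)
  fix u assume u: "u \<in> T p"
  show "frame_act f h (u + v) = frame_act f h u + frame_act f h v" if "v \<in> T p" for v
    unfolding frame_act_def frame_add[OF f u that] by (rule matrix_vector_right_distrib)
  show "frame_act f h (a *\<^sub>R u) = a *\<^sub>R frame_act f h u" for a
    unfolding frame_act_def frame_scale[OF f u] by (rule matrix_vector_mult_scaleR)
qed

lemma frame_act_mult:
  "invertible h \<Longrightarrow> invertible k \<Longrightarrow> frame_act (frame_act f h) k = frame_act f (h ** k)"
  by (rule ext) (simp add: frame_act_def matrix_inv_mult matrix_vector_mul_assoc)

lemma pullback_apply: "u \<in> T p \<Longrightarrow> v \<in> T p \<Longrightarrow> w \<in> T p \<Longrightarrow> pullback_\<phi>\<^sub>0 \<A> p f u v w = \<phi>\<^sub>0 (f u) (f v) (f w)"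
  by (simp add: pullback_\<phi>\<^sub>0_def)

lemma pullback_outside: "\<not> (u \<in> T p \<and> v \<in> T p \<and> w \<in> T p) \<Longrightarrow> pullback_\<phi>\<^sub>0 \<A> p f u v w = 0"
  unfolding pullback_\<phi>\<^sub>0_def by (rule if_not_P)

lemma pullback_alt3:
  assumes f: "frame \<A> p f" shows "alt3_at \<A> p (pullback_\<phi>\<^sub>0 \<A> p f)"
  unfolding alt3_at_def Let_def
proof (intro conjI ballI allI impI)
  fix u v w a assume t: "u \<in> T p" "v \<in> T p" "w \<in> T p"
  show "pullback_\<phi>\<^sub>0 \<A> p f (u + u') v w = pullback_\<phi>\<^sub>0 \<A> p f u v w + pullback_\<phi>\<^sub>0 \<A> p f u' v w" if u': "u' \<in> T p" for u'
    unfolding pullback_apply[OF T_add[OF t(1) u'] t(2,3)] pullback_apply[OF t] pullback_apply[OF u' t(2,3)] frame_add[OF f t(1) u']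
    by (rule phi0_add)
  show "pullback_\<phi>\<^sub>0 \<A> p f (a *\<^sub>R u) v w = a * pullback_\<phi>\<^sub>0 \<A> p f u v w"
    unfolding pullback_apply[OF T_scale[OF t(1)] t(2,3)] pullback_apply[OF t] frame_scale[OF f t(1)] by (rule phi0_scale)
  show "pullback_\<phi>\<^sub>0 \<A> p f v u w = - pullback_\<phi>\<^sub>0 \<A> p f u v w"
    unfolding pullback_apply[OF t] pullback_apply[OF t(2,1,3)] by (rule phi0_swap12)
  show "pullback_\<phi>\<^sub>0 \<A> p f u w v = - pullback_\<phi>\<^sub>0 \<A> p f u v w"
    unfolding pullback_apply[OF t] pullback_apply[OF t(1,3,2)] by (rule phi0_swap23)
next
  fix u v w assume "\<not> (u \<in> T p \<and> v \<in> T p \<and> w \<in> T p)"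
  then show "pullback_\<phi>\<^sub>0 \<A> p f u v w = 0" by (rule pullback_outside)
qed

lemma pullback_eqI:
  assumes "\<And>u v w. u \<in> T p \<Longrightarrow> v \<in> T p \<Longrightarrow> w \<in> T p \<Longrightarrow> \<phi>\<^sub>0 (f u) (f v) (f w) = \<phi>\<^sub>0 (g u) (g v) (g w)"
  shows "pullback_\<phi>\<^sub>0 \<A> p f = pullback_\<phi>\<^sub>0 \<A> p g"
  by (intro ext) (simp add: pullback_\<phi>\<^sub>0_def assms)

lemma pullback_G2: "k \<in> G2 \<Longrightarrow> pullback_\<phi>\<^sub>0 \<A> p (frame_act f k) = pullback_\<phi>\<^sub>0 \<A> p f"
  by (rule pullback_eqI) (simp add: frame_act_def G2_phi0[OF G2_inv])

lemma alt3_outside: "alt3_at \<A> p \<omega> \<Longrightarrow> \<not> (u \<in> T p \<and> v \<in> T p \<and> w \<in> T p) \<Longrightarrow> \<omega> u v w = 0"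
  unfolding alt3_at_def Let_def by blast

end

context smooth_connection
begin

text \<open>
  The end values of parallel fields, read in the two frames, form a relation that preserves \<open>\<phi>\<^sub>0\<close>,
  because \<open>\<omega>\<close> is constant on parallel fields. It is total in both directions by existence of
  parallel fields along the curve and its reverse.
\<close>

lemma transport_G2:
  assumes alt: "\<And>p. alt3_at \<A> p (\<omega> p)" and par: "parallel_components \<omega>"
    and f: "frame \<A> p f" "\<omega> p = pullback_\<phi>\<^sub>0 \<A> p f" and G: "frame \<A> q G" "\<omega> q = pullback_\<phi>\<^sub>0 \<A> q G"
    and path: "pw_path p q \<gamma>"
  shows "\<exists>k\<in>G2. \<forall>v w. transports \<gamma> v w \<longleftrightarrow> v \<in> T p \<and> w \<in> T q \<and> G w = k *v f v"
proof -
  obtain \<gamma>' where rev: "pw_path q p \<gamma>'" "\<forall>v w. transports \<gamma>' w v \<longleftrightarrow> transports \<gamma> v w"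
    using pw_path_reverse[OF path] by (elim exE conjE)
  have "\<exists>k\<in>G2. \<forall>x y. (\<exists>v w. transports \<gamma> v w \<and> x = f v \<and> y = G w) \<longleftrightarrow> y = k *v x"
  proof (rule phi0_relation)
    show "\<exists>y v w. transports \<gamma> v w \<and> x = f v \<and> y = G w" for x
    proof -
      obtain v where v: "v \<in> T p" "f v = x" using frame_surj[OF f(1)] by blast
      then obtain w where "transports \<gamma> v w" using transports_exists[OF path] by blast
      then show ?thesis using v by blast
    qed
    show "\<exists>x v w. transports \<gamma> v w \<and> x = f v \<and> y = G w" for y
    proof -
      obtain w where w: "w \<in> T q" "G w = y" using frame_surj[OF G(1)] by blast
      then obtain v where "transports \<gamma>' w v" using transports_exists[OF rev(1)] by blast
      then show ?thesis using w rev(2) by blast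
    qed
    fix x1 x2 x3 y1 y2 y3
    assume "\<exists>v w. transports \<gamma> v w \<and> x1 = f v \<and> y1 = G w" "\<exists>v w. transports \<gamma> v w \<and> x2 = f v \<and> y2 = G w"
      "\<exists>v w. transports \<gamma> v w \<and> x3 = f v \<and> y3 = G w"
    then obtain v1 w1 v2 w2 v3 w3 where
      t: "transports \<gamma> v1 w1" "transports \<gamma> v2 w2" "transports \<gamma> v3 w3"
      and xy: "x1 = f v1" "y1 = G w1" "x2 = f v2" "y2 = G w2" "x3 = f v3" "y3 = G w3" by (elim exE conjE)
    have "\<omega> p v1 v2 v3 = \<omega> q w1 w2 w3" by (rule transports_form[where \<omega> = \<omega>, OF alt par path t])
    then show "\<phi>\<^sub>0 x1 x2 x3 = \<phi>\<^sub>0 y1 y2 y3"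
      unfolding f(2) G(2) xy
      by (simp add: pullback_apply[OF transports_tangent(1)[OF path t(1)] transports_tangent(1)[OF path t(2)] transports_tangent(1)[OF path t(3)]]
        pullback_apply[OF transports_tangent(2)[OF path t(1)] transports_tangent(2)[OF path t(2)] transports_tangent(2)[OF path t(3)]])
  qed
  then obtain k where k: "k \<in> G2" "\<And>x y. (\<exists>v w. transports \<gamma> v w \<and> x = f v \<and> y = G w) \<longleftrightarrow> y = k *v x"
    by (elim bexE) (rule that; simp)
  have "transports \<gamma> v w \<longleftrightarrow> v \<in> T p \<and> w \<in> T q \<and> G w = k *v f v" for v w
  proof
    assume t: "transports \<gamma> v w"
    then have "G w = k *v f v" using k(2) by blast
    then show "v \<in> T p \<and> w \<in> T q \<and> G w = k *v f v" using transports_tangent[OF path t] by blast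
  next
    assume h: "v \<in> T p \<and> w \<in> T q \<and> G w = k *v f v"
    then obtain w' where w': "transports \<gamma> v w'" using transports_exists[OF path] by blast
    then have "G w' = k *v f v" using k(2) by blast
    then have "w' = w" using frame_inj[OF G(1) transports_tangent(2)[OF path w'], of w] h by metis
    then show "transports \<gamma> v w" using w' by simp
  qed
  then show ?thesis using k(1) by blast
qed

text \<open>
  The definite description in the definition of parallel transport is justified by the
  description of the relation \<open>transports\<close> through \<open>k\<close>.
\<close>

lemma holonomy_element:
  assumes f: "frame \<A> p f" and path: "pw_path p p \<gamma>"
    and k: "\<And>v w. transports \<gamma> v w \<longleftrightarrow> v \<in> T p \<and> w \<in> T p \<and> f w = k *v f v"
  shows "matrix (f \<circ> parallel_transport \<A> D \<gamma> \<circ> inv_into (T p) f) = k"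
proof -
  have "(f \<circ> parallel_transport \<A> D \<gamma> \<circ> inv_into (T p) f) x = k *v x" for x
  proof -
    define v where "v = inv_into (T p) f x"
    have v: "v \<in> T p" "f v = x" using frame_inv[OF f] by (auto simp: v_def)
    obtain w where w: "w \<in> T p" "f w = k *v x" using frame_surj[OF f] by blast
    have "parallel_transport \<A> D \<gamma> v = w"
      unfolding parallel_transport_eq
    proof (rule the_equality)
      show "transports \<gamma> v w" using k v w by simp
      show "w' = w" if "transports \<gamma> v w'" for w'
        using that k[of v w'] frame_inj[OF f _ w(1), of w'] w(2) v(2) by simp
    qed
    then show ?thesis using w(2) by (simp add: v_def)
  qed
  then have "f \<circ> parallel_transport \<A> D \<gamma> \<circ> inv_into (T p) f = (*v) k" by (rule ext)
  then show ?thesis by simp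
qed

lemma holonomy_groupI:
  assumes "frame \<A> p f" "pw_path p p \<gamma>" "\<And>v w. transports \<gamma> v w \<longleftrightarrow> v \<in> T p \<and> w \<in> T p \<and> f w = k *v f v"
  shows "k \<in> holonomy_group \<A> D p f"
  unfolding holonomy_group_def piecewise_smooth_curve_iff
  using holonomy_element[OF assms] assms(2) unfolding pw_path_def by blast

lemma holonomy_groupE:
  assumes alt: "\<And>p. alt3_at \<A> p (\<omega> p)" and par: "parallel_components \<omega>"
    and f: "frame \<A> p f" "\<omega> p = pullback_\<phi>\<^sub>0 \<A> p f" and k: "k \<in> holonomy_group \<A> D p f"
  obtains \<gamma> where "pw_path p p \<gamma>" "\<forall>v w. transports \<gamma> v w \<longleftrightarrow> v \<in> T p \<and> w \<in> T p \<and> f w = k *v f v"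
proof -
  obtain \<gamma> where \<gamma>: "pw_path p p \<gamma>" "k = matrix (f \<circ> parallel_transport \<A> D \<gamma> \<circ> inv_into (T p) f)"
    using k unfolding holonomy_group_def piecewise_smooth_curve_iff pw_path_def by blast
  obtain k' where k': "\<forall>v w. transports \<gamma> v w \<longleftrightarrow> v \<in> T p \<and> w \<in> T p \<and> f w = k' *v f v"
    using transport_G2[where \<omega> = \<omega>, OF alt par f f \<gamma>(1)] by blast
  have "k = k'" unfolding \<gamma>(2) by (rule holonomy_element[OF f(1) \<gamma>(1) k'[rule_format]])
  then show ?thesis using that[OF \<gamma>(1)] k' by simp
qed

text \<open>
  Any point is joined to \<open>p\<close> by a curve, along which both forms are constant on parallel fields.
\<close>

lemma parallel_form_unique:
  assumes conn: "connected (UNIV :: 'a set)"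
    and \<omega>: "\<And>p. alt3_at \<A> p (\<omega> p)" "parallel_components \<omega>"
    and \<omega>': "\<And>p. alt3_at \<A> p (\<omega>' p)" "parallel_components \<omega>'"
    and eq: "\<omega> p = \<omega>' p"
  shows "\<omega> = \<omega>'"
proof (intro ext)
  fix q u v w
  show "\<omega> q u v w = \<omega>' q u v w"
  proof (cases "u \<in> T q \<and> v \<in> T q \<and> w \<in> T q")
    case True
    obtain \<gamma> where path: "pw_path q p \<gamma>" using pw_path_exists[OF conn] by blast
    obtain u' where u': "transports \<gamma> u u'" using transports_exists[OF path] True by blast
    obtain v' where v': "transports \<gamma> v v'" using transports_exists[OF path] True by blast
    obtain w' where w': "transports \<gamma> w w'" using transports_exists[OF path] True by blast
    show ?thesis
      using transports_form[where \<omega> = \<omega>, OF \<omega> path u' v' w'] transports_form[where \<omega> = \<omega>', OF \<omega>' path u' v' w'] eq by simp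
  next
    case False
    show ?thesis using alt3_outside[OF \<omega>(1) False] alt3_outside[OF \<omega>'(1) False] by simp
  qed
qed

text \<open>
  Parallel transport to \<open>q\<close> of the coordinate vectors with components \<open>u\<close>, along coordinate segments;
  its derivative at \<open>q\<close> is \<open>segment_transport_has_derivative\<close> with \<open>G\<close> the Christoffel symbols.
\<close>

lemma parallel_along_segments:
  assumes c: "c \<in> \<A>" and q: "q \<in> dom_chart c" and R: "R > 0" "ball (coord c q) R \<subseteq> coord c ` dom_chart c"
  obtains Z where
    "\<And>y. y \<in> ball (coord c q) R \<Longrightarrow>
      transports (\<lambda>s. chart_inv c (y + s *\<^sub>R (coord c q - y))) (E c (chart_inv c y) u) (E c q (Z y))"
    "(Z has_derivative (\<lambda>x. \<Gamma> c q x u)) (at (coord c q))" "Z (coord c q) = u"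
proof -
  let ?y0 = "coord c q" and ?B = "ball (coord c q) R"
  let ?g = "\<lambda>y s. chart_inv c (y + s *\<^sub>R (?y0 - y))"
  have inB: "y + s *\<^sub>R (?y0 - y) \<in> ?B" if "y \<in> ?B" "s \<in> {0..1}" for y s
  proof -
    have "(1 - s) *\<^sub>R y + s *\<^sub>R ?y0 \<in> ?B"
      using convexD[OF convex_ball that(1), of ?y0 "1 - s" s] that(2) R(1) by auto
    then show ?thesis by (simp add: algebra_simps)
  qed
  have dom: "?g y s \<in> dom_chart c" if "y \<in> ?B" "s \<in> {0..1}" for y s
    using chart_inv_in[OF c order_refl] inB[OF that] R(2) by blast
  have cg: "coord c (?g y s) = y + s *\<^sub>R (?y0 - y)" if "y \<in> ?B" "s \<in> {0..1}" for y s
    using coord_chart_inv[OF c] inB[OF that] R(2) by blast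
  have y0B: "?y0 \<in> ?B" using R(1) by simp
  have sm: "smooth_curve_on \<A> 0 1 (?g y)" if "y \<in> ?B" for y
    by (rule smooth_segment[OF c R(2) that y0B])
  have "\<exists>V. parallel_piece (?g y) V 0 1 \<and> V 0 = E c (chart_inv c y) u" if y: "y \<in> ?B" for y
  proof (rule parallel_exists_in_chart[OF sm[OF y] _ c])
    show "?g y ` {0..1} \<subseteq> dom_chart c" using dom[OF y] by blast
    have "chart_inv c y \<in> dom_chart c" using chart_inv_in[OF c order_refl] y R(2) by blast
    then show "E c (chart_inv c y) u \<in> T (?g y 0)" using coord_vec_tangent[OF c] by simp
  qed simp
  then obtain V where V: "\<And>y. y \<in> ?B \<Longrightarrow> parallel_piece (?g y) (V y) 0 1" "\<And>y. y \<in> ?B \<Longrightarrow> V y 0 = E c (chart_inv c y) u"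
    by metis
  define z where "z y s = V y s c" for y s
  have zd: "(z y has_vector_derivative \<Gamma> c (chart_inv c (y + s *\<^sub>R (?y0 - y))) (y - ?y0) (z y s)) (at s within {0..1})"
    if y: "y \<in> ?B" and s: "s \<in> {0..1}" for y s
  proof -
    have "((\<lambda>s. y + s *\<^sub>R (?y0 - y)) has_vector_derivative (?y0 - y)) (at s within {0..1})"
      by (auto intro!: derivative_eq_intros)
    then have vel: "((\<lambda>s. coord c (?g y s)) has_vector_derivative (?y0 - y)) (at s within {0..1})"
      by (rule has_vector_derivative_transform[OF s, rotated]) (rule cg[OF y])
    have par: "parallel_on \<A> D (?g y) 0 1 (V y)" using V(1)[OF y] by (simp add: parallel_piece_def)
    have "(z y has_vector_derivative - \<Gamma> c (?g y s) (?y0 - y) (z y s)) (at s within {0..1})"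
      unfolding z_def by (rule parallel_onD(2)[OF sm[OF y] zero_less_one par s c dom[OF y s] vel])
    moreover have "- \<Gamma> c (?g y s) (?y0 - y) (z y s) = \<Gamma> c (?g y s) (y - ?y0) (z y s)"
      using linear_neg[OF christoffel_linear1[OF c dom[OF y s]], of "?y0 - y" "z y s"] by simp
    ultimately show ?thesis by simp
  qed
  have z0: "z y 0 = u" if "y \<in> ?B" for y
    unfolding z_def V(2)[OF that] by (rule coord_vec_self[OF c]) (use that R(2) chart_inv_in[OF c order_refl] in blast)
  have Bd: "chart_inv c y \<in> dom_chart c" if "y \<in> ?B" for y using chart_inv_in[OF c order_refl] that R(2) by blast
  have "((\<lambda>y. z y 1) has_derivative (\<lambda>x. \<Gamma> c (chart_inv c ?y0) x u)) (at ?y0)"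
  proof (rule segment_transport_has_derivative[where G = "\<lambda>y. \<Gamma> c (chart_inv c y)", OF R(1)])
    show "linear (\<lambda>v. \<Gamma> c (chart_inv c y) v w)" if "y \<in> ?B" for y w by (rule christoffel_linear1[OF c Bd[OF that]])
    show "linear (\<Gamma> c (chart_inv c y) v)" if "y \<in> ?B" for y v by (rule christoffel_linear2[OF c Bd[OF that]])
    show "continuous_on ?B (\<lambda>y. \<Gamma> c (chart_inv c y) v w)" for v w
      by (rule continuous_on_subset[OF smooth_on_imp_continuous_on[OF christoffel_smooth[OF c]] R(2)])
  qed (fact zd z0)+
  then have d: "((\<lambda>y. z y 1) has_derivative (\<lambda>x. \<Gamma> c q x u)) (at ?y0)" by (simp add: c q)
  have "norm (z ?y0 1 - z ?y0 0) \<le> 0"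
  proof (rule vector_derivative_bound_unit_interval[OF zd[OF y0B]])
    show "norm (\<Gamma> c (chart_inv c (?y0 + s *\<^sub>R (?y0 - ?y0))) (?y0 - ?y0) (z ?y0 s)) \<le> 0" for s
      using linear_0[OF christoffel_linear1[OF c q]] by (simp add: c q)
  qed auto
  then have zy0: "z ?y0 1 = u" using z0[OF y0B] by simp
  have tr: "transports (?g y) (E c (chart_inv c y) u) (E c q (z y 1))" if y: "y \<in> ?B" for y
  proof -
    have "V y 1 \<in> T (?g y 1)"
      using chain_parallel_tangent(2)[OF chain.base[of 0 1 "parallel_piece (?g y) (V y)", OF zero_less_one V(1)[OF y]]] .
    then have "E c q (z y 1) = V y 1" unfolding z_def using tangent_eq_coord_vec[OF _ c q] by (simp add: c q)
    then show ?thesis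
      unfolding transports_def using chain.base[of 0 1 "parallel_piece (?g y) (V y)", OF zero_less_one V(1)[OF y]] V(2)[OF y]
      by (intro exI[of _ "V y"]) simp
  qed
  show ?thesis by (rule that[OF tr d zy0])
qed

text \<open>
  By invariance the components of \<open>\<omega>\<close> at \<open>y\<close> are the values of the fixed trilinear form \<open>\<omega> q\<close> on
  coordinate vectors transported from \<open>y\<close> to \<open>q\<close>, and the derivative of the latter is known.
\<close>

lemma transport_invariant_imp_parallel:
  assumes alt: "\<And>p. alt3_at \<A> p (\<omega> p)"
    and inv: "\<And>p q \<gamma> v1 v2 v3 w1 w2 w3. pw_path p q \<gamma> \<Longrightarrow> transports \<gamma> v1 w1 \<Longrightarrow> transports \<gamma> v2 w2 \<Longrightarrow> transports \<gamma> v3 w3 \<Longrightarrow>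
      \<omega> p v1 v2 v3 = \<omega> q w1 w2 w3"
  shows "parallel_components \<omega>"
  unfolding parallel_components_def
proof (intro ballI allI)
  fix c q u v w assume c: "c \<in> \<A>" and q: "q \<in> dom_chart c"
  obtain R where R: "R > 0" "ball (coord c q) R \<subseteq> coord c ` dom_chart c" by (rule chart_ball[OF c q])
  let ?y0 = "coord c q" and ?g = "\<lambda>y s. chart_inv c (y + s *\<^sub>R (coord c q - y))"
  obtain Zu where Zu: "\<And>y. y \<in> ball ?y0 R \<Longrightarrow> transports (?g y) (E c (chart_inv c y) u) (E c q (Zu y))"
    "(Zu has_derivative (\<lambda>x. \<Gamma> c q x u)) (at ?y0)" "Zu ?y0 = u"
    by (rule parallel_along_segments[OF c q R]) (rule that)
  obtain Zv where Zv: "\<And>y. y \<in> ball ?y0 R \<Longrightarrow> transports (?g y) (E c (chart_inv c y) v) (E c q (Zv y))"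
    "(Zv has_derivative (\<lambda>x. \<Gamma> c q x v)) (at ?y0)" "Zv ?y0 = v"
    by (rule parallel_along_segments[OF c q R]) (rule that)
  obtain Zw where Zw: "\<And>y. y \<in> ball ?y0 R \<Longrightarrow> transports (?g y) (E c (chart_inv c y) w) (E c q (Zw y))"
    "(Zw has_derivative (\<lambda>x. \<Gamma> c q x w)) (at ?y0)" "Zw ?y0 = w"
    by (rule parallel_along_segments[OF c q R]) (rule that)
  have y0: "?y0 \<in> ball ?y0 R" using R(1) by simp
  note l = comp_linear1[where \<omega> = \<omega>, OF alt c q] comp_linear2[where \<omega> = \<omega>, OF alt c q] comp_linear3[where \<omega> = \<omega>, OF alt c q]
  have ev: "\<forall>\<^sub>F s in at ?y0. P" if P for P using that by simp
  have d0: "((\<lambda>y. comp \<omega> c q a b e) has_derivative (\<lambda>x. 0)) (at ?y0)" for a b e by (rule has_derivative_const)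
  have d1: "((\<lambda>y. comp \<omega> c q (Zu y) b e) has_derivative (\<lambda>x. 0 + comp \<omega> c q (\<Gamma> c q x u) b e)) (at ?y0)" for b e
    by (rule has_derivative_apply_linear[where L = "\<lambda>s a. comp \<omega> c q a b e", OF UNIV_I ev[OF l(1)] l(1) d0 Zu(2)])
  have d2: "((\<lambda>y. comp \<omega> c q (Zu y) (Zv y) e) has_derivative
      (\<lambda>x. (0 + comp \<omega> c q (\<Gamma> c q x u) (Zv ?y0) e) + comp \<omega> c q (Zu ?y0) (\<Gamma> c q x v) e)) (at ?y0)" for e
    by (rule has_derivative_apply_linear[where L = "\<lambda>s b. comp \<omega> c q (Zu s) b e", OF UNIV_I always_eventually[OF allI[OF l(2)]] l(2) d1 Zv(2)])
  have d3: "((\<lambda>y. comp \<omega> c q (Zu y) (Zv y) (Zw y)) has_derivative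
      (\<lambda>x. ((0 + comp \<omega> c q (\<Gamma> c q x u) (Zv ?y0) (Zw ?y0)) + comp \<omega> c q (Zu ?y0) (\<Gamma> c q x v) (Zw ?y0))
        + comp \<omega> c q (Zu ?y0) (Zv ?y0) (\<Gamma> c q x w))) (at ?y0)"
    by (rule has_derivative_apply_linear[where L = "\<lambda>s e. comp \<omega> c q (Zu s) (Zv s) e", OF UNIV_I always_eventually[OF allI[OF l(3)]] l(3) d2 Zw(2)])
  have d4: "((\<lambda>y. comp \<omega> c (chart_inv c y) u v w) has_derivative
      (\<lambda>x. ((0 + comp \<omega> c q (\<Gamma> c q x u) (Zv ?y0) (Zw ?y0)) + comp \<omega> c q (Zu ?y0) (\<Gamma> c q x v) (Zw ?y0))
        + comp \<omega> c q (Zu ?y0) (Zv ?y0) (\<Gamma> c q x w))) (at ?y0)"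
  proof (rule has_derivative_transform_within_open[OF d3 open_ball y0])
    fix y assume y: "y \<in> ball ?y0 R"
    have "pw_path (chart_inv c y) q (?g y)" using pw_path_segment[OF c R(2) y y0] by (simp only: chart_inv_coord[OF c q])
    from inv[OF this Zu(1)[OF y] Zv(1)[OF y] Zw(1)[OF y]]
    show "comp \<omega> c q (Zu y) (Zv y) (Zw y) = comp \<omega> c (chart_inv c y) u v w" by simp
  qed
  show "((\<lambda>y. comp \<omega> c (chart_inv c y) u v w) has_derivative
      (\<lambda>x. comp \<omega> c q (\<Gamma> c q x u) v w + comp \<omega> c q u (\<Gamma> c q x v) w + comp \<omega> c q u v (\<Gamma> c q x w)))
     (at (coord c q))"
    by (rule has_derivative_eq_rhs[OF d4]) (simp only: Zu(3) Zv(3) Zw(3) add_0_left)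
qed

text \<open>
  The partial derivatives of the components are combinations of the components themselves, with
  smooth coefficients; so each order of differentiability gives the next one.
\<close>

lemma parallel_components_smooth:
  assumes alt: "\<And>p. alt3_at \<A> p (\<omega> p)" and par: "parallel_components \<omega>"
  shows "smooth_form3 \<A> \<omega>"
  unfolding smooth_form3_def Let_def
proof (intro conjI ballI allI alt)
  fix c u v w assume c: "c \<in> \<A>"
  let ?S = "coord c ` dom_chart c" and ?F = "\<lambda>u v w y. comp \<omega> c (chart_inv c y) u v w"
  have o: "open ?S" by (rule coord_image_open'[OF c])
  have dom: "chart_inv c y \<in> dom_chart c" if "y \<in> ?S" for y by (rule chart_inv_in[OF c order_refl that])
  have d: "(?F u v w has_derivative (\<lambda>x. ?F (\<Gamma> c (chart_inv c y) x u) v w y + ?F u (\<Gamma> c (chart_inv c y) x v) w y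
      + ?F u v (\<Gamma> c (chart_inv c y) x w) y)) (at y)" if y: "y \<in> ?S" for u v w y
    using par[unfolded parallel_components_def, rule_format, OF c dom[OF y], of u v w]
    unfolding coord_chart_inv[OF c y] .
  let ?G = "\<lambda>y x u i. \<Gamma> c (chart_inv c y) x u $ i"
  have d': "(?F u v w has_derivative (\<lambda>x. (\<Sum>i\<in>UNIV. ?G y x u i *\<^sub>R ?F (axis i 1) v w y) + (\<Sum>i\<in>UNIV. ?G y x v i *\<^sub>R ?F u (axis i 1) w y)
      + (\<Sum>i\<in>UNIV. ?G y x w i *\<^sub>R ?F u v (axis i 1) y))) (at y)" if y: "y \<in> ?S" for u v w y
    by (rule has_derivative_eq_rhs[OF d[OF y]])
      (simp only: linear_vec_expand[OF comp_linear1[where \<omega> = \<omega>, OF alt c dom[OF y]], symmetric]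
        linear_vec_expand[OF comp_linear2[where \<omega> = \<omega>, OF alt c dom[OF y]], symmetric]
        linear_vec_expand[OF comp_linear3[where \<omega> = \<omega>, OF alt c dom[OF y]], symmetric])
  have "\<forall>u v w. Ck_on k ?S (?F u v w)" for k
  proof (induction k)
    case 0
    show ?case unfolding Ck_on.simps
      by (intro allI continuous_at_imp_continuous_on ballI has_derivative_continuous[OF d'])
  next
    case (Suc k)
    have Gk: "Ck_on k ?S (\<lambda>y. ?G y x u i)" for x u i
      using smooth_on_nth[OF o christoffel_smooth[OF c]] unfolding smooth_on_def by blast
    have Fk: "Ck_on k ?S (?F u v w)" for u v w using Suc.IH by blast
    show ?case
      by (intro allI Ck_on_SucI[OF o d'] Ck_on_add[OF o] Ck_on_sum[OF o] Ck_on_bilinear[OF bounded_bilinear_scaleR o] Gk Fk)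
  qed
  then show "smooth_on ?S (?F u v w)" unfolding smooth_on_def by blast
qed

text \<open>
  Choose a curve \<open>g q\<close> from \<open>p\<close> to every point \<open>q\<close>, transport \<open>f\<close> along it to a frame \<open>F q\<close>, and let
  \<open>\<psi>\<close> be the pullback of \<open>\<phi>\<^sub>0\<close> by \<open>F q\<close>, changed by \<open>h\<close>. Another curve to \<open>q\<close> differs from \<open>g q\<close> by a
  loop at \<open>p\<close>, whose holonomy is conjugated by \<open>h\<close> into \<open>G\<^sub>2\<close>; so the choice is immaterial, and
  \<open>\<psi>\<close> is invariant under transport along all curves.
\<close>

lemma holonomy_invariant_form_exists:
  assumes conn: "connected (UNIV :: 'a set)"
    and alt: "\<And>p. alt3_at \<A> p (\<omega> p)" and par: "parallel_components \<omega>"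
    and fr: "\<And>q. \<exists>F. frame \<A> q F \<and> \<omega> q = pullback_\<phi>\<^sub>0 \<A> q F"
    and f: "frame \<A> p f" "\<omega> p = pullback_\<phi>\<^sub>0 \<A> p f"
    and h: "invertible h" and hol: "\<And>k. k \<in> holonomy_group \<A> D p f \<Longrightarrow> matrix_inv h ** k ** h \<in> G2"
  shows "\<exists>\<psi>. (\<forall>q. alt3_at \<A> q (\<psi> q)) \<and> parallel_components \<psi> \<and> \<psi> p = pullback_\<phi>\<^sub>0 \<A> p (frame_act f h)
    \<and> (\<forall>q. \<exists>F. frame \<A> q F \<and> \<omega> q = pullback_\<phi>\<^sub>0 \<A> q F \<and> \<psi> q = pullback_\<phi>\<^sub>0 \<A> q (frame_act F h))"
proof -
  obtain g where g: "\<And>q. pw_path p q (g q)" using pw_path_exists[OF conn, of p] by metis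
  have "\<exists>F. frame \<A> q F \<and> \<omega> q = pullback_\<phi>\<^sub>0 \<A> q F \<and> (\<forall>v w. transports (g q) v w \<longrightarrow> F w = f v)" for q
  proof -
    obtain G where G: "frame \<A> q G" "\<omega> q = pullback_\<phi>\<^sub>0 \<A> q G" using fr by blast
    obtain k where k: "k \<in> G2" "\<forall>v w. transports (g q) v w \<longleftrightarrow> v \<in> T p \<and> w \<in> T q \<and> G w = k *v f v"
      using transport_G2[where \<omega> = \<omega>, OF alt par f G g] by blast
    show ?thesis
    proof (intro exI[of _ "frame_act G k"] conjI allI impI)
      show "frame \<A> q (frame_act G k)" by (rule frame_act_frame[OF G(1) G2_invertible[OF k(1)]])
      show "\<omega> q = pullback_\<phi>\<^sub>0 \<A> q (frame_act G k)" using G(2) pullback_G2[OF k(1)] by simp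
      fix v w assume "transports (g q) v w"
      then have "G w = k *v f v" using k(2) by blast
      then show "frame_act G k w = f v" by (simp add: frame_act_def matrix_inv_cancel[OF G2_invertible[OF k(1)]])
    qed
  qed
  then obtain F where F: "\<And>q. frame \<A> q (F q)" "\<And>q. \<omega> q = pullback_\<phi>\<^sub>0 \<A> q (F q)"
    "\<And>q v w. transports (g q) v w \<Longrightarrow> F q w = f v" by metis
  define \<psi> where "\<psi> q = pullback_\<phi>\<^sub>0 \<A> q (frame_act (F q) h)" for q
  let ?f = "\<lambda>v. matrix_inv h *v f v"
  have alt\<psi>: "alt3_at \<A> q (\<psi> q)" for q
    unfolding \<psi>_def by (rule pullback_alt3[OF frame_act_frame[OF F(1) h]])
  \<comment> \<open>close the curve to a loop by the reverse of \<open>g q\<close>\<close>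
  have claim1: "\<psi> q w1 w2 w3 = \<phi>\<^sub>0 (?f v1) (?f v2) (?f v3)"
    if path: "pw_path p q \<gamma>" and t: "transports \<gamma> v1 w1" "transports \<gamma> v2 w2" "transports \<gamma> v3 w3" for q \<gamma> v1 v2 v3 w1 w2 w3
  proof -
    obtain g' where g': "pw_path q p g'" "\<forall>v w. transports g' w v \<longleftrightarrow> transports (g q) v w"
      using pw_path_reverse[OF g[of q]] by (elim exE conjE)
    obtain \<delta> where \<delta>: "pw_path p p \<delta>" "\<forall>u v w. transports \<gamma> u v \<longrightarrow> transports g' v w \<longrightarrow> transports \<delta> u w"
      using pw_path_join[OF path g'(1)] by (elim exE conjE)
    obtain k where k: "\<forall>v w. transports \<delta> v w \<longleftrightarrow> v \<in> T p \<and> w \<in> T p \<and> f w = k *v f v"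
      using transport_G2[where \<omega> = \<omega>, OF alt par f f \<delta>(1)] by blast
    have khol: "k \<in> holonomy_group \<A> D p f" by (rule holonomy_groupI[OF f(1) \<delta>(1) k[rule_format]])
    let ?k = "matrix_inv h ** k ** h"
    \<comment> \<open>\<open>k\<close> is the holonomy of the loop \<open>\<delta>\<close>\<close>
    have one: "w \<in> T q \<and> matrix_inv h *v F q w = ?k *v ?f v" if vw: "transports \<gamma> v w" for v w
    proof -
      have w: "w \<in> T q" by (rule transports_tangent(2)[OF path vw])
      obtain u where u: "transports g' w u" using transports_exists[OF g'(1) w] by blast
      then have "F q w = f u" using F(3) g'(2) by blast
      moreover have "f u = k *v f v" using \<delta>(2) vw u k by blast
      ultimately have "matrix_inv h *v F q w = ?k *v ?f v"
        by (simp add: matrix_vector_mul_assoc[symmetric] matrix_inv_cancel[OF h])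
      then show ?thesis using w by blast
    qed
    have "\<psi> q w1 w2 w3 = \<phi>\<^sub>0 (matrix_inv h *v F q w1) (matrix_inv h *v F q w2) (matrix_inv h *v F q w3)"
      unfolding \<psi>_def using one[OF t(1)] one[OF t(2)] one[OF t(3)] by (simp add: pullback_apply frame_act_def)
    also have "\<dots> = \<phi>\<^sub>0 (?k *v ?f v1) (?k *v ?f v2) (?k *v ?f v3)"
      using one[OF t(1)] one[OF t(2)] one[OF t(3)] by (simp only:)
    also have "\<dots> = \<phi>\<^sub>0 (?f v1) (?f v2) (?f v3)" by (rule G2_phi0[OF hol[OF khol]])
    finally show ?thesis .
  qed
  have claim2: "\<psi> q1 v1 v2 v3 = \<psi> q2 w1 w2 w3"
    if path: "pw_path q1 q2 \<gamma>" and t: "transports \<gamma> v1 w1" "transports \<gamma> v2 w2" "transports \<gamma> v3 w3" for q1 q2 \<gamma> v1 v2 v3 w1 w2 w3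
  proof -
    obtain g' where g': "pw_path q1 p g'" "\<forall>v w. transports g' w v \<longleftrightarrow> transports (g q1) v w"
      using pw_path_reverse[OF g[of q1]] by (elim exE conjE)
    obtain \<delta> where \<delta>: "pw_path p q2 \<delta>" "\<forall>u v w. transports (g q1) u v \<longrightarrow> transports \<gamma> v w \<longrightarrow> transports \<delta> u w"
      using pw_path_join[OF g[of q1] path] by (elim exE conjE)
    have "\<exists>u. transports (g q1) u v" if "transports \<gamma> v w" for v w
      using transports_exists[OF g'(1) transports_tangent(1)[OF path that]] g'(2) by blast
    then obtain u1 u2 u3 where u: "transports (g q1) u1 v1" "transports (g q1) u2 v2" "transports (g q1) u3 v3"
      using t by meson
    have t': "transports \<delta> u1 w1" "transports \<delta> u2 w2" "transports \<delta> u3 w3" using \<delta>(2) u t by blast+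
    show ?thesis using claim1[OF g u] claim1[OF \<delta>(1) t'] by simp
  qed
  have par\<psi>: "parallel_components \<psi>" by (rule transport_invariant_imp_parallel[OF alt\<psi> claim2])
  have \<psi>p: "\<psi> p = pullback_\<phi>\<^sub>0 \<A> p (frame_act f h)"
  proof (intro ext)
    fix v1 v2 v3
    show "\<psi> p v1 v2 v3 = pullback_\<phi>\<^sub>0 \<A> p (frame_act f h) v1 v2 v3"
    proof (cases "v1 \<in> T p \<and> v2 \<in> T p \<and> v3 \<in> T p")
      case True
      obtain w1 where w1: "transports (g p) v1 w1" using transports_exists[OF g] True by blast
      obtain w2 where w2: "transports (g p) v2 w2" using transports_exists[OF g] True by blast
      obtain w3 where w3: "transports (g p) v3 w3" using transports_exists[OF g] True by blast
      show ?thesis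
        using claim1[OF g w1 w2 w3] claim2[OF g w1 w2 w3] True by (simp add: pullback_apply frame_act_def)
    next
      case False
      show ?thesis unfolding \<psi>_def pullback_outside[OF False] ..
    qed
  qed
  show ?thesis
  proof (intro exI[of _ \<psi>] conjI allI alt\<psi> par\<psi> \<psi>p)
    fix q
    show "\<exists>F. frame \<A> q F \<and> \<omega> q = pullback_\<phi>\<^sub>0 \<A> q F \<and> \<psi> q = pullback_\<phi>\<^sub>0 \<A> q (frame_act F h)"
      by (intro exI[of _ "F q"] conjI F \<psi>_def)
  qed
qed

end

section \<open>Smooth adapted frames\<close>

context smooth_manifold
begin

lemma frame_compose:
  assumes "frame \<A> p f" "invertible A" shows "frame \<A> p (\<lambda>v. A *v f v)"
proof -
  have "matrix_inv (matrix_inv A) = A"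
    by (rule matrix_inv_eqI) (rule matrix_inv_both(2)[OF assms(2)])
  then show ?thesis
    using frame_act_frame[OF assms(1) invertible_matrix_inv[OF assms(2)]] by (simp add: frame_act_def)
qed

text \<open>
  Both frames are bijective, so \<open>f v \<mapsto> f' v\<close> is a relation as in \<open>phi0_relation\<close>.
\<close>

lemma adapted_frames_G2:
  assumes f: "frame \<A> p f" and f': "frame \<A> p f'" and eq: "pullback_\<phi>\<^sub>0 \<A> p f = pullback_\<phi>\<^sub>0 \<A> p f'"
  shows "\<exists>k\<in>G2. \<forall>v\<in>T p. f' v = k *v f v"
proof -
  have "\<exists>k\<in>G2. \<forall>x y. (\<exists>v. v \<in> T p \<and> x = f v \<and> y = f' v) \<longleftrightarrow> y = k *v x"
  proof (rule phi0_relation)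
    show "\<exists>y v. v \<in> T p \<and> x = f v \<and> y = f' v" for x using frame_surj[OF f, of x] by blast
    show "\<exists>x v. v \<in> T p \<and> x = f v \<and> y = f' v" for y using frame_surj[OF f', of y] by blast
    fix x1 x2 x3 y1 y2 y3
    assume "\<exists>v. v \<in> T p \<and> x1 = f v \<and> y1 = f' v" "\<exists>v. v \<in> T p \<and> x2 = f v \<and> y2 = f' v" "\<exists>v. v \<in> T p \<and> x3 = f v \<and> y3 = f' v"
    then obtain v1 v2 v3 where v: "v1 \<in> T p" "v2 \<in> T p" "v3 \<in> T p"
      and xy: "x1 = f v1" "y1 = f' v1" "x2 = f v2" "y2 = f' v2" "x3 = f v3" "y3 = f' v3" by (elim exE conjE)
    show "\<phi>\<^sub>0 x1 x2 x3 = \<phi>\<^sub>0 y1 y2 y3"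
      using fun_cong[OF fun_cong[OF fun_cong[OF eq, of v1], of v2], of v3] unfolding xy pullback_apply[OF v] .
  qed
  then show ?thesis by blast
qed

text \<open>
  By Cramer's rule the components are quotients of determinants of smooth matrices.
\<close>

lemma frame_inverse_smooth:
  assumes F: "smooth_frame \<A> W F" and c: "c \<in> \<A>" "W \<subseteq> dom_chart c"
  shows "smooth_on (coord c ` W) (\<lambda>y. inv_into (T (chart_inv c y)) (F (chart_inv c y)) u c)"
proof -
  let ?S = "coord c ` W" and ?B = "\<lambda>y. inv_into (T (chart_inv c y)) (F (chart_inv c y)) u c"
  have W: "open W" and fr: "\<And>q. q \<in> W \<Longrightarrow> frame \<A> q (F q)" using F by (auto simp: smooth_frame_def)
  have o: "open ?S" by (rule coord_image_open[OF c(1) W c(2)])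
  define L where "L y v = F (chart_inv c y) (E c (chart_inv c y) v)" for y v
  have Lsm: "smooth_on ?S (\<lambda>y. L y v)" for v
  proof -
    have Wc: "W \<inter> dom_chart c = W" using c(2) by blast
    have "smooth_on (coord c ` (W \<inter> dom_chart c)) (\<lambda>y. F (chart_inv c y) (E c (chart_inv c y) v))"
      using F c(1) unfolding smooth_frame_def by blast
    then show ?thesis unfolding L_def Wc .
  qed
  have inW: "chart_inv c y \<in> W" "chart_inv c y \<in> dom_chart c" if "y \<in> ?S" for y
    using chart_inv_in[OF c that] c(2) by auto
  have lin: "linear (L y)" if y: "y \<in> ?S" for y
  proof (rule linearI)
    note q = inW[OF y]
    show "L y (v + w) = L y v + L y w" for v w
      unfolding L_def linear_add[OF linear_coord_vec[OF c(1) q(2)]]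
      by (rule frame_add[OF fr[OF q(1)] coord_vec_tangent[OF c(1) q(2)] coord_vec_tangent[OF c(1) q(2)]])
    show "L y (a *\<^sub>R v) = a *\<^sub>R L y v" for a v
      unfolding L_def linear_scale[OF linear_coord_vec[OF c(1) q(2)]]
      by (rule frame_scale[OF fr[OF q(1)] coord_vec_tangent[OF c(1) q(2)]])
  qed
  define A where "A y = matrix (L y)" for y
  have A: "A y *v v = L y v" if "y \<in> ?S" for y v
    unfolding A_def using matrix_vector_mul(2)[OF lin[OF that]] by (rule fun_cong)
  have AB: "A y *v ?B y = u" if y: "y \<in> ?S" for y
  proof -
    note q = inW[OF y]
    show ?thesis
      unfolding A[OF y] L_def tangent_eq_coord_vec[OF frame_inv(1)[OF fr[OF q(1)]] c(1) q(2)]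
      by (rule frame_inv(2)[OF fr[OF q(1)]])
  qed
  have detA: "det (A y) \<noteq> 0" if y: "y \<in> ?S" for y
  proof -
    note q = inW[OF y]
    have "inj (L y)"
    proof (rule injI)
      fix v w assume "L y v = L y w"
      then have "E c (chart_inv c y) v = E c (chart_inv c y) w"
        unfolding L_def by (rule frame_inj[OF fr[OF q(1)] coord_vec_tangent[OF c(1) q(2)] coord_vec_tangent[OF c(1) q(2)]])
      then have "E c (chart_inv c y) v c = E c (chart_inv c y) w c" by (rule fun_cong)
      then show "v = w" by (simp only: coord_vec_self[OF c(1) q(2)])
    qed
    moreover have "surj (L y)" by (rule linear_injective_imp_surjective[OF lin[OF y] \<open>inj (L y)\<close>]) (rule refl)
    moreover have "(*v) (A y) = L y" using A[OF y] by (rule ext)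
    ultimately have "invertible (A y)" unfolding invertible_eq_bij by (simp add: bij_def)
    then show ?thesis by (simp add: invertible_det_nz)
  qed
  define C where "C y k = (\<chi> i j. if j = k then u $ i else A y $ i $ j)" for y k
  have Asm: "smooth_on ?S (\<lambda>y. A y $ i $ j)" for i j
    unfolding A_def matrix_def using smooth_on_nth[OF o Lsm[of "axis j 1"], of i] by simp
  have Csm: "smooth_on ?S (\<lambda>y. C y k $ i $ j)" for k i j
    unfolding C_def using Asm[of i j] smooth_on_const[OF o] by (cases "j = k") simp_all
  have Bk: "?B y $ k = det (C y k) / det (A y)" if "y \<in> ?S" for y k
    using cramer[OF detA[OF that], of "?B y" u] AB[OF that] unfolding C_def by (simp add: vec_eq_iff)
  show ?thesis
  proof (rule smooth_on_vecI[OF o])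
    fix k
    have "smooth_on ?S (\<lambda>y. det (C y k) / det (A y))"
      by (rule smooth_on_divide[OF o smooth_on_det[OF o Csm] smooth_on_det[OF o Asm] detA])
    then show "smooth_on ?S (\<lambda>y. ?B y $ k)"
      by (subst smooth_on_cong[OF o, of _ "\<lambda>y. det (C y k) / det (A y)"]) (rule Bk)
  qed
qed

end

context smooth_connection
begin

text \<open>
  In the smooth frame \<open>F0\<close> the form \<open>\<psi>\<close> is a rotated \<open>\<phi>\<^sub>0\<close>, by an orthogonal matrix \<open>m q\<close> that need
  not depend on \<open>q\<close> in a smooth or even continuous way. The cross product \<open>X q\<close> of \<open>\<psi>\<close> is smooth, however, and
  so is everything built from it. Constant orthonormal vectors \<open>a, b\<close> and a third vector, corrected
  to be a unit vector orthogonal to \<open>a\<close>, \<open>b\<close> and \<open>X q a b\<close>, generate a \<open>G\<^sub>2\<close>-basis \<open>K q\<close> for \<open>\<psi>\<close>. Since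
  \<open>K q\<close> is orthonormal, taking inner products with it gives the coordinates of an adapted frame.
\<close>

lemma smooth_adapted_frame_exists:
  assumes \<psi>: "smooth_form3 \<A> \<psi>" and F0: "smooth_frame \<A> W0 F0" and p: "p \<in> W0"
    and ex: "\<And>q. q \<in> W0 \<Longrightarrow> \<exists>m. orthogonal_matrix m \<and> \<psi> q = pullback_\<phi>\<^sub>0 \<A> q (\<lambda>v. m *v F0 q v)"
  shows "\<exists>W F. p \<in> W \<and> smooth_frame \<A> W F \<and> (\<forall>q\<in>W. adapted_frame \<A> \<psi> q (F q))"
proof -
  obtain c where c: "c \<in> \<A>" "p \<in> dom_chart c" by (rule chart_cover)
  define W where "W = W0 \<inter> dom_chart c"
  have W0: "open W0" and fr0: "\<And>q. q \<in> W0 \<Longrightarrow> frame \<A> q (F0 q)" using F0 by (auto simp: smooth_frame_def)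
  have W: "open W" "W \<subseteq> dom_chart c" "W \<subseteq> W0" "p \<in> W" using W0 c p by (auto simp: W_def)
  have FW: "smooth_frame \<A> W F0" unfolding smooth_frame_def
  proof (intro conjI ballI allI W(1))
    show "frame \<A> q (F0 q)" if "q \<in> W" for q using fr0 W(3) that by blast
    fix c' v assume "c' \<in> \<A>"
    then have "smooth_on (coord c' ` (W0 \<inter> dom_chart c')) (\<lambda>y. F0 (chart_inv c' y) (coord_vec \<A> c' (chart_inv c' y) v))"
      using F0 unfolding smooth_frame_def by blast
    then show "smooth_on (coord c' ` (W \<inter> dom_chart c')) (\<lambda>y. F0 (chart_inv c' y) (coord_vec \<A> c' (chart_inv c' y) v))"
      by (rule smooth_on_subset) (use W(3) in blast)
  qed
  let ?S = "coord c ` W"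
  have oS: "open ?S" by (rule coord_image_open[OF c(1) W(1,2)])
  have inW: "chart_inv c y \<in> W" "chart_inv c y \<in> dom_chart c" if "y \<in> ?S" for y
    using chart_inv_in[OF c(1) W(2) that] W(2) by auto
  have fr: "frame \<A> q (F0 q)" if "q \<in> W" for q using fr0 W(3) that by blast
  obtain m where m: "\<And>q. q \<in> W \<Longrightarrow> orthogonal_matrix (m q)" "\<And>q. q \<in> W \<Longrightarrow> \<psi> q = pullback_\<phi>\<^sub>0 \<A> q (\<lambda>v. m q *v F0 q v)"
    using ex W(3) by (metis subsetD)
  note mi = orthogonal_matrix_inner[OF m(1)]
  define \<Phi> where "\<Phi> q u v w = \<psi> q (inv_into (T q) (F0 q) u) (inv_into (T q) (F0 q) v) (inv_into (T q) (F0 q) w)" for q u v w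
  have \<Phi>: "\<Phi> q u v w = \<phi>\<^sub>0 (m q *v u) (m q *v v) (m q *v w)" if q: "q \<in> W" for q u v w
    unfolding \<Phi>_def m(2)[OF q] pullback_apply[OF frame_inv(1)[OF fr[OF q]] frame_inv(1)[OF fr[OF q]] frame_inv(1)[OF fr[OF q]]]
      frame_inv(2)[OF fr[OF q]] ..
  have alt: "alt3_at \<A> q (\<psi> q)" for q using \<psi> by (simp add: smooth_form3_def)
  note mlin = matrix_vector_mul_linear
  have \<Phi>lin: "linear (\<lambda>u. \<Phi> q u v w)" "linear (\<lambda>v. \<Phi> q u v w)" "linear (\<lambda>w. \<Phi> q u v w)" if q: "q \<in> W" for q u v w
    unfolding \<Phi>[OF q]
    using linear_compose[OF mlin[of "m q"] linear_phi0_1[of "m q *v v" "m q *v w"]]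
      linear_compose[OF mlin[of "m q"] linear_phi0_2[of "m q *v u" "m q *v w"]]
      linear_compose[OF mlin[of "m q"] linear_phi0_3[of "m q *v u" "m q *v v"]]
    by (simp_all only: o_def)
  have csm: "smooth_on ?S (\<lambda>y. \<psi> (chart_inv c y) (E c (chart_inv c y) u) (E c (chart_inv c y) v) (E c (chart_inv c y) w))" for u v w
  proof (rule smooth_on_subset)
    show "smooth_on (coord c ` dom_chart c) (\<lambda>y. \<psi> (chart_inv c y) (E c (chart_inv c y) u) (E c (chart_inv c y) v) (E c (chart_inv c y) w))"
      using \<psi> c(1) unfolding smooth_form3_def Let_def by blast
  qed (use W(2) in blast)
  have Bsm: "smooth_on ?S (\<lambda>y. inv_into (T (chart_inv c y)) (F0 (chart_inv c y)) u c)" for u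
    by (rule frame_inverse_smooth[OF FW c(1) W(2)])
  have \<psi>lin: "linear (\<lambda>u. \<psi> q (E c q u) v w)" "linear (\<lambda>u. \<psi> q v (E c q u) w)" "linear (\<lambda>u. \<psi> q v w (E c q u))"
    if q: "q \<in> dom_chart c" and vw: "v \<in> T q" "w \<in> T q" for q v w
  proof -
    note t = coord_vec_tangent[OF c(1) q]
    have sw: "\<psi> q v u w = - \<psi> q u v w" "\<psi> q v w u = \<psi> q u v w" if u: "u \<in> T q" for u
      using alt3_swap(1)[OF alt u vw] alt3_swap(2)[OF alt vw(1) u vw(2)] by auto
    note l = linear_add[OF linear_coord_vec[OF c(1) q]] linear_scale[OF linear_coord_vec[OF c(1) q]]
    show 1: "linear (\<lambda>u. \<psi> q (E c q u) v w)"
      by (rule linearI) (simp_all only: l alt3_add_scale[OF alt t t vw] real_scaleR_def)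
    show "linear (\<lambda>u. \<psi> q v (E c q u) w)"
      using linear_compose_neg[OF 1] by (simp only: sw(1)[OF t])
    show "linear (\<lambda>u. \<psi> q v w (E c q u))" using 1 by (simp only: sw(2)[OF t])
  qed
  have \<Phi>sm0: "smooth_on ?S (\<lambda>y. \<Phi> (chart_inv c y) u v w)" for u v w
  proof -
    let ?b = "\<lambda>u y. inv_into (T (chart_inv c y)) (F0 (chart_inv c y)) u c"
    let ?C = "\<lambda>y u v w. \<psi> (chart_inv c y) (E c (chart_inv c y) u) (E c (chart_inv c y) v) (E c (chart_inv c y) w)"
    have 1: "smooth_on ?S (\<lambda>y. ?C y (?b u y) b e)" for b e
      by (rule smooth_on_apply_linear[where L = "\<lambda>y a. ?C y a b e", OF oS \<psi>lin(1) csm Bsm])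
        (use inW(2) coord_vec_tangent[OF c(1)] in blast)+
    have 2: "smooth_on ?S (\<lambda>y. ?C y (?b u y) (?b v y) e)" for e
      by (rule smooth_on_apply_linear[where L = "\<lambda>y b. ?C y (?b u y) b e", OF oS \<psi>lin(2) 1 Bsm])
        (use inW(2) coord_vec_tangent[OF c(1)] in blast)+
    have 3: "smooth_on ?S (\<lambda>y. ?C y (?b u y) (?b v y) (?b w y))"
      by (rule smooth_on_apply_linear[where L = "\<lambda>y e. ?C y (?b u y) (?b v y) e", OF oS \<psi>lin(3) 2 Bsm])
        (use inW(2) coord_vec_tangent[OF c(1)] in blast)+
    have "\<Phi> (chart_inv c y) u v w = ?C y (?b u y) (?b v y) (?b w y)" if y: "y \<in> ?S" for y
      unfolding \<Phi>_def by (simp only: tangent_eq_coord_vec[OF frame_inv(1)[OF fr[OF inW(1)[OF y]]] c(1) inW(2)[OF y]])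
    then show ?thesis using 3 by (subst smooth_on_cong[OF oS])
  qed
  have \<Phi>sm: "smooth_on S2 (\<lambda>y. \<Phi> (chart_inv c y) (u y) (v y) w)"
    if o2: "open S2" "S2 \<subseteq> ?S" and uv: "smooth_on S2 u" "smooth_on S2 v" for S2 u v w
  proof -
    have 1: "smooth_on S2 (\<lambda>y. \<Phi> (chart_inv c y) (u y) b w)" for b
      by (rule smooth_on_apply_linear[where L = "\<lambda>y a. \<Phi> (chart_inv c y) a b w", OF o2(1) \<Phi>lin(1)[OF inW(1)] smooth_on_subset[OF \<Phi>sm0 o2(2)] uv(1)])
        (use o2(2) in blast)
    show ?thesis
      by (rule smooth_on_apply_linear[where L = "\<lambda>y b. \<Phi> (chart_inv c y) (u y) b w", OF o2(1) \<Phi>lin(2)[OF inW(1)] 1 uv(2)])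
        (use o2(2) in blast)
  qed
  define X where "X q u v = (\<chi> i. \<Phi> q u v (axis i 1))" for q u v
  have Xsm: "smooth_on S2 (\<lambda>y. X (chart_inv c y) (u y) (v y))"
    if "open S2" "S2 \<subseteq> ?S" "smooth_on S2 u" "smooth_on S2 v" for S2 u v
    by (rule smooth_on_vecI[OF that(1)]) (simp add: X_def \<Phi>sm[OF that])
  have Xin: "X q u v \<bullet> w = \<Phi> q u v w" if q: "q \<in> W" for q u v w
    using linear_vec_expand[OF \<Phi>lin(3)[OF q], of u v w] by (simp add: X_def inner_vec_def mult.commute)
  have mX: "m q *v X q u v = cross7 (m q *v u) (m q *v v)" if q: "q \<in> W" for q u v
  proof (rule vector_eq_rdot[THEN iffD1, rule_format])
    fix z
    obtain w where w: "z = m q *v w" using orthogonal_matrix_surj[OF m(1)[OF q]] by metis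
    show "(m q *v X q u v) \<bullet> z = cross7 (m q *v u) (m q *v v) \<bullet> z"
      unfolding w mi[OF q] Xin[OF q] \<Phi>[OF q] by (rule phi0_eq_cross7)
  qed
  \<comment> \<open>at \<open>p\<close> these correspond to the basis vectors 1, 2, 4, so the third needs no correction there\<close>
  define a b d0 where "a = transpose (m p) *v axis 1 1" and "b = transpose (m p) *v axis 2 1" and "d0 = transpose (m p) *v axis 4 1"
  have mt: "m p *v (transpose (m p) *v x) = x" for x
    using matrix_inv_cancel(2)[OF orthogonal_matrix_invertible[OF m(1)[OF W(4)]]] orthogonal_matrix_inv[OF m(1)[OF W(4)]] by simp
  have mabd: "m p *v a = axis 1 1" "m p *v b = axis 2 1" "m p *v d0 = axis 4 1" unfolding a_def b_def d0_def by (simp_all only: mt)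
  have abd: "a \<bullet> a = 1" "b \<bullet> b = 1" "d0 \<bullet> d0 = 1" "a \<bullet> b = 0" "a \<bullet> d0 = 0" "b \<bullet> d0 = 0"
    using mi[OF W(4), of a a] mi[OF W(4), of b b] mi[OF W(4), of d0 d0] mi[OF W(4), of a b] mi[OF W(4), of a d0] mi[OF W(4), of b d0]
    unfolding mabd by (simp_all add: inner_axis_axis)
  \<comment> \<open>\<open>1 - s q * s q\<close> is the squared norm of the part of \<open>d0\<close> orthogonal to the unit vector \<open>X q a b\<close>\<close>
  define s where "s q = \<Phi> q a b d0" for q
  have sp: "s p = 0" unfolding s_def \<Phi>[OF W(4)] mabd phi0_poly by (simp add: axis_def)
  define r where "r q = (1 - s q * s q) powr (- 1 / 2)" for q
  define d where "d q = r q *\<^sub>R (d0 - s q *\<^sub>R X q a b)" for q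
  have ssm: "smooth_on ?S (\<lambda>y. s (chart_inv c y))" unfolding s_def by (rule \<Phi>sm0)
  have s1sm: "smooth_on ?S (\<lambda>y. 1 - s (chart_inv c y) * s (chart_inv c y))"
    by (intro smooth_on_diff[OF oS] smooth_on_const[OF oS] smooth_on_mult[OF oS] ssm)
  define S' where "S' = ?S \<inter> (\<lambda>y. 1 - s (chart_inv c y) * s (chart_inv c y)) -` {0<..}"
  have oS': "open S'" unfolding S'_def
    by (rule continuous_open_preimage[OF smooth_on_imp_continuous_on[OF s1sm] oS open_greaterThan])
  define W' where "W' = dom_chart c \<inter> coord c -` S'"
  have W'o: "open W'" unfolding W'_def by (rule continuous_open_preimage[OF coord_continuous[OF c(1)] chart_open[OF c(1)] oS'])
  have W'c: "W' \<subseteq> dom_chart c" by (simp add: W'_def)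
  have W'W: "q \<in> W \<and> 0 < 1 - s q * s q" if "q \<in> W'" for q
  proof -
    have q: "q \<in> dom_chart c" "coord c q \<in> ?S" "0 < 1 - s (chart_inv c (coord c q)) * s (chart_inv c (coord c q))"
      using that by (auto simp: W'_def S'_def)
    show ?thesis using inW(1)[OF q(2)] q(3) by (simp only: chart_inv_coord[OF c(1) q(1)])
  qed
  have pW': "p \<in> W'" unfolding W'_def S'_def using c W(4) by (simp add: sp)
  have W'S: "coord c ` W' \<subseteq> S'" by (auto simp: W'_def)
  have S'S: "S' \<subseteq> ?S" by (auto simp: S'_def)
  have dsm: "smooth_on S' (\<lambda>y. d (chart_inv c y))"
    unfolding d_def r_def
  proof (intro smooth_on_scaleR[OF oS'] smooth_on_diff[OF oS'] smooth_on_const[OF oS'])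
    show "smooth_on S' (\<lambda>x. (1 - s (chart_inv c x) * s (chart_inv c x)) powr (- 1 / 2))"
      by (rule smooth_on_powr[OF oS' smooth_on_subset[OF s1sm S'S]]) (simp add: S'_def)
    show "smooth_on S' (\<lambda>x. s (chart_inv c x))" by (rule smooth_on_subset[OF ssm S'S])
    show "smooth_on S' (\<lambda>x. X (chart_inv c x) a b)"
      by (intro Xsm[OF oS' S'S] smooth_on_const[OF oS'])
  qed
  define K where "K q i = g2_frame (X q) a b (d q) i" for q i
  have Ksm: "smooth_on S' (\<lambda>y. K (chart_inv c y) i)" for i
  proof -
    note const = smooth_on_const[OF oS'] and Xsm' = Xsm[OF oS' S'S]
    note s = const[of a] const[of b] Xsm'[OF const[of a] const[of b]] dsm Xsm'[OF const[of a] dsm] Xsm'[OF const[of b] dsm]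
      Xsm'[OF const[of a] Xsm'[OF const[of b] dsm]]
    show ?thesis unfolding K_def g2_frame_def
      by (cases "i = 1"; cases "i = 2"; cases "i = 3"; cases "i = 4"; cases "i = 5"; cases "i = 6"; simp add: s)
  qed
  define F where "F q v = (\<chi> i. K q i \<bullet> F0 q v)" for q v
  define \<kappa> where "\<kappa> q = (\<chi> i j. g2_frame cross7 (m q *v a) (m q *v b) (m q *v d q) j $ i)" for q
  have mK: "m q *v K q i = g2_frame cross7 (m q *v a) (m q *v b) (m q *v d q) i" if q: "q \<in> W" for q i
    by (simp add: K_def g2_frame_def mX[OF q])
  have \<kappa>G2: "\<kappa> q \<in> G2" if q': "q \<in> W'" for q
  proof -
    have q: "q \<in> W" and pos: "0 < 1 - s q * s q" using W'W[OF q'] by auto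
    let ?X = "X q a b"
    have Xa: "?X \<bullet> a = 0" "?X \<bullet> b = 0" "?X \<bullet> d0 = s q"
      using cross7_orth(2)[of "m q *v a" "m q *v b"] cross7_orth(2)[of "m q *v b" "m q *v a"] cross7_swap[of "m q *v a" "m q *v b"]
      by (simp_all add: Xin[OF q] \<Phi>[OF q] phi0_eq_cross7 s_def)
    have XX: "?X \<bullet> ?X = 1"
      using mi[OF q, of ?X ?X] cross7_inner[of "m q *v a" "m q *v b" "m q *v b"] unfolding mX[OF q] mi[OF q] by (simp add: abd)
    have rr: "r q * r q * (1 - s q * s q) = 1"
    proof -
      have "r q * r q = (1 - s q * s q) powr (- 1 / 2 + - 1 / 2)" by (simp only: r_def powr_add)
      also have "\<dots> = inverse (1 - s q * s q)" using pos by (simp add: powr_minus)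
      finally show ?thesis using pos by simp
    qed
    have dd: "a \<bullet> d q = 0" "b \<bullet> d q = 0" "?X \<bullet> d q = 0"
      using abd Xa XX by (simp_all add: d_def inner_diff_right inner_commute)
    have "(d0 - s q *\<^sub>R ?X) \<bullet> (d0 - s q *\<^sub>R ?X) = 1 - s q * s q"
      using abd(3) Xa(3) XX inner_commute[of d0 ?X] by (simp add: inner_diff_left inner_diff_right)
    then have "d q \<bullet> d q = r q * r q * (1 - s q * s q)"
      by (simp only: d_def inner_scaleR_left inner_scaleR_right mult.assoc)
    then have dq: "d q \<bullet> d q = 1" using rr by simp
    show ?thesis unfolding \<kappa>_def
    proof (rule g2_frame_in_G2)
      show "cross7 (m q *v a) (m q *v b) \<bullet> (m q *v d q) = 0"
        unfolding mX[OF q, symmetric] mi[OF q] by (rule dd(3))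
    qed (simp_all only: mi[OF q] abd dd dq)
  qed
  have Feq: "F q v = matrix_inv (\<kappa> q) *v (m q *v F0 q v)" if q': "q \<in> W'" for q v
  proof -
    have q: "q \<in> W" using W'W[OF q'] by blast
    have inv: "matrix_inv (\<kappa> q) = transpose (\<kappa> q)" by (rule orthogonal_matrix_inv[OF G2_orthogonal[OF \<kappa>G2[OF q']]])
    have "(transpose (\<kappa> q) *v x) $ i = g2_frame cross7 (m q *v a) (m q *v b) (m q *v d q) i \<bullet> x" for x i
      unfolding matrix_vector_mult_def transpose_def inner_vec_def \<kappa>_def by simp
    then show ?thesis
      unfolding inv vec_eq_iff by (simp add: F_def mK[OF q, symmetric] mi[OF q] del: transpose_matrix_vector)
  qed
  have inv\<kappa>: "invertible (matrix_inv (\<kappa> q))" if "q \<in> W'" for q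
    by (rule invertible_matrix_inv[OF G2_invertible[OF \<kappa>G2[OF that]]])
  have Ffr: "frame \<A> q (F q)" if q': "q \<in> W'" for q
  proof -
    have q: "q \<in> W" using W'W[OF q'] by blast
    have "frame \<A> q (\<lambda>v. matrix_inv (\<kappa> q) *v (m q *v F0 q v))"
      by (rule frame_compose[OF frame_compose[OF fr[OF q] orthogonal_matrix_invertible[OF m(1)[OF q]]] inv\<kappa>[OF q']])
    moreover have "F q = (\<lambda>v. matrix_inv (\<kappa> q) *v (m q *v F0 q v))" using Feq[OF q'] by (rule ext)
    ultimately show ?thesis by simp
  qed
  have "smooth_frame \<A> W' F"
    unfolding smooth_frame_def
  proof (intro conjI ballI allI W'o)
    show "frame \<A> q (F q)" if "q \<in> W'" for q by (rule Ffr[OF that])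
    fix c' v assume c': "c' \<in> \<A>"
    let ?U = "W' \<inter> dom_chart c'"
    have U: "open ?U" "?U \<subseteq> dom_chart c" "?U \<subseteq> dom_chart c'" using W'o W'c c' by auto
    have oU: "open (coord c' ` ?U)" by (rule coord_image_open[OF c' U(1,3)])
    have 1: "smooth_on (coord c' ` ?U) (\<lambda>y. K (chart_inv c' y) i)" for i
      by (rule smooth_on_change_chart[OF U(1) c(1) c' U(2,3)], rule smooth_on_subset[OF Ksm]) (use W'S in blast)
    have 2: "smooth_on (coord c' ` ?U) (\<lambda>y. F0 (chart_inv c' y) (E c' (chart_inv c' y) v))"
    proof (rule smooth_on_subset)
      show "smooth_on (coord c' ` (W \<inter> dom_chart c')) (\<lambda>y. F0 (chart_inv c' y) (E c' (chart_inv c' y) v))"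
        using FW c' unfolding smooth_frame_def by blast
    qed (use W'W in blast)
    show "smooth_on (coord c' ` ?U) (\<lambda>y. F (chart_inv c' y) (E c' (chart_inv c' y) v))"
    proof (rule smooth_on_vecI[OF oU])
      fix i
      show "smooth_on (coord c' ` ?U) (\<lambda>y. F (chart_inv c' y) (E c' (chart_inv c' y) v) $ i)"
        unfolding F_def using smooth_on_bilinear[OF bounded_bilinear_inner oU 1[of i] 2] by simp
    qed
  qed
  moreover have "adapted_frame \<A> \<psi> q (F q)" if q': "q \<in> W'" for q
    unfolding adapted_frame_def
  proof (intro conjI Ffr[OF q'])
    have q: "q \<in> W" using W'W[OF q'] by blast
    show "\<psi> q = pullback_\<phi>\<^sub>0 \<A> q (F q)"
      unfolding m(2)[OF q] by (rule pullback_eqI) (simp add: Feq[OF q'] G2_phi0[OF G2_inv[OF \<kappa>G2[OF q']]])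
  qed
  ultimately show ?thesis using pW' by blast
qed

end

section \<open>Metric, orientation and the Levi-Civita connection\<close>

context smooth_manifold
begin

lemma adapted_frameD: "adapted_frame \<A> \<omega> p f \<Longrightarrow> frame \<A> p f" "adapted_frame \<A> \<omega> p f \<Longrightarrow> \<omega> p = pullback_\<phi>\<^sub>0 \<A> p f"
  by (simp_all add: adapted_frame_def)

text \<open>
  Two adapted frames differ by an element of \<open>G\<^sub>2\<close>, which is orthogonal.
\<close>

lemma G2_metric_adapted:
  assumes f: "adapted_frame \<A> \<omega> p f" and uv: "u \<in> T p" "v \<in> T p"
  shows "G2_metric \<A> \<omega> p u v = f u \<bullet> f v"
proof -
  define f' where "f' = (SOME f. adapted_frame \<A> \<omega> p f)"
  have f': "adapted_frame \<A> \<omega> p f'" unfolding f'_def using f by (rule someI[where P = "adapted_frame \<A> \<omega> p"])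
  have "pullback_\<phi>\<^sub>0 \<A> p f = pullback_\<phi>\<^sub>0 \<A> p f'" using adapted_frameD(2)[OF f] adapted_frameD(2)[OF f'] by simp
  then obtain k where k: "k \<in> G2" "\<forall>v\<in>T p. f' v = k *v f v"
    using adapted_frames_G2[OF adapted_frameD(1)[OF f] adapted_frameD(1)[OF f']] by blast
  have "G2_metric \<A> \<omega> p u v = f' u \<bullet> f' v" by (simp add: G2_metric_def f'_def Let_def)
  also have "\<dots> = f u \<bullet> f v" using k uv orthogonal_matrix_inner[OF G2_orthogonal[OF k(1)]] by simp
  finally show ?thesis .
qed

lemma frame_diff: "frame \<A> p f \<Longrightarrow> u \<in> T p \<Longrightarrow> v \<in> T p \<Longrightarrow> f (u - v) = f u - f v"
  using frame_add[of p f "u - v" v] T_diff[of u p v] by simp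

text \<open>
  Let \<open>t A B C\<close> be the inner product of \<open>D\<^sub>A B - D'\<^sub>A B\<close> with \<open>C\<close>. Vanishing torsion makes it symmetric in
  \<open>A, B\<close> and the metric condition makes it skew in \<open>B, C\<close>, which forces it to vanish.
\<close>

lemma levi_civita_unique:
  assumes lc: "levi_civita \<A> g D" and lc': "levi_civita \<A> g' D'"
    and gg: "\<And>q u v. u \<in> T q \<Longrightarrow> v \<in> T q \<Longrightarrow> g' q u v = g q u v"
    and f: "frame \<A> p f" "\<And>u v. u \<in> T p \<Longrightarrow> v \<in> T p \<Longrightarrow> g p u v = f u \<bullet> f v"
    and Y: "smooth_vf \<A> W Y" and p: "p \<in> W" and X: "X \<in> T p"
  shows "D p X Y = D' p X Y"
proof -
  interpret L: levi_civita \<A> g D by (rule lc)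
  interpret L': levi_civita \<A> g' D' by (rule lc')
  obtain c where c: "c \<in> \<A>" "p \<in> dom_chart c" by (rule chart_cover)
  define V where "V = W \<inter> dom_chart c"
  have V: "open V" "V \<subseteq> W" "V \<subseteq> dom_chart c" "p \<in> V" using smooth_vf_open[OF Y] c p by (auto simp: V_def)
  \<comment> \<open>\<open>f\<close> translates the metric at \<open>p\<close> into the Euclidean inner product\<close>
  define t where "t A B C = (f (D p (A p) B) - f (D' p (A p) B)) \<bullet> f (C p)" for A B C
  have sym: "t A B C = t B A C" if A: "smooth_vf \<A> V A" and B: "smooth_vf \<A> V B" for A B C
  proof -
    note tA = smooth_vf_tangent[OF A V(4)] and tB = smooth_vf_tangent[OF B V(4)]
    have "D p (A p) B - D p (B p) A = D' p (A p) B - D' p (B p) A"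
      using L.torsion_zero[OF A B V(4)] L'.torsion_zero[OF A B V(4)] by simp
    then have "f (D p (A p) B - D p (B p) A) = f (D' p (A p) B - D' p (B p) A)" by simp
    then have "f (D p (A p) B) - f (D p (B p) A) = f (D' p (A p) B) - f (D' p (B p) A)"
      unfolding frame_diff[OF f(1) L.in_tangent_space[OF B V(4) tA] L.in_tangent_space[OF A V(4) tB]]
        frame_diff[OF f(1) L'.in_tangent_space[OF B V(4) tA] L'.in_tangent_space[OF A V(4) tB]] .
    then have "f (D p (A p) B) - f (D' p (A p) B) = f (D p (B p) A) - f (D' p (B p) A)"
      by (simp add: algebra_simps)
    then show ?thesis by (simp add: t_def)
  qed
  have skew: "t A B C = - t A C B" if A: "smooth_vf \<A> V A" and B: "smooth_vf \<A> V B" and C: "smooth_vf \<A> V C" for A B C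
  proof -
    note tA = smooth_vf_tangent[OF A V(4)] and tB = smooth_vf_tangent[OF B V(4)] and tC = smooth_vf_tangent[OF C V(4)]
    note i = L.in_tangent_space[OF B V(4) tA] L.in_tangent_space[OF C V(4) tA]
      L'.in_tangent_space[OF B V(4) tA] L'.in_tangent_space[OF C V(4) tA]
    have "dir_deriv \<A> p (A p) (\<lambda>q. g q (B q) (C q)) = dir_deriv \<A> p (A p) (\<lambda>q. g' q (B q) (C q))"
      by (rule dir_deriv_cong[OF V(1,4)]) (simp add: gg smooth_vf_tangent[OF B] smooth_vf_tangent[OF C])
    then have "g p (D p (A p) B) (C p) + g p (B p) (D p (A p) C) = g' p (D' p (A p) B) (C p) + g' p (B p) (D' p (A p) C)"
      using L.metric[OF B C V(4) tA] L'.metric[OF B C V(4) tA] by simp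
    then show ?thesis
      unfolding gg[OF i(3) tC] gg[OF tB i(4)] f(2)[OF i(3) tC] f(2)[OF tB i(4)] f(2)[OF i(1) tC] f(2)[OF tB i(2)] t_def
      by (simp add: inner_diff_left inner_commute[of "f (B p)"])
  qed
  have zero: "t A B C = 0" if A: "smooth_vf \<A> V A" and B: "smooth_vf \<A> V B" and C: "smooth_vf \<A> V C" for A B C
    using skew[OF A B C] sym[OF A C, of B] skew[OF C A B] sym[OF C B, of A] skew[OF B C A] sym[OF B A, of C] by simp
  note EV = smooth_vf_subset[OF smooth_vf_coord_vec[OF c(1)] V(1,3)]
  note YV = smooth_vf_subset[OF Y V(1,2)]
  have EX: "E c p (X c) = X" by (rule tangent_eq_coord_vec[OF X c])
  have "f (D p X Y) - f (D' p X Y) = 0"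
  proof (rule vector_eq_rdot[THEN iffD1, rule_format])
    fix z
    obtain v where v: "v \<in> T p" "f v = z" using frame_surj[OF f(1)] by blast
    have "t (\<lambda>r. E c r (X c)) Y (\<lambda>r. E c r (v c)) = 0" by (rule zero[OF EV YV EV])
    then show "(f (D p X Y) - f (D' p X Y)) \<bullet> z = 0 \<bullet> z"
      unfolding t_def EX tangent_eq_coord_vec[OF v(1) c] v(2) by simp
  qed
  then show ?thesis
    using frame_inj[OF f(1) L.in_tangent_space[OF Y p X] L'.in_tangent_space[OF Y p X]] by simp
qed

lemma parallel_form3_cong:
  assumes "\<And>W Y p X. smooth_vf \<A> W Y \<Longrightarrow> p \<in> W \<Longrightarrow> X \<in> T p \<Longrightarrow> D p X Y = D' p X Y"
    and "parallel_form3 \<A> D' \<omega>"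
  shows "parallel_form3 \<A> D \<omega>"
  unfolding parallel_form3_def
proof (intro allI impI)
  fix W p X Y1 Y2 Y3
  assume h: "p \<in> W" "X \<in> T p" "smooth_vf \<A> W Y1" "smooth_vf \<A> W Y2" "smooth_vf \<A> W Y3"
  show "dir_deriv \<A> p X (\<lambda>q. \<omega> q (Y1 q) (Y2 q) (Y3 q)) - \<omega> p (D p X Y1) (Y2 p) (Y3 p)
      - \<omega> p (Y1 p) (D p X Y2) (Y3 p) - \<omega> p (Y1 p) (Y2 p) (D p X Y3) = 0"
    unfolding assms(1)[OF h(3,1,2)] assms(1)[OF h(4,1,2)] assms(1)[OF h(5,1,2)]
    by (rule assms(2)[unfolded parallel_form3_def, rule_format, OF h])
qed

lemma frame_quotient_linear:
  assumes f: "frame \<A> p f" and f': "frame \<A> p f'"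
  shows "linear (f \<circ> inv_into (T p) f')"
proof (rule linearI)
  note i = frame_inv[OF f']
  show "(f \<circ> inv_into (T p) f') (x + y) = (f \<circ> inv_into (T p) f') x + (f \<circ> inv_into (T p) f') y" for x y
  proof -
    have "inv_into (T p) f' (x + y) = inv_into (T p) f' x + inv_into (T p) f' y"
      by (rule frame_inj[OF f' i(1) T_add[OF i(1) i(1)]]) (simp only: i(2) frame_add[OF f' i(1) i(1)])
    then show ?thesis by (simp only: o_apply frame_add[OF f i(1) i(1)])
  qed
  show "(f \<circ> inv_into (T p) f') (r *\<^sub>R x) = r *\<^sub>R (f \<circ> inv_into (T p) f') x" for r x
  proof -
    have "inv_into (T p) f' (r *\<^sub>R x) = r *\<^sub>R inv_into (T p) f' x"
      by (rule frame_inj[OF f' i(1) T_scale[OF i(1)]]) (simp only: i(2) frame_scale[OF f' i(1)])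
    then show ?thesis by (simp only: o_apply frame_scale[OF f i(1)])
  qed
qed

lemma frame_quotient_apply:
  assumes f: "frame \<A> p f" and f': "frame \<A> p f'" and v: "v \<in> T p"
  shows "matrix (f \<circ> inv_into (T p) f') *v f' v = f v"
proof -
  have 0: "f' (inv_into (T p) f' (f' v)) = f' v" by (rule frame_inv(2)[OF f'])
  have 1: "inv_into (T p) f' (f' v) = v" by (rule frame_inj[OF f' frame_inv(1)[OF f'] v 0])
  have 2: "(\<lambda>x. matrix (f \<circ> inv_into (T p) f') *v x) = f \<circ> inv_into (T p) f'"
    by (rule matrix_vector_mul(2)[OF frame_quotient_linear[OF f f']])
  have "matrix (f \<circ> inv_into (T p) f') *v f' v = (f \<circ> inv_into (T p) f') (f' v)"
    using fun_cong[OF 2, of "f' v"] .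
  then show ?thesis by (simp only: o_apply 1)
qed

lemma frame_quotient_compose:
  assumes F: "frame \<A> p F" and f': "frame \<A> p f'" and f'': "frame \<A> p f''" and A: "\<And>v. v \<in> T p \<Longrightarrow> f' v = A *v f'' v"
  shows "matrix (F \<circ> inv_into (T p) f'') = matrix (F \<circ> inv_into (T p) f') ** A"
proof (rule matrix_eq[THEN iffD2, rule_format])
  fix x
  obtain v where v: "v \<in> T p" "f'' v = x" using frame_surj[OF f''] by blast
  show "matrix (F \<circ> inv_into (T p) f'') *v x = matrix (F \<circ> inv_into (T p) f') ** A *v x"
    using frame_quotient_apply[OF F f'' v(1)] frame_quotient_apply[OF F f' v(1)] v(2) A[OF v(1)]
    by (simp add: matrix_vector_mul_assoc[symmetric])
qed

text \<open>
  A frame adapted to \<open>\<omega>\<close> is \<open>k F\<close> with \<open>k \<in> G\<^sub>2\<close>; it is compared with the frame \<open>k m F\<close> adapted to \<open>\<psi>\<close>,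
  because they differ by \<open>k m k\<^sup>-\<^sup>1\<close>, whose determinant is that of \<open>m\<close>.
\<close>

lemma G2_orientation_conjugate:
  assumes F: "frame \<A> q F" and \<omega>: "\<omega> q = pullback_\<phi>\<^sub>0 \<A> q F" and \<psi>: "\<psi> q = pullback_\<phi>\<^sub>0 \<A> q (\<lambda>v. m *v F v)"
    and m: "invertible m" "det m > 0"
  shows "G2_orientation \<A> \<omega> q \<subseteq> G2_orientation \<A> \<psi> q"
proof
  fix f assume "f \<in> G2_orientation \<A> \<omega> q"
  then obtain f' where f: "frame \<A> q f" and f': "adapted_frame \<A> \<omega> q f'"
    and pos: "det (matrix (f \<circ> inv_into (T q) f')) > 0" unfolding G2_orientation_def by blast
  obtain k where k: "k \<in> G2" "\<forall>v\<in>T q. f' v = k *v F v"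
    using adapted_frames_G2[OF F adapted_frameD(1)[OF f']] adapted_frameD(2)[OF f'] \<omega> by auto
  have ki: "invertible k" by (rule G2_invertible[OF k(1)])
  let ?f = "\<lambda>v. k *v (m *v F v)"
  have ff: "frame \<A> q ?f" by (rule frame_compose[OF frame_compose[OF F m(1)] ki])
  have "\<psi> q = pullback_\<phi>\<^sub>0 \<A> q ?f" unfolding \<psi> by (rule pullback_eqI) (simp add: G2_phi0[OF k(1)])
  then have ad: "adapted_frame \<A> \<psi> q ?f" using ff by (simp add: adapted_frame_def)
  let ?A = "k ** m ** matrix_inv k"
  have A: "?f v = ?A *v f' v" if "v \<in> T q" for v
    using k(2) that by (simp add: matrix_vector_mul_assoc[symmetric] matrix_inv_cancel[OF ki])
  have "det k * det (matrix_inv k) = det (k ** matrix_inv k)" by (simp only: det_mul)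
  also have "\<dots> = 1" by (simp add: matrix_inv_both[OF ki] det_I)
  finally have dA: "det ?A = det m" by (simp add: det_mul mult.assoc mult.left_commute)
  have "matrix (f \<circ> inv_into (T q) f') = matrix (f \<circ> inv_into (T q) ?f) ** ?A"
    by (rule frame_quotient_compose[OF f ff adapted_frameD(1)[OF f'] A])
  then have "0 < det (matrix (f \<circ> inv_into (T q) ?f)) * det m"
    using pos by (simp only: det_mul[of _ ?A] dA)
  then have "0 < det (matrix (f \<circ> inv_into (T q) ?f))" using m(2) by (rule zero_less_mult_pos2)
  then show "f \<in> G2_orientation \<A> \<psi> q" unfolding G2_orientation_def using f ad by blast
qed

end

section \<open>The bijection\<close>

theorem proposition1p2:
  fixes \<A> :: "'a::{t2_space, second_countable_topology} chart set"
    and \<phi> :: "'a form3" and D :: "'a conn"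
    and p :: 'a and f :: "'a tvec \<Rightarrow> real^7"
  assumes "smooth_atlas \<A>"
    and "connected (UNIV :: 'a set)"
    and "torsion_free_G2_structure \<A> \<phi>"
    and "levi_civita \<A> (G2_metric \<A> \<phi>) D"
    and "\<exists>\<psi>\<in>same_metric_G2_structures \<A> \<phi>. adapted_frame \<A> \<psi> p f"
  shows "\<exists>F. (\<forall>h\<in>N_set \<A> D p f.
                F (G2_coset h) = parallel_extension \<A> D p (frame_orbit (frame_act f h))) \<and>
             bij_betw F (G2_coset ` N_set \<A> D p f) (same_metric_G2_structures \<A> \<phi>)"
proof -
  interpret smooth_manifold \<A> by unfold_locales (rule assms(1))
  interpret levi_civita \<A> "G2_metric \<A> \<phi>" D by (rule assms(4))
  interpret smooth_connection \<A> D by unfold_locales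
  let ?\<Gamma> = "same_metric_G2_structures \<A> \<phi>" and ?N = "N_set \<A> D p f"
  have adapted_exists: "\<exists>F. adapted_frame \<A> \<omega> q F" if "G2_structure \<A> \<omega>" for \<omega> q
    using that unfolding G2_structure_def by blast
  have G\<phi>: "G2_structure \<A> \<phi>" using assms(3) by (simp add: torsion_free_G2_structure_def)
  have \<Gamma>D: "G2_structure \<A> \<psi>" "smooth_form3 \<A> \<psi>" "\<And>q. alt3_at \<A> q (\<psi> q)" "parallel_components \<psi>"
    "\<And>q u v. u \<in> T q \<Longrightarrow> v \<in> T q \<Longrightarrow> G2_metric \<A> \<psi> q u v = G2_metric \<A> \<phi> q u v"
    "\<And>q. G2_orientation \<A> \<psi> q = G2_orientation \<A> \<phi> q" if "\<psi> \<in> ?\<Gamma>" for \<psi>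
  proof -
    have tf: "torsion_free_G2_structure \<A> \<psi>" using that by (simp add: same_metric_G2_structures_def)
    show G: "G2_structure \<A> \<psi>" using tf by (simp add: torsion_free_G2_structure_def)
    show sm: "smooth_form3 \<A> \<psi>" using G by (simp add: G2_structure_def)
    show "alt3_at \<A> q (\<psi> q)" for q using sm by (simp add: smooth_form3_def)
    show met: "G2_metric \<A> \<psi> q u v = G2_metric \<A> \<phi> q u v" if "u \<in> T q" "v \<in> T q" for q u v
      using \<open>\<psi> \<in> ?\<Gamma>\<close> that unfolding same_metric_G2_structures_def by blast
    show "G2_orientation \<A> \<psi> q = G2_orientation \<A> \<phi> q" for q
      using \<open>\<psi> \<in> ?\<Gamma>\<close> unfolding same_metric_G2_structures_def by blast
    obtain D' where D': "levi_civita \<A> (G2_metric \<A> \<psi>) D'" "parallel_form3 \<A> D' \<psi>"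
      using tf unfolding torsion_free_G2_structure_def by blast
    have "D q X Y = D' q X Y" if Y: "smooth_vf \<A> W Y" "q \<in> W" "X \<in> T q" for W Y q X
    proof -
      obtain F where F: "adapted_frame \<A> \<phi> q F" using adapted_exists[OF G\<phi>] by blast
      show ?thesis
        by (rule levi_civita_unique[OF assms(4) D'(1) met adapted_frameD(1)[OF F] G2_metric_adapted[OF F] Y])
    qed
    from parallel_form3_cong[OF this D'(2)] show "parallel_components \<psi>"
      by (rule parallel_form3_imp_components[OF sm])
  qed
  obtain \<psi>0 where \<psi>0: "\<psi>0 \<in> ?\<Gamma>" "adapted_frame \<A> \<psi>0 p f" using assms(5) by blast
  note alt0 = \<Gamma>D(3)[OF \<psi>0(1)] and par0 = \<Gamma>D(4)[OF \<psi>0(1)]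
  note f = adapted_frameD[OF \<psi>0(2)]
  have ext: "\<exists>\<psi>\<in>?\<Gamma>. \<psi> p = pullback_\<phi>\<^sub>0 \<A> p (frame_act f h) \<and>
      parallel_extension \<A> D p (frame_orbit (frame_act f h)) = \<psi>" if h: "h \<in> ?N" for h
  proof -
    have rot: "rotation_matrix h" and hol: "\<And>k. k \<in> holonomy_group \<A> D p f \<Longrightarrow> matrix_inv h ** k ** h \<in> G2"
      using h by (auto simp: N_set_def)
    note hi = rotation_inv[OF rot]
    have fr0: "\<exists>F. frame \<A> q F \<and> \<psi>0 q = pullback_\<phi>\<^sub>0 \<A> q F" for q
      using adapted_exists[OF \<Gamma>D(1)[OF \<psi>0(1)]] unfolding adapted_frame_def by blast
    have "\<exists>\<psi>. (\<forall>q. alt3_at \<A> q (\<psi> q)) \<and> parallel_components \<psi> \<and> \<psi> p = pullback_\<phi>\<^sub>0 \<A> p (frame_act f h)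
        \<and> (\<forall>q. \<exists>F. frame \<A> q F \<and> \<psi>0 q = pullback_\<phi>\<^sub>0 \<A> q F \<and> \<psi> q = pullback_\<phi>\<^sub>0 \<A> q (frame_act F h))"
      by (rule holonomy_invariant_form_exists[where \<omega> = \<psi>0, OF assms(2) alt0 par0 fr0 f hi(3)]) (rule hol)
    then obtain \<psi> where alt: "\<forall>q. alt3_at \<A> q (\<psi> q)" and par: "parallel_components \<psi>"
      and \<psi>p: "\<psi> p = pullback_\<phi>\<^sub>0 \<A> p (frame_act f h)"
      and fr: "\<forall>q. \<exists>F. frame \<A> q F \<and> \<psi>0 q = pullback_\<phi>\<^sub>0 \<A> q F \<and> \<psi> q = pullback_\<phi>\<^sub>0 \<A> q (frame_act F h)"
      by (elim exE conjE)
    have sm: "smooth_form3 \<A> \<psi>" by (rule parallel_components_smooth[OF alt[rule_format] par])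
    have pf: "parallel_form3 \<A> D \<psi>" by (rule parallel_components_imp_form3[OF alt[rule_format] par])
    have G: "G2_structure \<A> \<psi>" unfolding G2_structure_def
    proof (intro conjI sm allI)
      fix q
      obtain W0 F0 where W0: "q \<in> W0" "smooth_frame \<A> W0 F0" "\<forall>q\<in>W0. adapted_frame \<A> \<psi>0 q (F0 q)"
        using \<Gamma>D(1)[OF \<psi>0(1)] unfolding G2_structure_def by blast
      show "\<exists>W F. q \<in> W \<and> smooth_frame \<A> W F \<and> (\<forall>q\<in>W. adapted_frame \<A> \<psi> q (F q))"
      proof (rule smooth_adapted_frame_exists[OF sm W0(2,1)])
        fix q' assume q': "q' \<in> W0"
        obtain F where F: "frame \<A> q' F" "\<psi>0 q' = pullback_\<phi>\<^sub>0 \<A> q' F" "\<psi> q' = pullback_\<phi>\<^sub>0 \<A> q' (frame_act F h)"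
          using fr by blast
        have ad: "adapted_frame \<A> \<psi>0 q' (F0 q')" using W0(3) q' by blast
        have "pullback_\<phi>\<^sub>0 \<A> q' (F0 q') = pullback_\<phi>\<^sub>0 \<A> q' F" using adapted_frameD(2)[OF ad] F(2) by simp
        then obtain k where k: "k \<in> G2" "\<forall>v\<in>T q'. F v = k *v F0 q' v"
          using adapted_frames_G2[OF adapted_frameD(1)[OF ad] F(1)] by blast
        show "\<exists>m. orthogonal_matrix m \<and> \<psi> q' = pullback_\<phi>\<^sub>0 \<A> q' (\<lambda>v. m *v F0 q' v)"
        proof (intro exI[of _ "matrix_inv h ** k"] conjI)
          show "orthogonal_matrix (matrix_inv h ** k)" by (rule orthogonal_matrix_mul[OF hi(1) G2_orthogonal[OF k(1)]])
          show "\<psi> q' = pullback_\<phi>\<^sub>0 \<A> q' (\<lambda>v. matrix_inv h ** k *v F0 q' v)"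
            unfolding F(3) by (rule pullback_eqI) (use k(2) in \<open>simp add: frame_act_def matrix_vector_mul_assoc\<close>)
        qed
      qed
    qed
    have met: "G2_metric \<A> \<psi> q u v = G2_metric \<A> \<phi> q u v" if uv: "u \<in> T q" "v \<in> T q" for q u v
    proof -
      obtain F where F: "frame \<A> q F" "\<psi>0 q = pullback_\<phi>\<^sub>0 \<A> q F" "\<psi> q = pullback_\<phi>\<^sub>0 \<A> q (frame_act F h)"
        using fr by blast
      have 1: "adapted_frame \<A> \<psi> q (frame_act F h)" unfolding adapted_frame_def using F(3) frame_act_frame[OF F(1) hi(3)] by blast
      have 2: "adapted_frame \<A> \<psi>0 q F" unfolding adapted_frame_def using F by blast
      have "G2_metric \<A> \<psi> q u v = F u \<bullet> F v"
        unfolding G2_metric_adapted[OF 1 uv] frame_act_def by (rule orthogonal_matrix_inner[OF hi(1)])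
      also have "\<dots> = G2_metric \<A> \<phi> q u v"
        using G2_metric_adapted[OF 2 uv] \<Gamma>D(5)[OF \<psi>0(1) uv] by simp
      finally show ?thesis .
    qed
    have "levi_civita \<A> (G2_metric \<A> \<psi>) D"
    proof unfold_locales
      show "D q (Z q) Y - D q (Y q) Z = lie_bracket \<A> Z Y q" if "smooth_vf \<A> W Z" "smooth_vf \<A> W Y" "q \<in> W" for W Z Y q
        by (rule torsion_zero[OF that])
      fix W Y Z q X assume a: "smooth_vf \<A> W Y" "smooth_vf \<A> W Z" "q \<in> W" "X \<in> T q"
      have "dir_deriv \<A> q X (\<lambda>q. G2_metric \<A> \<psi> q (Y q) (Z q)) = dir_deriv \<A> q X (\<lambda>q. G2_metric \<A> \<phi> q (Y q) (Z q))"
        by (rule dir_deriv_cong[OF smooth_vf_open[OF a(1)] a(3)]) (rule met[OF smooth_vf_tangent[OF a(1)] smooth_vf_tangent[OF a(2)]])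
      also have "\<dots> = G2_metric \<A> \<phi> q (D q X Y) (Z q) + G2_metric \<A> \<phi> q (Y q) (D q X Z)" by (rule metric[OF a])
      finally show "dir_deriv \<A> q X (\<lambda>q. G2_metric \<A> \<psi> q (Y q) (Z q))
          = G2_metric \<A> \<psi> q (D q X Y) (Z q) + G2_metric \<A> \<psi> q (Y q) (D q X Z)"
        unfolding met[OF in_tangent_space[OF a(1,3,4)] smooth_vf_tangent[OF a(2,3)]]
          met[OF smooth_vf_tangent[OF a(1,3)] in_tangent_space[OF a(2,3,4)]] .
    qed
    then have tf: "torsion_free_G2_structure \<A> \<psi>" unfolding torsion_free_G2_structure_def using G pf by blast
    have orient: "G2_orientation \<A> \<psi> q = G2_orientation \<A> \<phi> q" for q
    proof -
      obtain F where F: "frame \<A> q F" "\<psi>0 q = pullback_\<phi>\<^sub>0 \<A> q F" "\<psi> q = pullback_\<phi>\<^sub>0 \<A> q (frame_act F h)"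
        using fr by blast
      have "G2_orientation \<A> \<psi>0 q \<subseteq> G2_orientation \<A> \<psi> q"
        by (rule G2_orientation_conjugate[where \<omega> = \<psi>0 and \<psi> = \<psi> and m = "matrix_inv h", OF F(1,2) F(3)[unfolded frame_act_def] invertible_matrix_inv[OF hi(3)]]) (simp add: hi(2))
      moreover have "G2_orientation \<A> \<psi> q \<subseteq> G2_orientation \<A> \<psi>0 q"
      proof (rule G2_orientation_conjugate[where \<omega> = \<psi> and \<psi> = \<psi>0 and m = h, OF frame_act_frame[OF F(1) hi(3)] F(3) _ hi(3)])
        show "\<psi>0 q = pullback_\<phi>\<^sub>0 \<A> q (\<lambda>v. h *v frame_act F h v)"
          unfolding F(2) by (simp add: frame_act_def matrix_inv_cancel[OF hi(3)])
        show "det h > 0" using rot by (simp add: rotation_matrix_def)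
      qed
      ultimately show ?thesis using \<Gamma>D(6)[OF \<psi>0(1)] by blast
    qed
    have "\<psi> \<in> ?\<Gamma>" unfolding same_metric_G2_structures_def using tf met orient by blast
    moreover have "parallel_extension \<A> D p (frame_orbit (frame_act f h)) = \<psi>"
      unfolding parallel_extension_def
    proof (rule the_equality)
      have "\<psi> p = pullback_\<phi>\<^sub>0 \<A> p f'" if "f' \<in> frame_orbit (frame_act f h)" for f'
        using that pullback_G2 \<psi>p unfolding frame_orbit_def by auto
      then show "smooth_form3 \<A> \<psi> \<and> parallel_form3 \<A> D \<psi> \<and> (\<forall>f\<in>frame_orbit (frame_act f h). \<psi> p = pullback_\<phi>\<^sub>0 \<A> p f)"
        using sm pf by blast
      fix \<psi>' assume \<psi>': "smooth_form3 \<A> \<psi>' \<and> parallel_form3 \<A> D \<psi>' \<and> (\<forall>f\<in>frame_orbit (frame_act f h). \<psi>' p = pullback_\<phi>\<^sub>0 \<A> p f)"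
      have "frame_act (frame_act f h) (mat 1) \<in> frame_orbit (frame_act f h)"
        unfolding frame_orbit_def using G2_one by blast
      then have "\<psi>' p = \<psi> p" using \<psi>' \<psi>p pullback_G2[OF G2_one] by metis
      moreover have "\<And>q. alt3_at \<A> q (\<psi>' q)" using \<psi>' by (simp add: smooth_form3_def)
      moreover have "parallel_components \<psi>'" using \<psi>' parallel_form3_imp_components by blast
      ultimately show "\<psi>' = \<psi>" by (intro parallel_form_unique[OF assms(2) _ _ alt[rule_format] par])
    qed
    ultimately show ?thesis using \<psi>p by blast
  qed
  have Ninv: "invertible h" if "h \<in> ?N" for h
    by (rule rotation_inv(3)) (use that in \<open>simp add: N_set_def\<close>)
  define F where "F C = parallel_extension \<A> D p (frame_act f ` C)" for C
  have FC: "F (G2_coset h) = parallel_extension \<A> D p (frame_orbit (frame_act f h))" if h: "h \<in> ?N" for h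
  proof -
    have "frame_act f ` G2_coset h = frame_orbit (frame_act f h)"
      unfolding G2_coset_def frame_orbit_def image_image
      by (rule image_cong[OF refl]) (simp add: frame_act_mult[OF Ninv[OF h] G2_invertible])
    then show ?thesis by (simp add: F_def)
  qed
  have "bij_betw F (G2_coset ` ?N) ?\<Gamma>"
    unfolding bij_betw_def
  proof
    show "inj_on F (G2_coset ` ?N)"
    proof (rule inj_onI)
      fix C C' assume "C \<in> G2_coset ` ?N" "C' \<in> G2_coset ` ?N" and eq: "F C = F C'"
      then obtain h h' where h: "h \<in> ?N" "C = G2_coset h" and h': "h' \<in> ?N" "C' = G2_coset h'" by blast
      have pe: "pullback_\<phi>\<^sub>0 \<A> p (frame_act f h) = pullback_\<phi>\<^sub>0 \<A> p (frame_act f h')"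
        using ext[OF h(1)] ext[OF h'(1)] eq FC[OF h(1)] FC[OF h'(1)] h(2) h'(2) by metis
      note i = Ninv[OF h(1)] and i' = Ninv[OF h'(1)]
      obtain g where g: "g \<in> G2" "\<forall>v\<in>T p. frame_act f h' v = g *v frame_act f h v"
        using adapted_frames_G2[OF frame_act_frame[OF f(1) i] frame_act_frame[OF f(1) i'] pe] by blast
      have "h = h' ** g"
      proof (rule matrix_eq[THEN iffD2, rule_format])
        fix x
        obtain v where v: "v \<in> T p" "f v = h *v x" using frame_surj[OF f(1)] by blast
        have "matrix_inv h' *v (h *v x) = g *v x"
          using g(2)[rule_format, OF v(1)] by (simp add: frame_act_def v(2) matrix_inv_cancel[OF i])
        then have "h' *v (g *v x) = h *v x" using matrix_inv_cancel(2)[OF i'] by metis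
        then show "h *v x = h' ** g *v x" by (simp add: matrix_vector_mul_assoc)
      qed
      moreover have "(\<lambda>k. (h' ** g) ** k) ` G2 = (\<lambda>k. h' ** k) ` G2"
      proof (intro equalityI image_subsetI)
        fix k assume k: "k \<in> G2"
        show "(h' ** g) ** k \<in> (\<lambda>k. h' ** k) ` G2"
          using G2_mult[OF g(1) k] by (auto simp: matrix_mul_assoc[symmetric])
        have "h' ** k = (h' ** g) ** (matrix_inv g ** k)"
        proof -
          have "(h' ** g) ** (matrix_inv g ** k) = h' ** ((g ** matrix_inv g) ** k)" by (simp only: matrix_mul_assoc)
          then show ?thesis by (simp add: matrix_inv_both[OF G2_invertible[OF g(1)]])
        qed
        then show "h' ** k \<in> (\<lambda>k. (h' ** g) ** k) ` G2" using G2_mult[OF G2_inv[OF g(1)] k] by blast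
      qed
      ultimately show "C = C'" unfolding h(2) h'(2) G2_coset_def by simp
    qed
    show "F ` (G2_coset ` ?N) = ?\<Gamma>"
    proof (intro equalityI subsetI)
      fix \<psi> assume "\<psi> \<in> F ` (G2_coset ` ?N)"
      then obtain h where h: "h \<in> ?N" "\<psi> = F (G2_coset h)" by blast
      show "\<psi> \<in> ?\<Gamma>" using ext[OF h(1)] unfolding h(2) FC[OF h(1)] by blast
    next
      fix \<psi> assume \<psi>: "\<psi> \<in> ?\<Gamma>"
      \<comment> \<open>an adapted frame of \<open>\<psi>\<close> at \<open>p\<close> in the orientation of \<open>f\<close> gives the rotation \<open>h\<close>\<close>
      have "matrix (f \<circ> inv_into (T p) f) = mat 1"
        by (rule matrix_eq[THEN iffD2, rule_format])
          (metis frame_quotient_apply[OF f(1) f(1)] frame_surj[OF f(1)] matrix_vector_mul_lid)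
      then have "f \<in> G2_orientation \<A> \<psi>0 p"
        unfolding G2_orientation_def using f(1) \<psi>0(2) by (auto intro!: exI[of _ f] simp: det_I)
      then have "f \<in> G2_orientation \<A> \<psi> p" using \<Gamma>D(6)[OF \<psi>] \<Gamma>D(6)[OF \<psi>0(1)] by simp
      then obtain f' where f': "adapted_frame \<A> \<psi> p f'" and pos: "det (matrix (f \<circ> inv_into (T p) f')) > 0"
        unfolding G2_orientation_def by blast
      note f'D = adapted_frameD[OF f']
      define h where "h = matrix (f \<circ> inv_into (T p) f')"
      have hf: "h *v f' v = f v" if "v \<in> T p" for v
        unfolding h_def by (rule frame_quotient_apply[OF f(1) f'D(1) that])
      have inner: "(h *v x) \<bullet> (h *v y) = x \<bullet> y" for x y
      proof -
        obtain u where u: "u \<in> T p" "f' u = x" using frame_surj[OF f'D(1)] by blast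
        obtain v where v: "v \<in> T p" "f' v = y" using frame_surj[OF f'D(1)] by blast
        have "f u \<bullet> f v = f' u \<bullet> f' v"
          using G2_metric_adapted[OF \<psi>0(2) u(1) v(1)] G2_metric_adapted[OF f' u(1) v(1)]
            \<Gamma>D(5)[OF \<psi> u(1) v(1)] \<Gamma>D(5)[OF \<psi>0(1) u(1) v(1)] by simp
        then show ?thesis using hf[OF u(1)] hf[OF v(1)] u(2) v(2) by simp
      qed
      have "orthogonal_transformation ((*v) h)"
        unfolding orthogonal_transformation_def using inner by simp
      then have oh: "orthogonal_matrix h" using orthogonal_transformation_matrix[of "(*v) h"] by simp
      then have rot: "rotation_matrix h"
        using pos det_orthogonal_matrix[OF oh] by (auto simp: rotation_matrix_def h_def)
      note hi = rotation_inv(3)[OF rot]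
      have "matrix_inv h ** k ** h \<in> G2" if k: "k \<in> holonomy_group \<A> D p f" for k
      proof -
        obtain \<gamma> where \<gamma>: "pw_path p p \<gamma>" "\<forall>v w. transports \<gamma> v w \<longleftrightarrow> v \<in> T p \<and> w \<in> T p \<and> f w = k *v f v"
          by (rule holonomy_groupE[where \<omega> = \<psi>0, OF alt0 par0 f k])
        obtain k' where k': "k' \<in> G2" "\<forall>v w. transports \<gamma> v w \<longleftrightarrow> v \<in> T p \<and> w \<in> T p \<and> f' w = k' *v f' v"
          using transport_G2[where \<omega> = \<psi>, OF \<Gamma>D(3,4)[OF \<psi>] f'D f'D \<gamma>(1)] by blast
        have "matrix_inv h ** k ** h = k'"
        proof (rule matrix_eq[THEN iffD2, rule_format])
          fix x
          obtain v where v: "v \<in> T p" "f' v = x" using frame_surj[OF f'D(1)] by blast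
          obtain w where w: "transports \<gamma> v w" using transports_exists[OF \<gamma>(1) v(1)] by blast
          have w1: "w \<in> T p" "f w = k *v f v" using w \<gamma>(2) by blast+
          have w2: "f' w = k' *v f' v" using w k'(2) by blast
          have "matrix_inv h ** k ** h *v x = matrix_inv h *v (k *v (h *v x))"
            by (simp only: matrix_vector_mul_assoc matrix_mul_assoc)
          also have "\<dots> = matrix_inv h *v f w" using hf[OF v(1)] v(2) w1(2) by simp
          also have "\<dots> = f' w" unfolding hf[OF w1(1), symmetric] by (rule matrix_inv_cancel(1)[OF hi])
          finally show "matrix_inv h ** k ** h *v x = k' *v x" using w2 v(2) by simp
        qed
        then show ?thesis using k'(1) by simp
      qed
      then have hN: "h \<in> ?N" using rot by (simp add: N_set_def)
      obtain \<psi>1 where \<psi>1: "\<psi>1 \<in> ?\<Gamma>" "\<psi>1 p = pullback_\<phi>\<^sub>0 \<A> p (frame_act f h)"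
        "parallel_extension \<A> D p (frame_orbit (frame_act f h)) = \<psi>1" using ext[OF hN] by blast
      have "pullback_\<phi>\<^sub>0 \<A> p (frame_act f h) = pullback_\<phi>\<^sub>0 \<A> p f'"
        by (rule pullback_eqI) (simp add: frame_act_def hf[symmetric] matrix_inv_cancel[OF hi])
      then have "\<psi>1 p = \<psi> p" using \<psi>1(2) f'D(2) by simp
      then have "\<psi>1 = \<psi>" by (rule parallel_form_unique[OF assms(2) \<Gamma>D(3,4)[OF \<psi>1(1)] \<Gamma>D(3,4)[OF \<psi>]])
      then have "\<psi> = F (G2_coset h)" using FC[OF hN] \<psi>1(3) by simp
      then show "\<psi> \<in> F ` (G2_coset ` ?N)" using hN by blast
    qed
  qed
  then show ?thesis using FC by blast
qed

end
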